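(* Every Abelian child's drawing $\mathcal{D}$ admits a Belyi pair $(X,\gamma)$ defined over $\mathbb{Q}$.
   Context: Let $\mathsf{F}_2$ be the free group on $x,y$. A child's drawing of degree $d$ is an $S_d$-conjugacy class $[\psi]$ of homomorphisms $\psi:\mathsf{F}_2\to S_d$ whose image acts transitively on $\{1,\dots,d\}$. Its monodromy group is $\psi(\mathsf{F}_2)\le S_d$ (defined up to conjugation); the child's drawing is called Abelian if its monodromy group is Abelian. Identify $\mathsf{F}_2$ with $\pi_1(\mathbb{CP}^1\setminus\{0,1,\infty\})$ (base point in the real interval $(0,1)$; $x$ and $y$ are the standard loops around $0$ and $1$). Then child's drawings of degree $d$ correspond bijectively to isomorphism classes of connected degree $d$ coverings of $\mathbb{CP}^1\setminus\{0,1,\infty\}$, equivalently of Belyi pairs $(X,\gamma)$ of degree $d$: $X$ a smooth projective curve over $\overline{\mathbb{Q}}$ and $\gamma:X\to\mathbb{P}^1_{\overline{\mathbb{Q}}}$ a morphism unramified outside $\{0,1,\infty\}$. A child's drawing admits a Belyi pair defined over $\mathbb{Q}$ if it corresponds to a Belyi pair isomorphic to the base change to $\overline{\mathbb{Q}}$ of a curve over $\mathbb{Q}$ with a morphism to $\mathbb{P}^1_{\mathbb{Q}}$. *)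

theory Defs
  imports
    "HOL-Complex_Analysis.Complex_Analysis"
    "HOL-Algebra.Sym_Groups"
    "HOL-Library.Poly_Mapping"
    "HOL-Library.Function_Algebras"
begin

section \<open>The free group on two generators and child's drawings\<close>

text \<open>
  A letter \<open>(s, g)\<close> stands for \<open>g\<close> if \<open>s\<close> holds and for the inverse of \<open>g\<close> otherwise.  The
  elements of the free group are the reduced words.
\<close>

datatype gen = GX | GY

type_synonym letter = "bool \<times> gen"

definition letter_inv :: "letter \<Rightarrow> letter"
  where "letter_inv a = (\<not> fst a, snd a)"

fun reduced :: "letter list \<Rightarrow> bool"
  where
    "reduced [] = True"
  | "reduced [a] = True"
  | "reduced (a # b # w) = (b \<noteq> letter_inv a \<and> reduced (b # w))"

definition push :: "letter \<Rightarrow> letter list \<Rightarrow> letter list"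
  where "push a w = (if w \<noteq> [] \<and> hd w = letter_inv a then tl w else a # w)"

definition F2 :: "letter list monoid"
  where "F2 = \<lparr>carrier = {w. reduced w}, mult = (\<lambda>u w. foldr push u w), one = []\<rparr>"

definition F2_x :: "letter list" where "F2_x = [(True, GX)]"
definition F2_y :: "letter list" where "F2_y = [(True, GY)]"

lemma letter_inv_inv [simp]: "letter_inv (letter_inv a) = a"
  by (simp add: letter_inv_def)

lemma reduced_tl: "reduced w \<Longrightarrow> reduced (tl w)"
  by (induction w rule: reduced.induct) auto

lemma reduced_Cons: "reduced (a # w) \<longleftrightarrow> reduced w \<and> (w \<noteq> [] \<longrightarrow> hd w \<noteq> letter_inv a)"
  by (cases w) auto

lemma reduced_push: "reduced w \<Longrightarrow> reduced (push a w)"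
  by (auto simp: push_def reduced_tl reduced_Cons)

lemma reduced_foldr_push: "reduced w \<Longrightarrow> reduced (foldr push u w)"
  by (induction u) (auto simp: reduced_push)

lemma push_cancel: "reduced w \<Longrightarrow> push (letter_inv a) (push a w) = w"
  by (cases w) (auto simp: push_def reduced_Cons)

lemma foldr_push_Nil: "reduced u \<Longrightarrow> foldr push u [] = u"
  by (induction u) (auto simp: push_def reduced_Cons)

lemma foldr_push_push:
  assumes "reduced w"
  shows "foldr push (push a u) w = push a (foldr push u w)"
proof (cases "u \<noteq> [] \<and> hd u = letter_inv a")
  case True
  then obtain u' where u: "u = letter_inv a # u'"
    by (cases u) auto
  have "push (letter_inv (letter_inv a)) (push (letter_inv a) (foldr push u' w)) = foldr push u' w"
    by (intro push_cancel reduced_foldr_push assms)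
  then show ?thesis
    by (simp add: u push_def[of a "letter_inv a # u'"])
qed (auto simp: push_def[of a u])

lemma foldr_push_assoc:
  assumes "reduced w"
  shows "foldr push (foldr push u v) w = foldr push u (foldr push v w)"
  by (induction u) (simp_all add: foldr_push_push assms)

lemma foldr_push_inverse:
  assumes "reduced u"
  shows "foldr push (foldr push (rev (map letter_inv u)) []) u = []"
proof -
  have "foldr push (rev (map letter_inv u)) u = []"
    using assms
  proof (induction u)
    case (Cons a u)
    then have r: "reduced u" and ih: "foldr push (rev (map letter_inv u)) u = []"
      by (auto simp: reduced_Cons)
    have "push (letter_inv a) (a # u) = u"
      by (simp add: push_def)
    then show ?case using ih by simp
  qed simp
  then show ?thesis using foldr_push_assoc[OF assms, of "rev (map letter_inv u)" "[]"] by simp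
qed

lemma group_F2: "group F2"
proof (rule groupI)
  fix u assume "u \<in> carrier F2"
  then show "\<exists>v\<in>carrier F2. v \<otimes>\<^bsub>F2\<^esub> u = \<one>\<^bsub>F2\<^esub>"
    using foldr_push_inverse[of u] reduced_foldr_push[of "[]" "rev (map letter_inv u)"]
    by (auto simp: F2_def)
qed (auto simp: F2_def reduced_foldr_push foldr_push_assoc)

lemma F2_universal_property:
  assumes "group G" and g: "g \<in> carrier G" "h \<in> carrier G"
  shows "\<exists>\<phi> \<in> hom F2 G. \<phi> F2_x = g \<and> \<phi> F2_y = h"
    and "\<lbrakk>\<phi> \<in> hom F2 G; \<theta> \<in> hom F2 G; \<phi> F2_x = \<theta> F2_x; \<phi> F2_y = \<theta> F2_y; w \<in> carrier F2\<rbrakk>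
      \<Longrightarrow> \<phi> w = \<theta> w"
proof -
  interpret G: group G by fact
  define val where "val a = (case a of (s, GX) \<Rightarrow> if s then g else inv\<^bsub>G\<^esub> g
    | (s, GY) \<Rightarrow> if s then h else inv\<^bsub>G\<^esub> h)" for a
  define ev where "ev w = foldr (\<lambda>a r. val a \<otimes>\<^bsub>G\<^esub> r) w \<one>\<^bsub>G\<^esub>" for w
  have val: "val a \<in> carrier G" for a
    using g by (cases a; cases "snd a") (auto simp: val_def)
  have val_inv: "val (letter_inv a) = inv\<^bsub>G\<^esub> val a" for a
    using g by (cases a; cases "snd a") (auto simp: val_def letter_inv_def)
  have ev_Cons: "ev (a # w) = val a \<otimes>\<^bsub>G\<^esub> ev w" and ev_Nil: "ev [] = \<one>\<^bsub>G\<^esub>" for a w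
    by (simp_all add: ev_def)
  have ev: "ev w \<in> carrier G" for w
    by (induction w) (simp_all add: ev_Cons ev_Nil val)
  have ev_push: "ev (push a w) = val a \<otimes>\<^bsub>G\<^esub> ev w" for a w
  proof (cases "w \<noteq> [] \<and> hd w = letter_inv a")
    case True
    then obtain w' where "w = letter_inv a # w'" by (cases w) auto
    then show ?thesis
      by (simp add: push_def ev_Cons val_inv val ev G.m_assoc[symmetric])
  qed (auto simp: push_def ev_Cons)
  have ev_mult: "ev (foldr push u w) = ev u \<otimes>\<^bsub>G\<^esub> ev w" for u w
    by (induction u) (simp_all add: ev_Cons ev_Nil ev_push val ev G.m_assoc)
  have "ev \<in> hom F2 G"
    by (auto simp: hom_def F2_def ev ev_mult)
  moreover have "ev F2_x = g" "ev F2_y = h"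
    using g by (simp_all add: F2_x_def F2_y_def ev_Cons ev_Nil val_def)
  ultimately show "\<exists>\<phi> \<in> hom F2 G. \<phi> F2_x = g \<and> \<phi> F2_y = h"
    by blast
  assume hom: "\<phi> \<in> hom F2 G" "\<theta> \<in> hom F2 G"
    and eq: "\<phi> F2_x = \<theta> F2_x" "\<phi> F2_y = \<theta> F2_y" and w: "w \<in> carrier F2"
  interpret A: group_hom F2 G \<phi>
    using group_F2 \<open>group G\<close> hom(1) by (simp add: group_hom_def group_hom_axioms_def)
  interpret B: group_hom F2 G \<theta>
    using group_F2 \<open>group G\<close> hom(2) by (simp add: group_hom_def group_hom_axioms_def)
  have inv: "[(False, a)] = inv\<^bsub>F2\<^esub> [(True, a)]" for a
    by (rule group.inv_equality[OF group_F2, symmetric])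
      (auto simp: F2_def push_def letter_inv_def)
  have single: "\<phi> [a] = \<theta> [a]" for a
  proof (cases a)
    case (Pair s c)
    have pos: "\<phi> [(True, c)] = \<theta> [(True, c)]"
      using eq by (cases c) (simp_all add: F2_x_def F2_y_def)
    have "[(True, c)] \<in> carrier F2" by (simp add: F2_def)
    then have "\<phi> [(False, c)] = \<theta> [(False, c)]"
      using pos by (simp add: inv A.hom_inv B.hom_inv)
    then show ?thesis using pos Pair by (cases s) simp_all
  qed
  show "\<phi> w = \<theta> w"
    using w
  proof (induction w)
    case Nil
    then show ?case using A.hom_one B.hom_one by (simp add: F2_def)
  next
    case (Cons a w)
    then have w: "[a] \<in> carrier F2" "w \<in> carrier F2" "a # w = [a] \<otimes>\<^bsub>F2\<^esub> w"
      by (auto simp: F2_def reduced_Cons push_def)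
    show ?case using Cons.IH w single[of a] by (simp add: A.hom_mult B.hom_mult)
  qed
qed

text \<open>The conjugacy class of a homomorphism from the free group to the symmetric group
  on \<open>{1..d}\<close>.\<close>

definition drawing_of :: "nat \<Rightarrow> (letter list \<Rightarrow> nat \<Rightarrow> nat) \<Rightarrow> (letter list \<Rightarrow> nat \<Rightarrow> nat) set"
  where "drawing_of d \<psi> =
    {\<phi> \<in> hom F2 (sym_group d). \<exists>\<sigma> \<in> carrier (sym_group d). \<forall>w \<in> carrier F2.
       \<phi> w = \<sigma> \<otimes>\<^bsub>sym_group d\<^esub> \<psi> w \<otimes>\<^bsub>sym_group d\<^esub> inv\<^bsub>sym_group d\<^esub> \<sigma>}"

definition transitive_hom :: "nat \<Rightarrow> (letter list \<Rightarrow> nat \<Rightarrow> nat) \<Rightarrow> bool"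
  where "transitive_hom d \<psi> \<longleftrightarrow> (\<forall>i \<in> {1..d}. \<forall>j \<in> {1..d}. \<exists>w \<in> carrier F2. \<psi> w i = j)"

definition childs_drawing :: "nat \<Rightarrow> (letter list \<Rightarrow> nat \<Rightarrow> nat) set \<Rightarrow> bool"
  where "childs_drawing d D \<longleftrightarrow>
    d \<ge> 1 \<and> (\<exists>\<psi> \<in> hom F2 (sym_group d). transitive_hom d \<psi> \<and> D = drawing_of d \<psi>)"

text \<open>The monodromy group is defined up to conjugation only, hence the choice of a
  representative, which does not matter.\<close>

definition abelian_drawing :: "nat \<Rightarrow> (letter list \<Rightarrow> nat \<Rightarrow> nat) set \<Rightarrow> bool"
  where "abelian_drawing d D \<longleftrightarrow>
    (\<exists>\<psi> \<in> D. comm_group ((sym_group d)\<lparr>carrier := \<psi> ` carrier F2\<rparr>))"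


section \<open>Projective space\<close>

text \<open>
  The vector space of dimension \<open>N + 1\<close> over the complex numbers consists of the functions that
  vanish beyond index \<open>N\<close>; the points of projective \<open>N\<close>-space are its lines.
\<close>

interpretation cvec: vector_space "\<lambda>(c::complex) (v::nat \<Rightarrow> complex) i. c * v i"
  by unfold_locales (auto simp: fun_eq_iff algebra_simps)

type_synonym point = "(nat \<Rightarrow> complex) set"

definition vecs :: "nat \<Rightarrow> (nat \<Rightarrow> complex) set"
  where "vecs N = {v. \<forall>i>N. v i = 0}"

definition line :: "(nat \<Rightarrow> complex) \<Rightarrow> point"
  where "line v = cvec.span {v}"

definition proj :: "nat \<Rightarrow> point set"
  where "proj N = line ` (vecs N - {0})"

text \<open>The classical (Euclidean) topology on projective space, as a quotient topology.\<close>

definition proj_top :: "nat \<Rightarrow> point topology"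
  where "proj_top N = topology (\<lambda>U. U \<subseteq> proj N \<and>
    openin (top_of_set (vecs N - {0})) {v \<in> vecs N - {0}. line v \<in> U})"

lemma openin_proj_top:
  "openin (proj_top N) U \<longleftrightarrow>
    U \<subseteq> proj N \<and> openin (top_of_set (vecs N - {0})) {v \<in> vecs N - {0}. line v \<in> U}"
proof -
  have "istopology (\<lambda>U. U \<subseteq> proj N \<and>
    openin (top_of_set (vecs N - {0})) {v \<in> vecs N - {0}. line v \<in> U})"
    unfolding istopology_def
  proof (intro conjI allI impI)
    fix S T
    assume S: "S \<subseteq> proj N \<and> openin (top_of_set (vecs N - {0})) {v \<in> vecs N - {0}. line v \<in> S}"
      and T: "T \<subseteq> proj N \<and> openin (top_of_set (vecs N - {0})) {v \<in> vecs N - {0}. line v \<in> T}"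
    show "S \<inter> T \<subseteq> proj N" using S by auto
    have "{v \<in> vecs N - {0}. line v \<in> S \<inter> T} =
      {v \<in> vecs N - {0}. line v \<in> S} \<inter> {v \<in> vecs N - {0}. line v \<in> T}" by auto
    then show "openin (top_of_set (vecs N - {0})) {v \<in> vecs N - {0}. line v \<in> S \<inter> T}"
      using S T by (simp only: openin_Int)
  next
    fix \<K>
    assume K: "\<forall>S\<in>\<K>. S \<subseteq> proj N \<and>
      openin (top_of_set (vecs N - {0})) {v \<in> vecs N - {0}. line v \<in> S}"
    then show "\<Union>\<K> \<subseteq> proj N" by auto
    have "{v \<in> vecs N - {0}. line v \<in> \<Union>\<K>} = (\<Union>S\<in>\<K>. {v \<in> vecs N - {0}. line v \<in> S})" by auto
    then show "openin (top_of_set (vecs N - {0})) {v \<in> vecs N - {0}. line v \<in> \<Union>\<K>}"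
      using K by (simp only:) (rule openin_Union, blast)
  qed
  then show ?thesis
    unfolding proj_top_def by (simp add: topology_inverse')
qed

lemma topspace_proj_top: "topspace (proj_top N) = proj N"
proof -
  have "{v \<in> vecs N - {0}. line v \<in> proj N} = vecs N - {0}"
    by (auto simp: proj_def)
  then have "openin (proj_top N) (proj N)"
    by (simp add: openin_proj_top)
  then show ?thesis
    using openin_proj_top[of N "topspace (proj_top N)"] by (simp add: openin_subset subset_antisym)
qed


section \<open>Homogeneous polynomials\<close>

text \<open>A polynomial in the variables \<open>x\<^sub>0, x\<^sub>1, \<dots>\<close> maps exponent vectors to coefficients.\<close>

type_synonym mpoly = "(nat \<Rightarrow>\<^sub>0 nat) \<Rightarrow>\<^sub>0 complex"

definition mpoly_eval :: "mpoly \<Rightarrow> (nat \<Rightarrow> complex) \<Rightarrow> complex"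
  where "mpoly_eval f v =
    (\<Sum>m \<in> Poly_Mapping.keys f. Poly_Mapping.lookup f m * (\<Prod>i \<in> Poly_Mapping.keys m. v i ^ Poly_Mapping.lookup m i))"

text \<open>Homogeneous polynomials of degree \<open>e\<close> in \<open>x\<^sub>0, \<dots>, x\<^sub>N\<close> with coefficients in \<open>K\<close>
  (the zero polynomial included).\<close>

definition forms :: "complex set \<Rightarrow> nat \<Rightarrow> nat \<Rightarrow> mpoly set"
  where "forms K N e = {f. \<forall>m \<in> Poly_Mapping.keys f.
    Poly_Mapping.lookup f m \<in> K \<and> Poly_Mapping.keys m \<subseteq> {..N} \<and> (\<Sum>i \<in> Poly_Mapping.keys m. Poly_Mapping.lookup m i) = e}"

definition vanishes_at :: "mpoly \<Rightarrow> point \<Rightarrow> bool"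
  where "vanishes_at f L \<longleftrightarrow> (\<forall>v \<in> L. mpoly_eval f v = 0)"

text \<open>The differential of \<open>f\<close> at \<open>p\<close> in the direction \<open>v\<close>, that is
  \<open>\<Sum>i\<le>N. (\<partial>f/\<partial>x\<^sub>i)(p) * v i\<close>.\<close>

definition mpoly_diff :: "mpoly \<Rightarrow> (nat \<Rightarrow> complex) \<Rightarrow> (nat \<Rightarrow> complex) \<Rightarrow> complex"
  where "mpoly_diff f p v = deriv (\<lambda>z. mpoly_eval f (\<lambda>i. p i + z * v i)) 0"


section \<open>Projective varieties over a subfield of the complex numbers\<close>

text \<open>
  Let \<open>K\<close> be a subfield of the complex numbers.  A reduced closed subscheme of projective
  \<open>N\<close>-space over \<open>K\<close> is represented by its set of complex points; by the Nullstellensatz this is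
  a bijection onto the zero sets of homogeneous polynomials over \<open>K\<close>.  As \<open>K\<close> is perfect, base
  change to a larger subfield preserves reducedness, so in this representation it leaves
  the set of complex points, and the map on complex points given by a morphism, unchanged:
  only the field with respect to which they are considered is replaced.
\<close>

definition zariski_closed :: "complex set \<Rightarrow> nat \<Rightarrow> point set \<Rightarrow> bool"
  where "zariski_closed K N X \<longleftrightarrow>
    (\<exists>F \<subseteq> (\<Union>e. forms K N e). X = {L \<in> proj N. \<forall>f \<in> F. vanishes_at f L})"

definition zariski_irreducible :: "complex set \<Rightarrow> nat \<Rightarrow> point set \<Rightarrow> bool"
  where "zariski_irreducible K N X \<longleftrightarrow> zariski_closed K N X \<and> X \<noteq> {} \<and>
    (\<forall>A B. zariski_closed K N A \<and> zariski_closed K N B \<and> X = A \<union> B \<longrightarrow> X = A \<or> X = B)"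

text \<open>The Krull dimension: the supremum of the lengths of chains of irreducible closed subsets.\<close>

definition zariski_dim :: "complex set \<Rightarrow> nat \<Rightarrow> point set \<Rightarrow> enat"
  where "zariski_dim K N X = Sup {enat n | n. \<exists>Z.
    (\<forall>i \<le> n. zariski_irreducible K N (Z i) \<and> Z i \<subseteq> X) \<and> (\<forall>i < n. Z i \<subset> Z (Suc i))}"

definition vanishing_forms :: "complex set \<Rightarrow> nat \<Rightarrow> point set \<Rightarrow> mpoly set"
  where "vanishing_forms K N X = {f \<in> (\<Union>e. forms K N e). \<forall>L \<in> X. vanishes_at f L}"

text \<open>The tangent space at \<open>p\<close> of the affine cone over \<open>X\<close>, i.e. the kernel of the Jacobian matrix
  at \<open>p\<close> of the homogeneous ideal of \<open>X\<close>.  The tangent space of \<open>X\<close> at the point \<open>line p\<close> is its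
  quotient by \<open>line p\<close> (up to a twist by a one-dimensional space).\<close>

definition cone_tangent :: "complex set \<Rightarrow> nat \<Rightarrow> point set \<Rightarrow> (nat \<Rightarrow> complex) \<Rightarrow> (nat \<Rightarrow> complex) set"
  where "cone_tangent K N X p = {v \<in> vecs N. \<forall>f \<in> vanishing_forms K N X. mpoly_diff f p v = 0}"

text \<open>
  Smoothness is the Jacobian criterion at all complex (i.e. geometric) points: the rank of the
  Jacobian is \<open>N - 1\<close>, i.e. its kernel in the space of dimension \<open>N + 1\<close> has dimension \<open>2\<close>.
\<close>

definition smooth_projective_curve :: "complex set \<Rightarrow> nat \<Rightarrow> point set \<Rightarrow> bool"
  where "smooth_projective_curve K N X \<longleftrightarrow>
    zariski_irreducible K N X \<and> zariski_dim K N X = 1 \<and>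
    (\<forall>L \<in> X. \<forall>p \<in> L - {0}. cvec.dim (cone_tangent K N X p) = 2)"

definition form_map :: "nat \<Rightarrow> (nat \<Rightarrow> mpoly) \<Rightarrow> (nat \<Rightarrow> complex) \<Rightarrow> (nat \<Rightarrow> complex)"
  where "form_map M G v = (\<lambda>j. if j \<le> M then mpoly_eval (G j) v else 0)"

text \<open>The map \<open>\<phi>\<close> from \<open>X\<close> to projective \<open>M\<close>-space is given on a Zariski neighbourhood of \<open>L\<close>
  (the complement of \<open>Z\<close>) by homogeneous polynomials \<open>G 0, \<dots>, G M\<close> of the same degree over \<open>K\<close>.\<close>

definition represents_at ::
  "complex set \<Rightarrow> nat \<Rightarrow> point set \<Rightarrow> nat \<Rightarrow> (point \<Rightarrow> point) \<Rightarrow> point \<Rightarrow> (nat \<Rightarrow> mpoly) \<Rightarrow> bool"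
  where "represents_at K N X M \<phi> L G \<longleftrightarrow>
    (\<exists>e. \<forall>j \<le> M. G j \<in> forms K N e) \<and>
    (\<exists>Z. zariski_closed K N Z \<and> L \<in> X - Z \<and>
      (\<forall>L' \<in> X - Z. \<forall>v \<in> L' - {0}. form_map M G v \<noteq> 0 \<and> \<phi> L' = line (form_map M G v)))"

definition morphism ::
  "complex set \<Rightarrow> nat \<Rightarrow> point set \<Rightarrow> nat \<Rightarrow> point set \<Rightarrow> (point \<Rightarrow> point) \<Rightarrow> bool"
  where "morphism K N X M Y \<phi> \<longleftrightarrow>
    \<phi> ` X \<subseteq> Y \<and> (\<forall>L \<in> X. \<exists>G. represents_at K N X M \<phi> L G)"

text \<open>
  A morphism of smooth curves is unramified at a point iff its differential there is injective.
  If \<open>\<phi>\<close> is represented by \<open>G\<close> near \<open>line p\<close>, then its differential is the map induced by the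
  differential of \<open>G\<close> at \<open>p\<close> from \<open>cone_tangent K N X p\<close> modulo \<open>line p\<close> to the vectors modulo
  \<open>line (form_map M G p)\<close>.
\<close>

definition unramified_at ::
  "complex set \<Rightarrow> nat \<Rightarrow> point set \<Rightarrow> nat \<Rightarrow> (point \<Rightarrow> point) \<Rightarrow> point \<Rightarrow> bool"
  where "unramified_at K N X M \<phi> L \<longleftrightarrow>
    (\<exists>G. represents_at K N X M \<phi> L G \<and>
      (\<forall>p \<in> L - {0}. \<forall>v \<in> cone_tangent K N X p.
        (\<lambda>j. if j \<le> M then mpoly_diff (G j) p v else 0) \<in> line (form_map M G p) \<longrightarrow> v \<in> L))"


section \<open>Belyi pairs\<close>

definition affine_pt :: "complex \<Rightarrow> point"
  where "affine_pt z = line (\<lambda>i. if i = 0 then z else if i = 1 then 1 else 0)"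

definition infinity_pt :: point
  where "infinity_pt = line (\<lambda>i. if i = 0 then 1 else 0)"

definition belyi_pair :: "complex set \<Rightarrow> nat \<Rightarrow> point set \<Rightarrow> (point \<Rightarrow> point) \<Rightarrow> bool"
  where "belyi_pair K N X \<gamma> \<longleftrightarrow>
    smooth_projective_curve K N X \<and> morphism K N X 1 (proj 1) \<gamma> \<and>
    \<not> (\<exists>c. \<forall>L \<in> X. \<gamma> L = c) \<and>
    (\<forall>L \<in> X. \<gamma> L \<notin> {affine_pt 0, affine_pt 1, infinity_pt} \<longrightarrow> unramified_at K N X 1 \<gamma> L)"

definition isomorphic_pairs ::
  "complex set \<Rightarrow> nat \<Rightarrow> point set \<Rightarrow> (point \<Rightarrow> point) \<Rightarrow> nat \<Rightarrow> point set \<Rightarrow> (point \<Rightarrow> point) \<Rightarrow> bool"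
  where "isomorphic_pairs K N X \<gamma> M Y \<delta> \<longleftrightarrow>
    (\<exists>\<phi> \<theta>. morphism K N X M Y \<phi> \<and> morphism K M Y N X \<theta> \<and>
      (\<forall>L \<in> X. \<theta> (\<phi> L) = L) \<and> (\<forall>L \<in> Y. \<phi> (\<theta> L) = L) \<and> (\<forall>L \<in> X. \<delta> (\<phi> L) = \<gamma> L))"

text \<open>The path \<open>c\<close> in the affine line lifts, continuously in the classical topology, to a path
  in \<open>X\<close> from \<open>P\<close> to \<open>Q\<close>.\<close>

definition lifts_from_to ::
  "nat \<Rightarrow> point set \<Rightarrow> (point \<Rightarrow> point) \<Rightarrow> (real \<Rightarrow> complex) \<Rightarrow> point \<Rightarrow> point \<Rightarrow> bool"
  where "lifts_from_to N X \<gamma> c P Q \<longleftrightarrow>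
    (\<exists>g. pathin (subtopology (proj_top N) X) g \<and>
      (\<forall>t \<in> {0..1}. \<gamma> (g t) = affine_pt (c t)) \<and> g 0 = P \<and> g 1 = Q)"

text \<open>
  The standard loops \<open>x\<close> and \<open>y\<close> are the positively oriented circles around \<open>0\<close> and \<open>1\<close> through
  the base point \<open>1/2\<close> (the loop \<open>circlepath 1 (-1/2)\<close> starts at \<open>1 - 1/2\<close>).  A Belyi pair corresponds
  to the drawing \<open>D\<close> if for some representative \<open>\<psi>\<close> of \<open>D\<close> and some numbering \<open>b\<close> of the fibre over
  the base point, \<open>x\<close> and \<open>y\<close> act on the fibre by path lifting as \<open>\<psi> x\<close> and \<open>\<psi> y\<close> do on the
  numbers; as the fundamental group is free on \<open>x\<close> and \<open>y\<close>, this determines the whole action.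
\<close>

definition corresponds ::
  "nat \<Rightarrow> (letter list \<Rightarrow> nat \<Rightarrow> nat) set \<Rightarrow> nat \<Rightarrow> point set \<Rightarrow> (point \<Rightarrow> point) \<Rightarrow> bool"
  where "corresponds d D N X \<gamma> \<longleftrightarrow>
    (\<exists>\<psi> \<in> D. \<exists>b. bij_betw b {1..d} {L \<in> X. \<gamma> L = affine_pt (1/2)} \<and>
      (\<forall>i \<in> {1..d}.
        lifts_from_to N X \<gamma> (circlepath 0 (1/2)) (b i) (b (\<psi> F2_x i)) \<and>
        lifts_from_to N X \<gamma> (circlepath 1 (-1/2)) (b i) (b (\<psi> F2_y i))))"

definition Qbar :: "complex set"
  where "Qbar = {z. algebraic z}"

definition admits_belyi_pair_over_Q :: "nat \<Rightarrow> (letter list \<Rightarrow> nat \<Rightarrow> nat) set \<Rightarrow> bool"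
  where "admits_belyi_pair_over_Q d D \<longleftrightarrow>
    (\<exists>N X \<gamma>. belyi_pair Qbar N X \<gamma> \<and> corresponds d D N X \<gamma> \<and>
      (\<exists>M Y \<delta>. smooth_projective_curve \<rat> M Y \<and> morphism \<rat> M Y 1 (proj 1) \<delta> \<and>
        isomorphic_pairs Qbar N X \<gamma> M Y \<delta>))"

end

theory Submission
  imports Defs
begin

text \<open>
  An Abelian transitive pair of permutations \<open>g\<close>, \<open>h\<close> generates a quotient of \<open>\<int>\<^sup>2\<close> of order \<open>d\<close>,
  and the covering that corresponds to it is the quotient of the Fermat curve
  \<open>x\<^sup>d + y\<^sup>d = z\<^sup>d\<close>, with the map \<open>(x / z)\<^sup>d\<close>, by a group \<open>H\<close> of diagonal automorphisms.  The
  monomials of degree \<open>d\<close> invariant under \<open>H\<close> embed this quotient in projective space as a smooth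
  curve.  Its equations, a linear one and binomials, have rational coefficients, and the map is
  a linear projection, so the pair is defined over the rational numbers.

  Near a point where \<open>x\<^sub>i\<close> may vanish and \<open>x\<^sub>j\<close>, \<open>x\<^sub>k\<close> do not, the invariant monomials
  are generated by one monomial containing \<open>x\<^sub>i\<close> to a minimal positive power, and units; this
  gives the equations of the image and its tangent spaces.  Irreducibility and the dimension
  follow from the fact that a form over the algebraic numbers which does not vanish on the curve
  has finitely many zeros on it, all algebraic: they are zeros of its norm to the rational functions
  of \<open>x\<close>.  Finally, the standard loops lift to explicit paths \<open>x = \<rho> \<zeta>\<^sup>a e\<^bsup>2\<pi>it/d\<^esup>\<close>.
\<close>


section \<open>Algebraic numbers\<close>

text \<open>A transitive Abelian permutation group acts regularly, so the stabilizer of the point 1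
  in Z^2 has index d and contains d Z^2. This is why the Fermat curve of degree d, a cover with
  group (Z/d)^2, dominates the wanted covering; H is the stabilizer modulo d. Its quotient needs a
  smooth projective model, and degree d is large enough for one: in each of the three charts,
  generators of the lattice of invariant monomials can be chosen inside the triangle of exponents of
  total degree d. The model is the same point set over the rational and the algebraic numbers, but
  the closed sets differ: over the rational numbers an irreducible proper closed set may consist of
  several conjugate points. Irreducibility and dimension are therefore proved for a general set
  \<open>K\<close> of coefficients, from finiteness and algebraicity of the zeros of forms. That
  finiteness needs the norm to be nonzero, in effect the irreducibility of the affine Fermat curve;
  a limit argument at (1, 0), where the projection to x is totally ramified, provides it.\<close>

interpretation rvec: vector_space "\<lambda>(q::rat) (z::complex). of_rat q * z"
  by unfold_locales (auto simp: algebra_simps of_rat_add of_rat_mult)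

lemma rspan_mult_left:
  assumes "x \<in> rvec.span B" "\<And>b. b \<in> B \<Longrightarrow> z * b \<in> rvec.span C"
  shows "z * x \<in> rvec.span C"
  using assms(1)
proof (induction rule: rvec.span_induct_alt)
  case (step q b y)
  have "of_rat q * (z * b) + z * y \<in> rvec.span C"
    by (intro rvec.span_add rvec.span_scale assms(2) step)
  then show ?case by (simp add: algebra_simps)
qed (use rvec.span_zero in simp)

text \<open>The card B + 1 numbers z^i * b0 lie in a space of dimension at most card B, so they
  satisfy a rational linear relation, and dividing it by b0 gives a polynomial equation for z.
  Linear dependence is a property of sets and does not see repetitions, hence the separate case z^i
  = z^j.\<close>

lemma algebraic_if_stable_span:
  assumes B: "finite B" and b0: "b0 \<in> rvec.span B" "b0 \<noteq> 0"
    and stable: "\<And>b. b \<in> B \<Longrightarrow> z * b \<in> rvec.span B"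
  shows "algebraic z"
proof (cases "inj_on (\<lambda>i. z ^ i * b0) {..card B}")
  case False
  then obtain i j where ij: "i \<noteq> j" "z ^ i * b0 = z ^ j * b0"
    by (auto simp: inj_on_def)
  have "coeff (monom (1::complex) i - monom 1 j) i \<noteq> 0"
    using ij by simp
  then have "monom (1::complex) i - monom 1 j \<noteq> 0"
    by (metis coeff_0)
  moreover have "poly (monom 1 i - monom 1 j) z = 0"
    using ij b0 by (simp add: poly_monom)
  ultimately show ?thesis
    by (intro algebraicI'[of "monom 1 i - monom 1 j"]) auto
next
  case True
  let ?S = "(\<lambda>i. z ^ i * b0) ` {..card B}"
  have pow: "z ^ i * b0 \<in> rvec.span B" for i
    by (induction i) (use b0 rspan_mult_left[OF _ stable] in \<open>auto simp: mult.assoc\<close>)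
  have card: "card ?S = Suc (card B)"
    using True by (simp add: card_image)
  have "rvec.dependent ?S"
    using rvec.independent_span_bound[OF B, of ?S] pow card by fastforce
  then obtain u where u: "\<exists>v\<in>?S. u v \<noteq> 0" "(\<Sum>v\<in>?S. of_rat (u v) * v) = 0"
    by (subst (asm) rvec.dependent_finite) auto
  define p where "p = (\<Sum>i\<le>card B. monom (of_rat (u (z ^ i * b0)) :: complex) i)"
  have coeff: "coeff p i = (if i \<le> card B then of_rat (u (z ^ i * b0)) else 0)" for i
    by (simp add: p_def coeff_sum)
  have "(\<Sum>i\<le>card B. of_rat (u (z ^ i * b0)) * (z ^ i * b0)) = 0"
    using u(2) by (subst (asm) sum.reindex[OF True]) (simp add: o_def)
  then have "poly p z * b0 = 0"
    by (simp add: p_def poly_sum poly_monom sum_distrib_right mult.assoc)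
  moreover have "p \<noteq> 0"
  proof -
    obtain i where "i \<le> card B" "u (z ^ i * b0) \<noteq> 0" using u(1) by auto
    then have "coeff p i \<noteq> 0" by (simp add: coeff)
    then show ?thesis by auto
  qed
  ultimately show ?thesis
    using b0 by (intro algebraicI'[of p]) (auto simp: coeff)
qed

text \<open>The rational span of such a set is a subring of the complex numbers of finite dimension
  over the rational numbers.\<close>

definition fin_alg :: "complex set \<Rightarrow> bool"
  where "fin_alg B \<longleftrightarrow> finite B \<and> 1 \<in> rvec.span B \<and> (\<forall>b\<in>B. \<forall>c\<in>B. b * c \<in> rvec.span B)"

lemma fin_alg_mult:
  assumes "fin_alg B" "x \<in> rvec.span B" "y \<in> rvec.span B"
  shows "x * y \<in> rvec.span B"
proof (rule rspan_mult_left[OF assms(3)])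
  fix b assume "b \<in> B"
  then have "b * x \<in> rvec.span B"
    using assms(1) by (intro rspan_mult_left[OF assms(2)]) (auto simp: fin_alg_def)
  then show "x * b \<in> rvec.span B" by (simp add: mult.commute)
qed

lemma fin_alg_Rats:
  assumes "fin_alg B" "q \<in> \<rat>"
  shows "q \<in> rvec.span B"
  using assms rvec.span_scale[of 1 B] by (auto simp: fin_alg_def Rats_def)

lemma fin_alg_algebraic:
  assumes "fin_alg B" "z \<in> rvec.span B"
  shows "algebraic z"
  using assms fin_alg_mult[OF assms] rvec.span_base
  by (intro algebraic_if_stable_span[of B 1]) (auto simp: fin_alg_def)

text \<open>The products b * z^i with i < n span the larger ring: the monic equation rewrites z^n,
  so their span is stable under multiplication by z.\<close>

lemma fin_alg_adjoin:
  assumes B: "fin_alg B" and c: "\<And>i. i < n \<Longrightarrow> c i \<in> rvec.span B"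
    and z: "z ^ n = (\<Sum>i<n. c i * z ^ i)"
  shows "\<exists>B'. fin_alg B' \<and> rvec.span B \<subseteq> rvec.span B' \<and> z \<in> rvec.span B'"
proof -
  have n: "n > 0"
    using z by (cases n) auto
  define B' where "B' = (\<lambda>(b, i). b * z ^ i) ` (B \<times> {..<n})"
  have fin: "finite B'"
    using B by (simp add: B'_def fin_alg_def)
  have small: "r * z ^ i \<in> rvec.span B'" if "r \<in> rvec.span B" "i < n" for r i
  proof -
    have "z ^ i * b \<in> rvec.span B'" if "b \<in> B" for b
      unfolding B'_def
      by (intro rvec.span_base image_eqI[of _ _ "(b, i)"]) (use that \<open>i < n\<close> in auto)
    from rspan_mult_left[OF that(1) this] show ?thesis by (simp add: mult.commute)
  qed
  have base: "r * m \<in> rvec.span B'" if "r \<in> rvec.span B" "m \<in> rvec.span B'" for r m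
  proof (rule rspan_mult_left[OF that(2)])
    fix b' assume "b' \<in> B'"
    then obtain b i where bi: "b \<in> B" "i < n" "b' = b * z ^ i"
      by (auto simp: B'_def)
    then have "(r * b) * z ^ i \<in> rvec.span B'"
      by (intro small fin_alg_mult[OF B] that rvec.span_base)
    then show "r * b' \<in> rvec.span B'" by (simp add: bi mult.assoc)
  qed
  have step: "z * m \<in> rvec.span B'" if "m \<in> rvec.span B'" for m
  proof (rule rspan_mult_left[OF that])
    fix b' assume "b' \<in> B'"
    then obtain b i where bi: "b \<in> B" "i < n" "b' = b * z ^ i"
      by (auto simp: B'_def)
    have b: "b \<in> rvec.span B" using bi by (simp add: rvec.span_base)
    show "z * b' \<in> rvec.span B'"
    proof (cases "Suc i < n")
      case True
      then show ?thesis using small[OF b True] by (simp add: bi mult_ac)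
    next
      case False
      then have "z * b' = b * z ^ n"
        using bi by (metis Suc_lessI mult.left_commute power_Suc)
      also have "\<dots> = (\<Sum>i<n. (b * c i) * z ^ i)"
        by (simp add: z sum_distrib_left mult.assoc)
      also have "\<dots> \<in> rvec.span B'"
        by (intro rvec.span_sum small fin_alg_mult[OF B] b c) auto
      finally show ?thesis .
    qed
  qed
  have pow: "z ^ i * m \<in> rvec.span B'" if "m \<in> rvec.span B'" for m i
    by (induction i) (use that step in \<open>auto simp: mult.assoc\<close>)
  have one: "1 \<in> rvec.span B'"
    using small[of 1 0] n B by (simp add: fin_alg_def)
  have "b * c \<in> rvec.span B'" if "b \<in> B'" "c \<in> B'" for b c
  proof -
    obtain b1 i where "b1 \<in> B" "b = b1 * z ^ i" using \<open>b \<in> B'\<close> by (auto simp: B'_def)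
    then show ?thesis
      using base[of b1 "z ^ i * c"] pow[of c i] that by (auto simp: mult.assoc rvec.span_base)
  qed
  then have "fin_alg B'"
    using fin one by (auto simp: fin_alg_def)
  moreover have "rvec.span B \<subseteq> rvec.span B'"
    using small[of _ 0] n by auto
  ultimately show ?thesis
    using step[OF one] by auto
qed

lemma monic_relation:
  fixes p :: "'a::field poly"
  assumes "p \<noteq> 0" "poly p z = 0"
  shows "z ^ degree p = (\<Sum>i<degree p. (- (coeff p i * inverse (lead_coeff p))) * z ^ i)"
proof -
  have "0 = (\<Sum>i<degree p. coeff p i * z ^ i) + lead_coeff p * z ^ degree p"
    using assms(2) by (simp add: poly_altdef lessThan_Suc_atMost[symmetric])
  then have "lead_coeff p * z ^ degree p = - (\<Sum>i<degree p. coeff p i * z ^ i)"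
    by (simp add: eq_neg_iff_add_eq_0 add.commute)
  then have "z ^ degree p = - (\<Sum>i<degree p. coeff p i * z ^ i) * inverse (lead_coeff p)"
    using assms(1) by (simp add: field_simps)
  then show ?thesis
    by (simp add: sum_distrib_right sum_negf mult_ac sum_distrib_left)
qed

lemma fin_alg_adjoin_finite:
  assumes "finite A" "\<And>a. a \<in> A \<Longrightarrow> algebraic a"
  shows "\<exists>B. fin_alg B \<and> A \<subseteq> rvec.span B"
  using assms
proof (induction)
  case empty
  have "fin_alg {1}" using rvec.span_base[of 1 "{1}"] by (simp add: fin_alg_def)
  then show ?case by auto
next
  case (insert a A)
  then obtain B where B: "fin_alg B" "A \<subseteq> rvec.span B" by auto
  obtain p where p: "\<And>i. coeff p i \<in> \<rat>" "p \<noteq> 0" "poly p a = 0"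
    using insert.prems[of a] by (auto simp: algebraic_altdef)
  have "- (coeff p i * inverse (lead_coeff p)) \<in> rvec.span B" for i
    using p(1) by (intro fin_alg_Rats[OF B(1)]) auto
  from fin_alg_adjoin[OF B(1) this monic_relation[OF p(2,3)]] B(2) show ?case
    by blast
qed

lemma algebraic_add:
  fixes x y :: complex
  assumes "algebraic x" "algebraic y"
  shows "algebraic (x + y)"
proof -
  obtain B where "fin_alg B" "{x, y} \<subseteq> rvec.span B"
    using fin_alg_adjoin_finite[of "{x, y}"] assms by auto
  then show ?thesis using rvec.span_add[of x B y] fin_alg_algebraic[of B] by simp
qed

lemma algebraic_mult:
  fixes x y :: complex
  assumes "algebraic x" "algebraic y"
  shows "algebraic (x * y)"
proof -
  obtain B where "fin_alg B" "{x, y} \<subseteq> rvec.span B"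
    using fin_alg_adjoin_finite[of "{x, y}"] assms by auto
  then show ?thesis using fin_alg_mult[of B x y] fin_alg_algebraic[of B] by simp
qed

text \<open>Divided by the leading coefficient, the equation is monic over a finite-dimensional ring
  that contains its coefficients, and z can be adjoined to that ring.\<close>

lemma algebraic_root_of_algebraic_poly:
  fixes z :: complex
  assumes "\<And>i. algebraic (coeff p i)" "p \<noteq> 0" "poly p z = 0"
  shows "algebraic z"
proof -
  have "finite ((\<lambda>i. - (coeff p i * inverse (lead_coeff p))) ` {..<degree p})" by simp
  moreover have "algebraic (- (coeff p i * inverse (lead_coeff p)))" for i
    using assms(1) by (auto intro!: algebraic_mult)
  ultimately obtain B where "fin_alg B"
    "(\<lambda>i. - (coeff p i * inverse (lead_coeff p))) ` {..<degree p} \<subseteq> rvec.span B"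
    using fin_alg_adjoin_finite by (metis (no_types, lifting) imageE)
  then show ?thesis
    using fin_alg_adjoin[OF _ _ monic_relation[OF assms(2,3)], of B] fin_alg_algebraic by blast
qed

lemma algebraic_power: "algebraic x \<Longrightarrow> algebraic ((x::complex) ^ m)"
  by (induction m) (auto intro: algebraic_mult rat_imp_algebraic)

lemma algebraic_prod: "(\<And>i. i \<in> I \<Longrightarrow> algebraic (f i :: complex)) \<Longrightarrow> algebraic (\<Prod>i\<in>I. f i)"
  by (induction I rule: infinite_finite_induct) (auto intro: algebraic_mult rat_imp_algebraic)

lemma algebraic_sum: "(\<And>i. i \<in> I \<Longrightarrow> algebraic (f i :: complex)) \<Longrightarrow> algebraic (\<Sum>i\<in>I. f i)"
  by (induction I rule: infinite_finite_induct) (auto intro: algebraic_add)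


text \<open>Serves two coefficient sets: the rational numbers, and the polynomials in x with
  algebraic coefficients.\<close>

lemma coeff_prod_closed:
  fixes f :: "'i \<Rightarrow> 'a::comm_semiring_1 poly"
  assumes S: "0 \<in> S" "1 \<in> S" "\<And>x y. x \<in> S \<Longrightarrow> y \<in> S \<Longrightarrow> x + y \<in> S"
      "\<And>x y. x \<in> S \<Longrightarrow> y \<in> S \<Longrightarrow> x * y \<in> S"
    and f: "\<And>i n. i \<in> I \<Longrightarrow> coeff (f i) n \<in> S"
  shows "coeff (\<Prod>i\<in>I. f i) n \<in> S"
  using f
proof (induction I arbitrary: n rule: infinite_finite_induct)
  case (insert i I)
  have sum: "(\<Sum>j\<in>J. g j) \<in> S" if "\<And>j. j \<in> J \<Longrightarrow> g j \<in> S" for J :: "nat set" and g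
    using that by (induction J rule: infinite_finite_induct) (auto intro: S)
  have "coeff (f i * (\<Prod>i\<in>I. f i)) n \<in> S"
    unfolding coeff_mult using insert by (intro sum S) auto
  then show ?case using insert by simp
qed (auto simp: S coeff_1)

lemma algebraic_nth_root:
  assumes "n > 0" "algebraic (x ^ n)"
  shows "algebraic (x :: complex)"
proof (rule algebraic_root[OF assms(2), of "monom 1 n"])
  show "poly (monom 1 n) x = x ^ n" by (simp add: poly_monom)
qed (use assms(1) in \<open>auto simp: degree_monom_eq\<close>)

text \<open>Treats both fields of definition at once. Subtraction of forms uses the scalar -1, which
  \<open>K\<close> contains because it contains the rational numbers.\<close>

locale algebraic_coeffs =
  fixes K :: "complex set"
  assumes Rats: "\<rat> \<subseteq> K" and Qbar: "K \<subseteq> Qbar"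
    and add: "x \<in> K \<Longrightarrow> y \<in> K \<Longrightarrow> x + y \<in> K"
    and mult: "x \<in> K \<Longrightarrow> y \<in> K \<Longrightarrow> x * y \<in> K"

lemma algebraic_coeffs_Rats: "algebraic_coeffs \<rat>"
  by unfold_locales (auto simp: Qbar_def rat_imp_algebraic)

lemma algebraic_coeffs_Qbar: "algebraic_coeffs Qbar"
  by unfold_locales (auto simp: Qbar_def rat_imp_algebraic algebraic_add algebraic_mult)

lemma (in algebraic_coeffs) algebraic_K: "x \<in> K \<Longrightarrow> algebraic x"
  using Qbar by (auto simp: Qbar_def)


section \<open>Forms and projective sets\<close>

text \<open>Forms are handled as functions on vectors instead of elements of \<open>mpoly\<close>,
  so that sums, products and powers can be written directly as terms.\<close>

definition is_form :: "complex set \<Rightarrow> nat \<Rightarrow> nat \<Rightarrow> ((nat \<Rightarrow> complex) \<Rightarrow> complex) \<Rightarrow> bool"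
  where "is_form K N e F \<longleftrightarrow> (\<exists>f\<in>forms K N e. mpoly_eval f = F)"

definition vanishes_on :: "((nat \<Rightarrow> complex) \<Rightarrow> complex) \<Rightarrow> point \<Rightarrow> bool"
  where "vanishes_on F L \<longleftrightarrow> (\<forall>v\<in>L. F v = 0)"

text \<open>Here every monomial is a product over all coordinates up to \<open>N\<close> and not
  only over its support, so that two expansions can be multiplied factor by factor.\<close>

lemma is_form_expand:
  assumes "is_form K N e F"
  shows "\<exists>S c n. finite S \<and> (\<forall>m\<in>S. c m \<in> K \<and> (\<Sum>i\<le>N. n m i) = e) \<and>
    F = (\<lambda>v. \<Sum>m\<in>(S :: (nat \<Rightarrow>\<^sub>0 nat) set). c m * (\<Prod>i\<le>N. v i ^ n m i))"
proof -
  obtain f where f: "f \<in> forms K N e" and F: "F = mpoly_eval f"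
    using assms by (auto simp: is_form_def)
  have keys: "Poly_Mapping.keys m \<subseteq> {..N}" "Poly_Mapping.lookup f m \<in> K"
    "(\<Sum>i\<in>Poly_Mapping.keys m. Poly_Mapping.lookup m i) = e" if "m \<in> Poly_Mapping.keys f" for m
    using f that by (auto simp: forms_def)
  have "(\<Prod>i\<in>Poly_Mapping.keys m. v i ^ Poly_Mapping.lookup m i) = (\<Prod>i\<le>N. v i ^ Poly_Mapping.lookup m i)"
    if "m \<in> Poly_Mapping.keys f" for v :: "nat \<Rightarrow> complex" and m
    by (intro prod.mono_neutral_left) (use keys that in \<open>auto simp: in_keys_iff\<close>)
  then have "F = (\<lambda>v. \<Sum>m\<in>Poly_Mapping.keys f. Poly_Mapping.lookup f m *
    (\<Prod>i\<le>N. v i ^ Poly_Mapping.lookup m i))"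
    by (simp add: F mpoly_eval_def fun_eq_iff)
  moreover have "(\<Sum>i\<le>N. Poly_Mapping.lookup m i) = e" if "m \<in> Poly_Mapping.keys f" for m
    unfolding keys(3)[OF that, symmetric]
    by (intro sum.mono_neutral_right) (use keys that in \<open>auto simp: in_keys_iff\<close>)
  ultimately show ?thesis
    using keys(2) by (intro exI[of _ "Poly_Mapping.keys f"] exI[of _ "Poly_Mapping.lookup f"]
      exI[of _ Poly_Mapping.lookup]) auto
qed

lemma is_form_homogeneous:
  assumes "is_form K N e F"
  shows "F (\<lambda>i. a * v i) = a ^ e * F v"
proof -
  obtain S c n where S: "\<forall>m\<in>S. c m \<in> K \<and> (\<Sum>i\<le>N. n m i) = e"
    and F: "F = (\<lambda>v. \<Sum>m\<in>(S :: (nat \<Rightarrow>\<^sub>0 nat) set). c m * (\<Prod>i\<le>N. v i ^ n m i))"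
    using is_form_expand[OF assms] by blast
  have "(\<Prod>i\<le>N. (a * v i) ^ n m i) = a ^ e * (\<Prod>i\<le>N. v i ^ n m i)" if "m \<in> S" for m
    using S that by (simp add: power_mult_distrib prod.distrib power_sum[symmetric])
  then show ?thesis by (simp add: F sum_distrib_left mult_ac)
qed

lemma mpoly_eval_superset:
  assumes "finite S" "Poly_Mapping.keys f \<subseteq> S"
  shows "mpoly_eval f v =
    (\<Sum>m\<in>S. Poly_Mapping.lookup f m * (\<Prod>i\<in>Poly_Mapping.keys m. v i ^ Poly_Mapping.lookup m i))"
  unfolding mpoly_eval_def
  by (intro sum.mono_neutral_left) (use assms in \<open>auto simp: in_keys_iff\<close>)

lemma is_form_monomial:
  assumes "c \<in> K" "(\<Sum>i\<le>N. n i) = e"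
  shows "is_form K N e (\<lambda>v. c * (\<Prod>i\<le>N. v i ^ n i))"
proof -
  define m where "m = (\<Sum>i\<le>N. Poly_Mapping.single i (n i))"
  define f where "f = Poly_Mapping.single m c"
  have lookup: "Poly_Mapping.lookup m i = (if i \<le> N then n i else 0)" for i
    by (simp add: m_def lookup_sum lookup_single when_def)
  have keys: "Poly_Mapping.keys m = {i. i \<le> N \<and> n i \<noteq> 0}"
    by (auto simp: in_keys_iff lookup split: if_splits)
  have "(\<Sum>i\<in>Poly_Mapping.keys m. Poly_Mapping.lookup m i) = e"
    unfolding assms(2)[symmetric] keys
    by (intro sum.mono_neutral_cong_left) (auto simp: lookup)
  then have "f \<in> forms K N e"
    using assms(1) by (auto simp: forms_def f_def keys split: if_splits)
  moreover have "mpoly_eval f v = c * (\<Prod>i\<le>N. v i ^ n i)" for v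
  proof -
    have "mpoly_eval f v = c * (\<Prod>i\<in>Poly_Mapping.keys m. v i ^ Poly_Mapping.lookup m i)"
      by (subst mpoly_eval_superset[of "{m}"]) (auto simp: f_def)
    also have "(\<Prod>i\<in>Poly_Mapping.keys m. v i ^ Poly_Mapping.lookup m i) = (\<Prod>i\<le>N. v i ^ n i)"
      unfolding keys by (intro prod.mono_neutral_cong_left) (auto simp: lookup)
    finally show ?thesis .
  qed
  ultimately show ?thesis by (auto simp: is_form_def)
qed

context algebraic_coeffs
begin

lemma is_form_add:
  assumes "is_form K N e F" "is_form K N e G"
  shows "is_form K N e (\<lambda>v. F v + G v)"
proof -
  obtain f g where fg: "f \<in> forms K N e" "g \<in> forms K N e" "F = mpoly_eval f" "G = mpoly_eval g"
    using assms by (auto simp: is_form_def)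
  have sub: "Poly_Mapping.keys (f + g) \<subseteq> Poly_Mapping.keys f \<union> Poly_Mapping.keys g"
    by (rule keys_add)
  have zero: "0 \<in> K" using Rats by auto
  have in_K: "Poly_Mapping.lookup h m \<in> K" if "h \<in> forms K N e" for h m
    using that zero by (cases "m \<in> Poly_Mapping.keys h") (auto simp: forms_def in_keys_iff)
  have "Poly_Mapping.keys m \<subseteq> {..N} \<and> (\<Sum>i\<in>Poly_Mapping.keys m. Poly_Mapping.lookup m i) = e"
    if "m \<in> Poly_Mapping.keys (f + g)" for m
  proof -
    from that sub have "m \<in> Poly_Mapping.keys f \<or> m \<in> Poly_Mapping.keys g" by blast
    then show ?thesis using fg(1,2) unfolding forms_def by blast
  qed
  moreover have "Poly_Mapping.lookup (f + g) m \<in> K" for m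
    unfolding lookup_add by (intro add in_K[of f] in_K[of g] fg)
  ultimately have "f + g \<in> forms K N e"
    unfolding forms_def by blast
  moreover have "mpoly_eval (f + g) v = F v + G v" for v
    using sub mpoly_eval_superset[of "Poly_Mapping.keys f \<union> Poly_Mapping.keys g" f v]
      mpoly_eval_superset[of "Poly_Mapping.keys f \<union> Poly_Mapping.keys g" g v]
      mpoly_eval_superset[of "Poly_Mapping.keys f \<union> Poly_Mapping.keys g" "f + g" v]
    by (simp add: fg lookup_add algebra_simps sum.distrib)
  ultimately show ?thesis by (auto simp: is_form_def)
qed

lemma is_form_zero: "is_form K N e (\<lambda>v. 0)"
  unfolding is_form_def
  by (rule bexI[of _ "0 :: mpoly"]) (auto simp: forms_def mpoly_eval_def fun_eq_iff)

lemma is_form_sum: "(\<And>i. i \<in> I \<Longrightarrow> is_form K N e (F i)) \<Longrightarrow> is_form K N e (\<lambda>v. \<Sum>i\<in>I. F i v)"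
  by (induction I rule: infinite_finite_induct) (auto simp: is_form_zero is_form_add)

lemma is_form_mult:
  assumes "is_form K N e F" "is_form K N e' G"
  shows "is_form K N (e + e') (\<lambda>v. F v * G v)"
proof -
  obtain S c n where S: "\<forall>m\<in>S. c m \<in> K \<and> (\<Sum>i\<le>N. n m i) = e"
    and F: "F = (\<lambda>v. \<Sum>m\<in>(S :: (nat \<Rightarrow>\<^sub>0 nat) set). c m * (\<Prod>i\<le>N. v i ^ n m i))"
    using is_form_expand[OF assms(1)] by blast
  obtain S' c' n' where S': "\<forall>m\<in>S'. c' m \<in> K \<and> (\<Sum>i\<le>N. n' m i) = e'"
    and G: "G = (\<lambda>v. \<Sum>m\<in>(S' :: (nat \<Rightarrow>\<^sub>0 nat) set). c' m * (\<Prod>i\<le>N. v i ^ n' m i))"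
    using is_form_expand[OF assms(2)] by blast
  have "(\<lambda>v. F v * G v) = (\<lambda>v. \<Sum>m\<in>S. \<Sum>m'\<in>S'. (c m * c' m') * (\<Prod>i\<le>N. v i ^ (n m i + n' m' i)))"
    unfolding F G fun_eq_iff sum_product power_add prod.distrib
    by (intro allI sum.cong refl) (simp add: mult_ac)
  moreover have "is_form K N (e + e') \<dots>"
    using S S' by (intro is_form_sum is_form_monomial) (auto simp: sum.distrib intro: mult)
  ultimately show ?thesis by simp
qed

lemma is_form_const: "c \<in> K \<Longrightarrow> is_form K N 0 (\<lambda>v. c)"
  using is_form_monomial[of c K "\<lambda>_. 0" N 0] by simp

lemma is_form_coord:
  assumes "j \<le> N"
  shows "is_form K N 1 (\<lambda>v. v j)"
proof -
  have "1 \<in> K" using Rats by auto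
  then have "is_form K N 1 (\<lambda>v. 1 * (\<Prod>i\<le>N. v i ^ (if i = j then 1 else 0)))"
    using assms by (intro is_form_monomial) auto
  moreover have "(\<Prod>i\<le>N. v i ^ (if i = j then 1 else 0)) = v j" for v :: "nat \<Rightarrow> complex"
    using assms prod.delta[of "{..N}" j v] by (simp add: if_distrib cong: if_cong)
  ultimately show ?thesis by simp
qed

lemma is_form_power: "is_form K N e F \<Longrightarrow> is_form K N (m * e) (\<lambda>v. F v ^ m)"
proof (induction m)
  case 0
  have "1 \<in> K" using Rats by auto
  then show ?case by (simp add: is_form_const)
qed (auto intro: is_form_mult)

lemma is_form_cmult: "c \<in> K \<Longrightarrow> is_form K N e F \<Longrightarrow> is_form K N e (\<lambda>v. c * F v)"
  using is_form_mult[OF is_form_const] by fastforce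

lemma is_form_diff:
  assumes "is_form K N e F" "is_form K N e G"
  shows "is_form K N e (\<lambda>v. F v - G v)"
proof -
  have "-1 \<in> K" using Rats by auto
  then have "is_form K N e (\<lambda>v. F v + (-1) * G v)"
    by (intro is_form_add is_form_cmult assms)
  then show ?thesis by simp
qed

end

section \<open>Derivatives of polynomials along a direction\<close>

lemma mpoly_diff_eq:
  "mpoly_diff f p q = (\<Sum>m\<in>Poly_Mapping.keys f. Poly_Mapping.lookup f m * (\<Sum>i\<in>Poly_Mapping.keys m.
    (of_nat (Poly_Mapping.lookup m i) * (q i * p i ^ (Poly_Mapping.lookup m i - Suc 0))) *
    (\<Prod>j\<in>Poly_Mapping.keys m - {i}. p j ^ Poly_Mapping.lookup m j)))"
proof -
  have q: "((\<lambda>z. p i + z * q i) has_field_derivative q i) (at 0)" for i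
    by (auto intro!: derivative_eq_intros)
  have "((\<lambda>z. mpoly_eval f (\<lambda>i. p i + z * q i)) has_field_derivative
    (\<Sum>m\<in>Poly_Mapping.keys f. Poly_Mapping.lookup f m * (\<Sum>i\<in>Poly_Mapping.keys m.
    (of_nat (Poly_Mapping.lookup m i) * (q i * (p i + 0 * q i) ^ (Poly_Mapping.lookup m i - Suc 0))) *
    (\<Prod>j\<in>Poly_Mapping.keys m - {i}. (p j + 0 * q j) ^ Poly_Mapping.lookup m j)))) (at 0)"
    unfolding mpoly_eval_def
    by (intro DERIV_sum DERIV_cmult has_field_derivative_prod DERIV_power q)
  then show ?thesis by (simp add: mpoly_diff_def DERIV_imp_deriv)
qed

lemma mpoly_diff_linear:
  "mpoly_diff f p (\<lambda>i. a * u i + b * v i) = a * mpoly_diff f p u + b * mpoly_diff f p v"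
proof -
  have "(\<Sum>i\<in>I. (n i * ((a * u i + b * v i) * x i)) * y i) =
      a * (\<Sum>i\<in>I. (n i * (u i * x i)) * y i) + b * (\<Sum>i\<in>I. (n i * (v i * x i)) * y i)"
    for I :: "nat set" and n x y :: "nat \<Rightarrow> complex"
    by (simp add: sum_distrib_left sum.distrib[symmetric] algebra_simps)
  then show ?thesis
    unfolding mpoly_diff_eq by (simp add: sum_distrib_left sum.distrib[symmetric] algebra_simps)
qed

text \<open>\<open>mpoly_diff\<close> is defined along straight lines; by the explicit formula every
  curve with the same velocity gives the same value.\<close>

lemma mpoly_eval_has_field_derivative:
  assumes "\<And>i. ((\<lambda>z. w z i) has_field_derivative q i) (at z0)"
  shows "((\<lambda>z. mpoly_eval f (w z)) has_field_derivative mpoly_diff f (w z0) q) (at z0)"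
  unfolding mpoly_diff_eq mpoly_eval_def
  by (intro DERIV_sum DERIV_cmult has_field_derivative_prod DERIV_power assms)

section \<open>Points of projective space and Zariski closed sets\<close>

lemma line_eq: "line v = {\<lambda>i. a * v i | a. True}"
  by (auto simp: line_def cvec.span_singleton)

lemma line_self: "v \<in> line v"
  by (auto simp: line_eq intro!: exI[of _ 1])

lemma line_eq_line:
  assumes "w \<in> line v" "w \<noteq> 0"
  shows "line w = line v"
proof -
  obtain a where w: "w = (\<lambda>i. a * v i)" using assms by (auto simp: line_eq)
  with assms have "a \<noteq> 0" by (auto simp: fun_eq_iff)
  then have v: "v = (\<lambda>i. inverse a * w i)"
    unfolding w by (intro ext) simp
  have sub: "line w \<subseteq> line v" if "w = (\<lambda>i. a * v i)" for v w a
  proof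
    fix x assume "x \<in> line w"
    then obtain b where x: "x = (\<lambda>i. b * w i)" unfolding line_eq by blast
    have "x = (\<lambda>i. (b * a) * v i)" unfolding x that by (intro ext) (rule mult.assoc[symmetric])
    then show "x \<in> line v" unfolding line_eq by blast
  qed
  show ?thesis using sub[OF w] sub[OF v] by (rule subset_antisym)
qed

lemma proj_memD:
  assumes "L \<in> proj N" "v \<in> L"
  shows "v \<in> vecs N" "v \<noteq> 0 \<Longrightarrow> L = line v"
proof -
  obtain u where u: "u \<in> vecs N" "L = line u" using assms by (auto simp: proj_def)
  show "v \<in> vecs N" using u assms by (auto simp: line_eq vecs_def)
  show "v \<noteq> 0 \<Longrightarrow> L = line v" using line_eq_line u assms by metis
qed

lemma proj_rep:
  assumes "L \<in> proj N"
  obtains v where "v \<in> L" "v \<noteq> 0" "v \<in> vecs N" "L = line v"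
  using assms line_self by (auto simp: proj_def)

lemma vanishes_on_line:
  assumes "is_form K N e F"
  shows "vanishes_on F (line v) \<longleftrightarrow> F v = 0"
  using line_self[of v] is_form_homogeneous[OF assms]
  by (auto simp: vanishes_on_def line_eq)

lemma vanishes_on_rep:
  assumes "is_form K N e F" "L \<in> proj N" "v \<in> L" "v \<noteq> 0"
  shows "vanishes_on F L \<longleftrightarrow> F v = 0"
  using vanishes_on_line[OF assms(1), of v] proj_memD[OF assms(2,3)] assms(4) by simp

lemma zariski_closed_iff:
  "zariski_closed K N X \<longleftrightarrow>
    (\<exists>\<F>. (\<forall>F\<in>\<F>. \<exists>e. is_form K N e F) \<and> X = {L \<in> proj N. \<forall>F\<in>\<F>. vanishes_on F L})"
proof
  assume "zariski_closed K N X"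
  then obtain S where "S \<subseteq> (\<Union>e. forms K N e)" "X = {L \<in> proj N. \<forall>f \<in> S. vanishes_at f L}"
    unfolding zariski_closed_def by blast
  then show "\<exists>\<F>. (\<forall>F\<in>\<F>. \<exists>e. is_form K N e F) \<and> X = {L \<in> proj N. \<forall>F\<in>\<F>. vanishes_on F L}"
    by (intro exI[of _ "mpoly_eval ` S"])
      (simp add: is_form_def vanishes_on_def vanishes_at_def subset_iff, blast)
next
  assume "\<exists>\<F>. (\<forall>F\<in>\<F>. \<exists>e. is_form K N e F) \<and> X = {L \<in> proj N. \<forall>F\<in>\<F>. vanishes_on F L}"
  then obtain \<F> where F: "\<forall>F\<in>\<F>. \<exists>e. is_form K N e F" "X = {L \<in> proj N. \<forall>F\<in>\<F>. vanishes_on F L}"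
    by auto
  define S where "S = {f \<in> (\<Union>e. forms K N e). mpoly_eval f \<in> \<F>}"
  have "mpoly_eval ` S = \<F>" using F(1) by (fastforce simp: S_def is_form_def)
  then have "X = {L \<in> proj N. \<forall>f \<in> S. vanishes_at f L}"
    unfolding F(2) by (auto simp: vanishes_on_def vanishes_at_def)
  then show "zariski_closed K N X"
    unfolding zariski_closed_def by (intro exI[of _ S]) (auto simp: S_def)
qed

lemma zariski_closed_subset_proj: "zariski_closed K N X \<Longrightarrow> X \<subseteq> proj N"
  by (auto simp: zariski_closed_def)

lemma zariski_closed_Int_form:
  assumes "zariski_closed K N Z" "is_form K N e F"
  shows "zariski_closed K N {L \<in> Z. vanishes_on F L}"
proof -
  obtain \<F> where F: "\<forall>F\<in>\<F>. \<exists>e. is_form K N e F" "Z = {L \<in> proj N. \<forall>F\<in>\<F>. vanishes_on F L}"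
    using assms(1) by (auto simp: zariski_closed_iff)
  show ?thesis
    unfolding zariski_closed_iff
    by (intro exI[of _ "insert F \<F>"]) (use F assms(2) in auto)
qed

lemma zariski_closed_separate:
  assumes "zariski_closed K N Z" "L \<in> proj N" "L \<notin> Z"
  obtains e F where "is_form K N e F" "\<And>M. M \<in> Z \<Longrightarrow> vanishes_on F M" "\<not> vanishes_on F L"
proof -
  obtain \<F> where F: "\<forall>F\<in>\<F>. \<exists>e. is_form K N e F" "Z = {L \<in> proj N. \<forall>F\<in>\<F>. vanishes_on F L}"
    using assms(1) by (auto simp: zariski_closed_iff)
  then obtain F where "F \<in> \<F>" "\<not> vanishes_on F L" using assms by auto
  then show ?thesis using F that by blast
qed

lemma (in algebraic_coeffs) zariski_closed_empty: "zariski_closed K N {}"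
proof -
  have "1 \<in> K" using Rats by auto
  then have "is_form K N 0 (\<lambda>v. 1)" by (rule is_form_const)
  moreover have "L \<in> proj N \<Longrightarrow> \<not> vanishes_on (\<lambda>v. 1) L" for L
    by (auto simp: vanishes_on_def elim: proj_rep)
  ultimately show ?thesis
    unfolding zariski_closed_iff by (intro exI[of _ "{\<lambda>v. 1}"]) auto
qed


section \<open>Curves on which every form has finitely many zeros\<close>

text \<open>The coordinates \<open>a\<close> and \<open>b\<close>, which have no common zero on
  \<open>X\<close>, supply linear forms that avoid finitely many points. The form \<open>F0\<close>
  cuts out a nonempty proper closed subset, which makes the dimension positive.\<close>

locale finite_zeros = algebraic_coeffs +
  fixes N :: nat and X :: "point set" and a b :: nat and e0 :: nat and F0 :: "(nat \<Rightarrow> complex) \<Rightarrow> complex"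
  assumes closed: "zariski_closed K N X"
    and infinite: "infinite X"
    and zeros: "is_form K N e F \<Longrightarrow> L0 \<in> X \<Longrightarrow> \<not> vanishes_on F L0 \<Longrightarrow>
      finite {L \<in> X. vanishes_on F L} \<and>
      (\<forall>L\<in>X. vanishes_on F L \<longrightarrow> (\<exists>v\<in>L. v \<noteq> 0 \<and> (\<forall>i. algebraic (v i))))"
    and ab: "a \<le> N" "b \<le> N" "L \<in> X \<Longrightarrow> v \<in> L \<Longrightarrow> v \<noteq> 0 \<Longrightarrow> v a \<noteq> 0 \<or> v b \<noteq> 0"
    and F0: "is_form K N e0 F0" "\<exists>L\<in>X. vanishes_on F0 L" "\<exists>L\<in>X. \<not> vanishes_on F0 L"
begin

lemma X_proj: "X \<subseteq> proj N"
  by (rule zariski_closed_subset_proj[OF closed])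

lemma proper_closed:
  assumes "zariski_closed K N A" "A \<subset> X"
  shows "finite A \<and> (\<forall>L\<in>A. \<exists>v\<in>L. v \<noteq> 0 \<and> (\<forall>i. algebraic (v i)))"
proof -
  obtain L0 where L0: "L0 \<in> X" "L0 \<notin> A" using assms by auto
  then obtain e F where F: "is_form K N e F" "\<And>M. M \<in> A \<Longrightarrow> vanishes_on F M" "\<not> vanishes_on F L0"
    using zariski_closed_separate[OF assms(1), of L0] X_proj by blast
  have "A \<subseteq> {L \<in> X. vanishes_on F L}" using F assms by auto
  with zeros[OF F(1) L0(1) F(3)] show ?thesis
    using finite_subset by blast
qed

lemma irreducible: "zariski_irreducible K N X"
  unfolding zariski_irreducible_def
proof (intro conjI allI impI)
  show "X \<noteq> {}" using infinite by auto
next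
  fix A B assume AB: "zariski_closed K N A \<and> zariski_closed K N B \<and> X = A \<union> B"
  show "X = A \<or> X = B"
  proof (rule ccontr)
    assume "\<not> ?thesis"
    then have "A \<subset> X" "B \<subset> X" using AB by auto
    then have "finite A" "finite B" using proper_closed AB by auto
    then show False using infinite AB by auto
  qed
qed (rule closed)

text \<open>Each point excludes at most one \<open>c\<close>, since two excluded values would force
  both coordinates to vanish there. Dividing a form by a power of such a linear form gives a
  function on the points.\<close>

lemma nonvanishing_combination:
  assumes "finite Z" "Z \<subseteq> X"
  shows "\<exists>c::nat. \<forall>L\<in>Z. \<forall>v\<in>L. v \<noteq> 0 \<longrightarrow> v a + of_nat c * v b \<noteq> 0"
proof -
  define bad where "bad L = {c::nat. \<exists>v\<in>L. v \<noteq> 0 \<and> v a + of_nat c * v b = 0}" for L :: point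
  have "c = c'" if L: "L \<in> Z" and c: "c \<in> bad L" "c' \<in> bad L" for L c c'
  proof -
    obtain v v' where v: "v \<in> L" "v \<noteq> 0" "v a + of_nat c * v b = 0"
      "v' \<in> L" "v' \<noteq> 0" "v' a + of_nat c' * v' b = 0"
      using c by (auto simp: bad_def)
    have "L = line v" using v L assms(2) X_proj by (blast dest: proj_memD(2))
    then obtain r where r: "v' = (\<lambda>i. r * v i)" using v by (auto simp: line_eq)
    have "r \<noteq> 0" using v(5) r by (auto simp: fun_eq_iff)
    have "r * (v a + of_nat c' * v b) = 0"
      using v(6) by (simp add: r algebra_simps)
    then have "v a + of_nat c' * v b = 0" using \<open>r \<noteq> 0\<close> by simp
    have "(of_nat c - of_nat c') * v b = (v a + of_nat c * v b) - (v a + of_nat c' * v b)"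
      by (simp add: algebra_simps)
    then have "(of_nat c - of_nat c') * v b = 0"
      using v(3) \<open>v a + of_nat c' * v b = 0\<close> by simp
    moreover have "v b \<noteq> 0" using ab(3)[of L v] v L assms by auto
    ultimately show ?thesis by simp
  qed
  then have "finite (bad L)" if "L \<in> Z" for L
    using that by (metis finite.simps finite_subset insertI1 subsetI)
  then have "finite (\<Union>L\<in>Z. bad L)" using assms(1) by auto
  then obtain c where "c \<notin> (\<Union>L\<in>Z. bad L)" using ex_new_if_finite infinite_UNIV_nat by metis
  then show ?thesis by (auto simp: bad_def)
qed

text \<open>Over the ground field a closed point is a Galois orbit.  Here a form \<open>f\<close> that vanishes on a
  proper closed subset is divided by a power of a linear form; a polynomial with rational
  coefficients that kills all nonzero values of this algebraic function, but not zero, separates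
  the zeros of \<open>f\<close> from the other points.\<close>

lemma finite_irreducible_minimal:
  assumes Z: "zariski_irreducible K N Z" "Z \<subset> X" and Z0: "zariski_closed K N Z0" "Z0 \<subset> Z"
  shows "Z0 = {}"
proof (rule ccontr)
  assume ne: "Z0 \<noteq> {}"
  have clZ: "zariski_closed K N Z" using Z by (simp add: zariski_irreducible_def)
  have finZ: "finite Z" and alg: "\<forall>L\<in>Z. \<exists>v\<in>L. v \<noteq> 0 \<and> (\<forall>i. algebraic (v i))"
    using proper_closed[OF clZ Z(2)] by auto
  obtain r where r: "\<And>L. L \<in> Z \<Longrightarrow> r L \<in> L \<and> r L \<noteq> 0 \<and> (\<forall>i. algebraic (r L i))"
    using alg by metis
  have ZX: "Z \<subseteq> X" and Zproj: "Z \<subseteq> proj N" using Z X_proj by auto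
  obtain L1 where L1: "L1 \<in> Z" "L1 \<notin> Z0" using Z0 by auto
  then obtain e F where F: "is_form K N e F" "\<And>M. M \<in> Z0 \<Longrightarrow> vanishes_on F M" "\<not> vanishes_on F L1"
    using zariski_closed_separate[OF Z0(1), of L1] Zproj by blast
  obtain c :: nat where c: "\<forall>L\<in>Z. \<forall>v\<in>L. v \<noteq> 0 \<longrightarrow> v a + of_nat c * v b \<noteq> 0"
    using nonvanishing_combination[OF finZ ZX] by auto
  define G where "G v = (v a + of_nat c * v b) ^ e" for v :: "nat \<Rightarrow> complex"
  have "of_nat c \<in> K" using Rats by auto
  then have G: "is_form K N e G"
    using is_form_power[OF is_form_add[OF is_form_coord is_form_cmult[OF _ is_form_coord]], of a N "of_nat c" b e] ab
    by (simp add: G_def[abs_def])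
  define h where "h L = F (r L) / G (r L)" for L
  have Gnz: "G (r L) \<noteq> 0" if "L \<in> Z" for L
    using c r[OF that] that by (auto simp: G_def)
  have algF: "algebraic (F' (r L))" if L: "L \<in> Z" and F': "is_form K N e F'" for L F'
  proof -
    obtain S c n where S: "finite S" "\<forall>m\<in>S. c m \<in> K \<and> (\<Sum>i\<le>N. n m i) = e"
      and FF: "F' = (\<lambda>v. \<Sum>m\<in>(S :: (nat \<Rightarrow>\<^sub>0 nat) set). c m * (\<Prod>i\<le>N. v i ^ n m i))"
      using is_form_expand[OF F'] by blast
    show ?thesis
      unfolding FF
      using S(2) r[OF L]
      by (intro algebraic_sum algebraic_mult algebraic_prod algebraic_power) (auto intro: algebraic_K)
  qed
  have algh: "algebraic (h L)" if "L \<in> Z" for L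
    unfolding h_def divide_inverse
    by (intro algebraic_mult algebraic_inverse algF that F(1) G)
  have "\<exists>p. (\<forall>n. coeff p n \<in> \<rat>) \<and> coeff p 0 \<noteq> 0 \<and> poly p (h L) = 0"
    if L: "L \<in> Z" "h L \<noteq> 0" for L
  proof -
    obtain p where "p \<noteq> 0" "coeff p 0 \<noteq> 0" "poly (map_poly of_int p) (h L) = 0"
      using algebraicE'_nonzero[OF algh[OF L(1)] L(2)] by blast
    then show ?thesis
      by (intro exI[of _ "map_poly of_int p"]) (auto simp: coeff_map_poly)
  qed
  then obtain p where p: "\<And>L. L \<in> Z \<Longrightarrow> h L \<noteq> 0 \<Longrightarrow> (\<forall>n. coeff (p L) n \<in> \<rat>) \<and> coeff (p L) 0 \<noteq> 0 \<and>
      poly (p L) (h L) = 0"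
    by metis
  define Q where "Q = (\<Prod>L\<in>{L \<in> Z. h L \<noteq> 0}. p L)"
  have Q_prod: "poly Q x = (\<Prod>L\<in>{L \<in> Z. h L \<noteq> 0}. poly (p L) x)" for x
    unfolding Q_def by (simp add: poly_prod)
  have Q0: "poly Q 0 \<noteq> 0"
    unfolding Q_prod using finZ p by (simp add: poly_0_coeff_0)
  have Qh: "poly Q (h L) = 0 \<longleftrightarrow> h L \<noteq> 0" if "L \<in> Z" for L
    using Q0 p that finZ by (auto simp: Q_prod)
  define n where "n = degree Q"
  \<comment> \<open>The homogenization G^n * Q(F / G), a form over \<open>K\<close> because
    \<open>Q\<close> has rational coefficients. In this proof \<open>F2\<close> is a form and not
    the free group.\<close>
  define F2 where "F2 v = (\<Sum>i\<le>n. coeff Q i * (F v ^ i * G v ^ (n - i)))" for v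
  have "is_form K N (i * e + (n - i) * e) (\<lambda>v. F v ^ i * G v ^ (n - i))" for i
    by (intro is_form_mult is_form_power F G)
  moreover have "i * e + (n - i) * e = n * e" if "i \<le> n" for i
    using that by (simp add: add_mult_distrib[symmetric])
  moreover have "coeff Q i \<in> \<rat>" for i
    unfolding Q_def by (rule coeff_prod_closed) (use p in auto)
  then have "coeff Q i \<in> K" for i
    using Rats by blast
  ultimately have F2: "is_form K N (n * e) F2"
    unfolding F2_def[abs_def] by (intro is_form_sum is_form_cmult) (metis atMost_iff)+
  have F2_val: "F2 (r L) = G (r L) ^ n * poly Q (h L)" if "L \<in> Z" for L
    using Gnz[OF that]
    by (auto simp: F2_def poly_altdef n_def[symmetric] h_def sum_distrib_left power_divide
        power_diff field_simps intro!: sum.cong)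
  have van: "vanishes_on F L \<longleftrightarrow> h L = 0" "vanishes_on F2 L \<longleftrightarrow> h L \<noteq> 0" if "L \<in> Z" for L
    using vanishes_on_rep[OF F(1), of L "r L"] vanishes_on_rep[OF F2, of L "r L"] r[OF that] that
      Zproj Gnz[OF that] Qh[OF that] F2_val[OF that] by (auto simp: h_def)
  define A where "A = {L \<in> Z. vanishes_on F L}"
  define B where "B = {L \<in> Z. vanishes_on F2 L}"
  have "zariski_closed K N A" "zariski_closed K N B"
    unfolding A_def B_def
    using zariski_closed_Int_form[OF clZ F(1)] zariski_closed_Int_form[OF clZ F2] by simp_all
  moreover have "Z = A \<union> B"
    by (auto simp: A_def B_def van)
  ultimately have "Z = A \<or> Z = B"
    using Z(1) by (auto simp: zariski_irreducible_def)
  moreover have "Z \<noteq> A" using L1 F(3) by (auto simp: A_def)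
  moreover have "Z \<noteq> B"
  proof -
    obtain L where L: "L \<in> Z0" using ne by auto
    then have "L \<in> Z" using Z0 by auto
    then show ?thesis using F(2)[OF L] van[of L] by (auto simp: B_def)
  qed
  ultimately show False by blast
qed

text \<open>A minimal nonempty closed subset of the finite zero set of \<open>F0\<close> is
  irreducible: of two closed sets that cover it, a nonempty one is already everything.\<close>

lemma ex_irreducible_proper: "\<exists>Z. zariski_irreducible K N Z \<and> Z \<subset> X"
proof -
  define W where "W = {L \<in> X. vanishes_on F0 L}"
  have W: "zariski_closed K N W" unfolding W_def by (rule zariski_closed_Int_form[OF closed F0(1)])
  have WX: "W \<subset> X" using F0(3) by (auto simp: W_def)
  have finW: "finite W" using proper_closed[OF W WX] by simp
  define \<A> where "\<A> = {Z. zariski_closed K N Z \<and> Z \<noteq> {} \<and> Z \<subseteq> W}"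
  have "finite \<A>" using finW by (auto intro!: finite_subset[of \<A> "Pow W"] simp: \<A>_def)
  moreover have "W \<in> \<A>" using W F0(2) by (auto simp: \<A>_def W_def)
  ultimately obtain Z where Z: "Z \<in> \<A>" and min: "\<forall>Y\<in>\<A>. Y \<subseteq> Z \<longrightarrow> Z = Y"
    using finite_has_minimal[of \<A>] by auto
  have "zariski_irreducible K N Z"
    unfolding zariski_irreducible_def
  proof (intro conjI allI impI)
    fix A B assume AB: "zariski_closed K N A \<and> zariski_closed K N B \<and> Z = A \<union> B"
    show "Z = A \<or> Z = B"
    proof (cases "A = {}")
      case False
      then have "A \<in> \<A>" using AB Z by (auto simp: \<A>_def)
      then show ?thesis using min AB by auto
    qed (use AB in auto)
  qed (use Z in \<open>auto simp: \<A>_def\<close>)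
  then show ?thesis using Z WX by (auto simp: \<A>_def)
qed

text \<open>In a chain of length 2 the middle set would be irreducible and proper in
  \<open>X\<close> and still contain a smaller nonempty closed set, against
  \<open>finite_irreducible_minimal\<close>.\<close>

lemma dim_one: "zariski_dim K N X = 1"
proof -
  define C where "C n \<longleftrightarrow> (\<exists>Z. (\<forall>i \<le> n. zariski_irreducible K N (Z i) \<and> Z i \<subseteq> X) \<and>
    (\<forall>i < n. Z i \<subset> Z (Suc i)))" for n :: nat
  have "C 1"
  proof -
    obtain Z0 where "zariski_irreducible K N Z0" "Z0 \<subset> X"
      using ex_irreducible_proper by auto
    then show ?thesis
      unfolding C_def using irreducible
      by (intro exI[of _ "\<lambda>i. if i = 0 then Z0 else X"]) auto
  qed
  moreover have "n \<le> 1" if C: "C n" for n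
  proof (rule ccontr)
    assume n: "\<not> n \<le> 1"
    obtain Z where Z: "\<forall>i \<le> n. zariski_irreducible K N (Z i) \<and> Z i \<subseteq> X" "\<forall>i < n. Z i \<subset> Z (Suc i)"
      using C unfolding C_def by blast
    have "Z 0 \<subset> Z 1" "Z 1 \<subset> Z 2" "Z 2 \<subseteq> X"
      using Z n by (auto simp: numeral_2_eq_2)
    moreover have irr: "zariski_irreducible K N (Z 0)" "zariski_irreducible K N (Z 1)"
      using Z n by auto
    ultimately have "Z 0 = {}"
      by (intro finite_irreducible_minimal[of "Z 1" "Z 0"]) (auto simp: zariski_irreducible_def)
    then show False using irr by (simp add: zariski_irreducible_def)
  qed
  ultimately have "Sup {enat n | n. C n} = enat 1"
    by (intro antisym Sup_least Sup_upper) auto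
  then show ?thesis
    by (simp add: zariski_dim_def C_def one_enat_def)
qed

end


section \<open>Zeros of polynomials on the affine Fermat curve\<close>

lemma ex_complex_root:
  assumes "n > 0"
  shows "\<exists>b::complex. b ^ n = a"
proof (cases "a = 0")
  case False
  then have "exp (Ln a / of_nat n) ^ n = a"
    using assms by (simp add: exp_of_nat_mult[symmetric])
  then show ?thesis by blast
qed (use assms in \<open>auto intro!: exI[of _ 0]\<close>)

definition root1 :: "nat \<Rightarrow> complex"
  where "root1 d = exp (2 * of_real pi * \<i> / of_nat d)"

lemma root1_power: "root1 d ^ n = exp (2 * of_real pi * \<i> * of_nat n / of_nat d)"
  by (simp add: root1_def exp_of_nat_mult[symmetric] mult_ac)

lemma root1_power_eq_iff:
  assumes "d > 0"
  shows "root1 d ^ m = root1 d ^ n \<longleftrightarrow> m mod d = n mod d"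
  using complex_root_unity_eq[of d m n] assms by (simp add: root1_power)

lemma root1_power_self: "d > 0 \<Longrightarrow> root1 d ^ d = 1"
  using root1_power_eq_iff[of d d 0] by simp

lemma algebraic_root1:
  assumes "d > 0"
  shows "algebraic (root1 d)"
proof (rule algebraicI'[of "monom 1 d - 1"])
  have "coeff (monom (1::complex) d - 1) d \<noteq> 0" using assms by (simp add: coeff_1)
  then show "monom (1::complex) d - 1 \<noteq> 0" by (metis coeff_0)
qed (auto simp: poly_monom root1_power_self[OF assms] coeff_1)

lemma coeff_pcompose_linear:
  fixes p :: "'a::comm_ring_1 poly"
  shows "coeff (p \<circ>\<^sub>p [:0, a:]) n = a ^ n * coeff p n"
  by (induction p arbitrary: n) (auto simp: pcompose_pCons coeff_pCons mult_ac split: nat.splits)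

text \<open>The outer variable of \<open>P\<close> is y and its coefficients are polynomials in
  x.\<close>

definition poly2 :: "complex poly poly \<Rightarrow> complex \<Rightarrow> complex \<Rightarrow> complex"
  where "poly2 P x y = poly (poly P [:y:]) x"

lemma poly2_altdef: "poly2 P x y = (\<Sum>n\<le>degree P. poly (coeff P n) x * y ^ n)"
  by (simp add: poly2_def poly_altdef[of P] poly_sum)

lemma poly2_prod: "poly2 (\<Prod>i\<in>I. P i) x y = (\<Prod>i\<in>I. poly2 (P i) x y)"
  by (simp add: poly2_def poly_prod)

lemma poly2_pcompose: "poly2 (P \<circ>\<^sub>p [:0, [:c:]:]) x y = poly2 P x (c * y)"
  by (simp add: poly2_def poly_pcompose mult.commute)

text \<open>The norm from the function field of the Fermat curve to the field of rational functions
  of \<open>x\<close>.\<close>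

lemma fermat_norm:
  assumes d: "d > 0" and alg: "\<And>m n. algebraic (coeff (coeff P m) n)"
  obtains D where "\<And>n. algebraic (coeff D n)"
    "\<And>x y. x ^ d + y ^ d = 1 \<Longrightarrow> poly D x = (\<Prod>b<d. poly2 P x (root1 d ^ b * y))"
proof -
  define T where "T b = P \<circ>\<^sub>p [:0, [:root1 d ^ b:]:]" for b
  define Q where "Q = (\<Prod>b<d. T b)"
  define S where "S = {p :: complex poly. \<forall>n. algebraic (coeff p n)}"
  have S: "0 \<in> S" "1 \<in> S" "\<And>p q. p \<in> S \<Longrightarrow> q \<in> S \<Longrightarrow> p + q \<in> S"
    "\<And>p q. p \<in> S \<Longrightarrow> q \<in> S \<Longrightarrow> p * q \<in> S"
    by (auto simp: S_def coeff_1 coeff_mult rat_imp_algebraic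
        intro!: algebraic_add algebraic_sum algebraic_mult)
  have const: "[:c:] ^ n = [:c ^ n:]" for c :: complex and n
    by (induction n) (auto simp: one_pCons)
  have "coeff (T b) n \<in> S" for b n
    using alg by (auto simp: T_def S_def coeff_pcompose_linear const
        intro!: algebraic_mult algebraic_power algebraic_root1 d)
  then have Q_S: "coeff Q n \<in> S" for n
    unfolding Q_def by (intro coeff_prod_closed S)
  have T_shift: "T b \<circ>\<^sub>p [:0, [:root1 d:]:] = T (Suc b)" for b
    by (simp add: T_def pcompose_assoc[symmetric] pcompose_pCons mult.commute)
  have "T d = T 0"
    by (simp add: T_def root1_power_self[OF d])
  have "Q \<circ>\<^sub>p [:0, [:root1 d:]:] = (\<Prod>b<d. T (Suc b))"
    by (simp add: Q_def pcompose_prod T_shift)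
  also have "\<dots> = Q"
  proof -
    obtain d' where "d = Suc d'" using d by (cases d) auto
    then show ?thesis
      using \<open>T d = T 0\<close> unfolding Q_def
      by (simp only: prod.lessThan_Suc_shift[of T] prod.lessThan_Suc[of "\<lambda>b. T (Suc b)"] mult.commute)
  qed
  \<comment> \<open>The product is invariant under y -> \<open>root1 d\<close> * y, so only powers
    of y^d occur in it; on the curve these are powers of 1 - x^d, which yields
    \<open>D\<close>.\<close>
  finally have inv: "[:root1 d:] ^ n * coeff Q n = coeff Q n" for n
    by (metis coeff_pcompose_linear)
  have Q_zero: "coeff Q n = 0" if "\<not> d dvd n" for n
  proof -
    have "root1 d ^ n \<noteq> 1"
      using root1_power_eq_iff[OF d, of n 0] that by (auto simp: dvd_eq_mod_eq_0)
    moreover have "smult (root1 d ^ n - 1) (coeff Q n) = 0"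
      using inv[of n] by (simp add: const smult_diff_left)
    ultimately show ?thesis by simp
  qed
  define D where "D = (\<Sum>n\<in>{n. n \<le> degree Q \<and> d dvd n}. coeff Q n * (1 - monom 1 d) ^ (n div d))"
  have one_minus: "1 - monom 1 d \<in> S"
  proof -
    have "algebraic (coeff (1 - monom (1::complex) d) n)" for n
      by (rule rat_imp_algebraic) (auto simp: coeff_1)
    then show ?thesis by (simp add: S_def)
  qed
  have pow: "(1 - monom 1 d) ^ n \<in> S" for n
    by (induction n) (auto intro: S one_minus)
  have sum_S: "(\<Sum>n\<in>I. g n) \<in> S" if "\<And>n. n \<in> I \<Longrightarrow> g n \<in> S" for I :: "nat set" and g
    using that by (induction I rule: infinite_finite_induct) (auto intro: S)
  have "D \<in> S"
    unfolding D_def by (intro sum_S S Q_S pow)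
  moreover have "poly D x = (\<Prod>b<d. poly2 P x (root1 d ^ b * y))" if xy: "x ^ d + y ^ d = 1" for x y
  proof -
    have y: "1 - x ^ d = y ^ d" using xy by (simp add: algebra_simps)
    have "poly D x = (\<Sum>n\<in>{n. n \<le> degree Q \<and> d dvd n}. poly (coeff Q n) x * y ^ n)"
      by (simp add: D_def poly_sum poly_monom y power_mult[symmetric])
    also have "\<dots> = (\<Sum>n\<le>degree Q. poly (coeff Q n) x * y ^ n)"
      by (intro sum.mono_neutral_left) (auto simp: Q_zero)
    also have "\<dots> = (\<Prod>b<d. poly2 P x (root1 d ^ b * y))"
      by (simp add: poly2_altdef[symmetric] Q_def poly2_prod T_def poly2_pcompose)
    finally show ?thesis .
  qed
  ultimately show ?thesis using that[of D] by (auto simp: S_def)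
qed

text \<open>Modulo the equation of the curve \<open>P\<close> is \<open>\<Sum>j<d. f j * y\<^sup>j\<close> with polynomials \<open>f j\<close> in \<open>x\<close>.
  At the point \<open>(1, 0)\<close>, where \<open>y\<close> is a uniformizer, the orders of the nonzero summands
  are distinct modulo \<open>d\<close>, hence \<open>P\<close> cannot vanish at points close to it.\<close>

lemma fermat_nonvanishing_near:
  assumes d: "d > 0" and f: "\<exists>j<d. f j \<noteq> (0 :: complex poly)"
    and X: "X \<longlonglongrightarrow> 1" "\<And>n. X n \<noteq> 1" and Y: "Y \<longlonglongrightarrow> 0" "\<And>n. Y n \<noteq> 0"
    and XY: "\<And>n. X n ^ d + Y n ^ d = 1" and zero: "\<And>n. (\<Sum>j<d. poly (f j) (X n) * Y n ^ j) = 0"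
  shows False
proof -
  define J where "J = {j. j < d \<and> f j \<noteq> 0}"
  \<comment> \<open>(x - 1)^m is the highest power of x - 1 dividing all \<open>f j\<close>. Once it
    is removed, some \<open>g j\<close> is nonzero at 1, and \<open>j0\<close> will be the first
    such index.\<close>
  define m where "m = Min ((\<lambda>j. Polynomial.order 1 (f j)) ` J)"
  have J: "finite J" "J \<noteq> {}" using f by (auto simp: J_def)
  have "[:-1, 1:] ^ m dvd f j" if "j < d" for j
  proof (cases "f j = 0")
    case False
    then have "m \<le> Polynomial.order 1 (f j)" using J that by (auto simp: m_def J_def intro!: Min_le)
    then show ?thesis by (simp add: order_divides)
  qed simp
  then obtain g where g: "\<And>j. j < d \<Longrightarrow> f j = [:-1, 1:] ^ m * g j"
    unfolding dvd_def by metis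
  have "m \<in> (\<lambda>j. Polynomial.order 1 (f j)) ` J" unfolding m_def using J by (intro Min_in) auto
  then obtain j1 where j1: "j1 < d" "f j1 \<noteq> 0" "Polynomial.order 1 (f j1) = m" by (auto simp: J_def)
  have "poly (g j1) 1 \<noteq> 0"
  proof
    assume "poly (g j1) 1 = 0"
    then have "[:-1, 1:] ^ Suc m dvd f j1"
      unfolding g[OF j1(1)] power_Suc2 by (intro mult_dvd_mono dvd_refl) (simp add: poly_eq_0_iff_dvd)
    then have "Suc m \<le> Polynomial.order 1 (f j1)"
      unfolding order_divides using j1 by blast
    then show False using j1 by simp
  qed
  define j0 where "j0 = (LEAST j. j < d \<and> poly (g j) 1 \<noteq> 0)"
  have j0: "j0 < d" "poly (g j0) 1 \<noteq> 0"
    using LeastI[of "\<lambda>j. j < d \<and> poly (g j) 1 \<noteq> 0" j1] j1 \<open>poly (g j1) 1 \<noteq> 0\<close> by (auto simp: j0_def)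
  have "[:-1, 1:] dvd g j" if "j < j0" for j
    using not_less_Least[OF that[unfolded j0_def]] that j0 by (auto simp: poly_eq_0_iff_dvd)
  then obtain h where h: "\<And>j. j < j0 \<Longrightarrow> g j = [:-1, 1:] * h j"
    unfolding dvd_def by metis
  \<comment> \<open>On the curve (x - 1) * S x = x^d - 1 = - y^d with S 1 = d nonzero, so the factor
    x - 1 still contained in \<open>g j\<close> for j < j0 counts as y^d.\<close>
  define S where "S x = (\<Sum>i<d. x ^ i)" for x :: complex
  have S: "(x - 1) * S x = x ^ d - 1" for x
    unfolding S_def by (rule power_diff_1_eq[symmetric])
  have SX: "S (X n) \<noteq> 0" for n
    using S[of "X n"] XY[of n] Y(2)[of n] by auto
  \<comment> \<open>The summands divided by (x - 1)^m * y^j0. As j0 < d, the exponent d + j - j0 is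
    positive, so in the limit only the summand j0 survives.\<close>
  define t where "t j n = (if j < j0 then - (poly (h j) (X n) / S (X n)) * Y n ^ (d + j - j0)
    else poly (g j) (X n) * Y n ^ (j - j0))" for j n
  have t: "poly (g j) (X n) * Y n ^ j = t j n * Y n ^ j0" if "j < d" for j n
  proof (cases "j < j0")
    case True
    have "X n - 1 = - (Y n ^ d) / S (X n)"
    proof -
      have "(X n - 1) * S (X n) = - (Y n ^ d)"
        unfolding S using XY[of n] by (simp add: algebra_simps)
      then show ?thesis using SX[of n] by (metis nonzero_mult_div_cancel_right)
    qed
    moreover have "poly (g j) (X n) = (X n - 1) * poly (h j) (X n)"
      by (simp add: h[OF True] algebra_simps)
    ultimately have "poly (g j) (X n) * Y n ^ j = - (poly (h j) (X n) / S (X n)) * (Y n ^ d * Y n ^ j)"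
      by simp
    also have "Y n ^ d * Y n ^ j = Y n ^ (d + j - j0) * Y n ^ j0"
      using True j0 by (simp add: power_add[symmetric])
    finally show ?thesis
      using True by (simp add: t_def)
  next
    case False
    then have "Y n ^ (j - j0) * Y n ^ j0 = Y n ^ j" by (simp add: power_add[symmetric])
    then show ?thesis using False by (simp add: t_def mult.assoc)
  qed
  have "(\<Sum>j<d. t j n) = 0" for n
  proof -
    have "0 = (\<Sum>j<d. (X n - 1) ^ m * (t j n * Y n ^ j0))"
      unfolding zero[of n, symmetric]
      by (intro sum.cong refl) (simp add: g t[symmetric] mult.assoc)
    also have "\<dots> = ((X n - 1) ^ m * Y n ^ j0) * (\<Sum>j<d. t j n)"
      by (simp add: sum_distrib_left mult_ac)
    finally show ?thesis using X(2)[of n] Y(2)[of n] by auto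
  qed
  moreover have "(\<lambda>n. \<Sum>j<d. t j n) \<longlonglongrightarrow> (\<Sum>j<d. if j = j0 then poly (g j0) 1 else 0)"
  proof (intro tendsto_sum)
    fix j assume "j \<in> {..<d}"
    have "S 1 \<noteq> 0" using d by (simp add: S_def)
    have "(\<lambda>n. S (X n)) \<longlonglongrightarrow> S 1"
      unfolding S_def by (intro tendsto_sum tendsto_power X)
    have pX: "(\<lambda>n. poly p (X n)) \<longlonglongrightarrow> poly p 1" for p
      by (rule tendsto_poly[OF X(1)])
    consider "j < j0" | "j = j0" | "j > j0" by linarith
    then show "t j \<longlonglongrightarrow> (if j = j0 then poly (g j0) 1 else 0)"
    proof cases
      case 1
      have "(\<lambda>n. - (poly (h j) (X n) / S (X n)) * Y n ^ (d + j - j0)) \<longlonglongrightarrow>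
          - (poly (h j) 1 / S 1) * 0 ^ (d + j - j0)"
        by (intro tendsto_intros pX Y \<open>(\<lambda>n. S (X n)) \<longlonglongrightarrow> S 1\<close> \<open>S 1 \<noteq> 0\<close>)
      moreover have "d + j - j0 > 0" using j0 by simp
      ultimately show ?thesis using 1 by (simp add: t_def[abs_def] zero_power)
    next
      case 2
      then show ?thesis using pX by (simp add: t_def[abs_def])
    next
      case 3
      have "(\<lambda>n. poly (g j) (X n) * Y n ^ (j - j0)) \<longlonglongrightarrow> poly (g j) 1 * 0 ^ (j - j0)"
        by (intro tendsto_intros pX Y)
      then show ?thesis using 3 by (simp add: t_def[abs_def] zero_power)
    qed
  qed
  ultimately have "poly (g j0) 1 = 0"
    using j0 by (simp add: LIMSEQ_const_iff)
  then show False using j0 by simp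
qed

text \<open>\<open>D\<close> is the norm of \<open>P\<close>, and the issue is that it is not zero.
  Otherwise every x has some y on the curve with P(x, y) = 0, and x -> 1 gives zeros of
  \<open>P\<close> converging to (1, 0), which \<open>fermat_nonvanishing_near\<close>
  excludes.\<close>

lemma fermat_finite_zeros:
  assumes d: "d > 0" and alg: "\<And>m n. algebraic (coeff (coeff P m) n)"
    and nz: "x0 ^ d + y0 ^ d = 1" "poly2 P x0 y0 \<noteq> 0"
  obtains D where "\<And>n. algebraic (coeff D n)" "D \<noteq> 0"
    "\<And>x y. x ^ d + y ^ d = 1 \<Longrightarrow> poly2 P x y = 0 \<Longrightarrow> poly D x = 0"
proof -
  obtain D where D: "\<And>n. algebraic (coeff D n)"
    "\<And>x y. x ^ d + y ^ d = 1 \<Longrightarrow> poly D x = (\<Prod>b<d. poly2 P x (root1 d ^ b * y))"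
    using fermat_norm[OF d alg] by blast
  have "D \<noteq> 0"
  proof
    assume "D = 0"
    \<comment> \<open>Reduction of \<open>P\<close> modulo y^d = 1 - x^d: the powers of y are
      collected by their residue modulo d.\<close>
    define f where "f j = (\<Sum>n\<in>{n. n \<le> degree P \<and> n mod d = j}. coeff P n * (1 - monom 1 d) ^ (n div d))" for j
    have f: "poly2 P x y = (\<Sum>j<d. poly (f j) x * y ^ j)" if xy: "x ^ d + y ^ d = 1" for x y
    proof -
      have y: "1 - x ^ d = y ^ d" using xy by (simp add: algebra_simps)
      have "(\<Sum>j<d. poly (f j) x * y ^ j) =
        (\<Sum>j<d. \<Sum>n\<in>{n \<in> {..degree P}. n mod d = j}. poly (coeff P n) x * y ^ n)"
      proof (intro sum.cong refl)
        fix j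
        have "(poly (coeff P n) x * (y ^ d) ^ (n div d)) * y ^ j = poly (coeff P n) x * y ^ n"
          if "n mod d = j" for n
          using mult_div_mod_eq[of d n] that
          by (simp add: mult.assoc power_mult[symmetric] power_add[symmetric])
        then show "poly (f j) x * y ^ j = (\<Sum>n\<in>{n \<in> {..degree P}. n mod d = j}. poly (coeff P n) x * y ^ n)"
          by (simp only: f_def poly_sum poly_mult poly_power poly_diff poly_1 poly_monom mult_1 y
              sum_distrib_right atMost_iff) (intro sum.cong refl, simp)
      qed
      also have "\<dots> = poly2 P x y"
        unfolding poly2_altdef by (intro sum.group) (use d in auto)
      finally show ?thesis by simp
    qed
    have ex: "\<exists>j<d. f j \<noteq> 0"
    proof (rule ccontr)
      assume "\<not> ?thesis"
      then show False using nz(2) f[OF nz(1)] by simp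
    qed
    \<comment> \<open>Real numbers above 1, so that X n ^ d is not 1 and the corresponding y is not
      0.\<close>
    define X where "X n = (1 + 1 / of_nat (Suc n) :: complex)" for n :: nat
    have X_real: "X n = of_real (1 + 1 / real (Suc n))" for n
      by (simp add: X_def)
    have X1: "X n ^ d \<noteq> 1" for n
    proof -
      have "(1 + 1 / real (Suc n)) ^ d > 1"
        using d by (intro one_less_power) auto
      then show ?thesis unfolding X_real of_real_power[symmetric] by (metis less_irrefl of_real_eq_1_iff)
    qed
    have X: "X \<longlonglongrightarrow> 1"
      unfolding X_real
      using tendsto_of_real[OF tendsto_add[OF tendsto_const[of 1] lim_inverse_n'[THEN LIMSEQ_Suc]],
          where 'a = complex] by simp
    have "\<exists>y. X n ^ d + y ^ d = 1 \<and> poly2 P (X n) y = 0" for n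
    proof -
      obtain y where y: "y ^ d = 1 - X n ^ d" using ex_complex_root[OF d] by blast
      have "(\<Prod>b<d. poly2 P (X n) (root1 d ^ b * y)) = 0"
        using D(2)[of "X n" y] y \<open>D = 0\<close> by simp
      then obtain b where "poly2 P (X n) (root1 d ^ b * y) = 0" by auto
      moreover have "(root1 d ^ b * y) ^ d = y ^ d"
        using root1_power_self[OF d]
        by (metis mult.commute mult_1 power_mult power_mult_distrib power_one)
      ultimately show ?thesis using y by (intro exI[of _ "root1 d ^ b * y"]) auto
    qed
    then obtain Y where Y: "\<And>n. X n ^ d + Y n ^ d = 1" "\<And>n. poly2 P (X n) (Y n) = 0" by metis
    have "Y \<longlonglongrightarrow> 0"
    proof -
      have "norm (Y n) = root d (norm (1 - X n ^ d))" for n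
      proof -
        have "norm (1 - X n ^ d) = norm (Y n) ^ d"
          using Y(1)[of n] by (metis add_diff_cancel_left' norm_power)
        then show ?thesis using d by (simp add: real_root_power_cancel)
      qed
      moreover have "(\<lambda>n. root d (norm (1 - X n ^ d))) \<longlonglongrightarrow> root d (norm (1 - (1::complex) ^ d))"
        by (intro tendsto_intros X)
      ultimately show ?thesis by (intro tendsto_norm_zero_cancel[of Y]) simp
    qed
    moreover have "Y n \<noteq> 0" for n using Y(1)[of n] X1[of n] d by (auto simp: zero_power)
    moreover have "X n \<noteq> 1" for n using X1[of n] by auto
    ultimately show False
      using fermat_nonvanishing_near[OF d ex X _ _ _ Y(1)] Y f[OF Y(1)] by simp
  qed
  moreover have "poly D x = 0" if "x ^ d + y ^ d = 1" "poly2 P x y = 0" for x y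
    using D(2)[OF that(1)] that(2) d by (auto intro!: bexI[of _ 0])
  ultimately show ?thesis using that D(1) by blast
qed


section \<open>Images of Fermat curves under monomial maps\<close>

text \<open>Read for the monomial with exponents \<open>E c\<close> in place of \<open>c\<close>, this says that on the
  complement of the coordinate hyperplanes other than \<open>x\<^sub>i = 0\<close> all monomials are generated by
  \<open>u\<close>, the unit \<open>t\<close> and its inverse (after division by the \<open>d\<close>-th power \<open>V k\<close> of \<open>x\<^sub>k\<close>).\<close>

definition toric_chart :: "nat \<Rightarrow> (nat \<Rightarrow> nat \<Rightarrow> nat) \<Rightarrow> (nat \<Rightarrow> nat) \<Rightarrow> nat \<Rightarrow> nat \<Rightarrow> nat \<Rightarrow> nat \<Rightarrow> nat \<Rightarrow> bool"
  where "toric_chart N E V i j k u t \<longleftrightarrow>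
    i < 3 \<and> j < 3 \<and> k < 3 \<and> i \<noteq> j \<and> i \<noteq> k \<and> j \<noteq> k \<and> u \<le> N \<and> t \<le> N \<and> 0 < E u i \<and> E t i = 0 \<and> 0 < E t j \<and>
    (\<forall>c\<le>N. \<exists>r A B A' B'. \<forall>n<3. E c n + E t n * A + E (V k) n * B = E u n * r + E t n * A' + E (V k) n * B')"

lemma less_3_cases: "n < 3 \<Longrightarrow> n = 0 \<or> n = 1 \<or> n = (2::nat)"
  by auto

lemma perm3_cases:
  assumes "i < 3" "j < 3" "k < (3::nat)" "i \<noteq> j" "i \<noteq> k" "j \<noteq> k"
  shows "i = 0 \<and> j = 1 \<and> k = 2 \<or> i = 0 \<and> j = 2 \<and> k = 1 \<or> i = 1 \<and> j = 0 \<and> k = 2 \<or>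
    i = 1 \<and> j = 2 \<and> k = 0 \<or> i = 2 \<and> j = 0 \<and> k = 1 \<or> i = 2 \<and> j = 1 \<and> k = 0"
  using assms less_3_cases[OF assms(1)] less_3_cases[OF assms(2)] less_3_cases[OF assms(3)]
  by (elim disjE) simp_all

lemma ex_third: "\<exists>k<3. i \<noteq> k \<and> j \<noteq> (k::nat)"
proof -
  have "i \<noteq> 0 \<and> j \<noteq> 0 \<or> i \<noteq> 1 \<and> j \<noteq> 1 \<or> i \<noteq> 2 \<and> j \<noteq> (2::nat)" by presburger
  moreover have "(0::nat) < 3" "(1::nat) < 3" "(2::nat) < 3" by simp_all
  ultimately show ?thesis by blast
qed

lemma all_less_3: "(\<forall>n<3. P n) \<longleftrightarrow> P 0 \<and> P 1 \<and> P (2::nat)"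
  by (auto simp: numeral_3_eq_3 numeral_2_eq_2 less_Suc_eq)

text \<open>\<open>E c n\<close> is the exponent of x n in the monomial that gives coordinate
  \<open>c\<close>, and \<open>V i\<close> is the coordinate given by x i ^ d, a vertex of the
  triangle of exponents.\<close>

locale toric_curve =
  fixes d N :: nat and E :: "nat \<Rightarrow> nat \<Rightarrow> nat" and V :: "nat \<Rightarrow> nat"
  assumes d_pos: "d > 0"
    and E_sum: "c \<le> N \<Longrightarrow> E c 0 + E c 1 + E c 2 = d"
    and V_le: "i < 3 \<Longrightarrow> V i \<le> N"
    and E_V: "i < 3 \<Longrightarrow> j < 3 \<Longrightarrow> E (V i) j = (if j = i then d else 0)"
    and chart_ex: "i < 3 \<Longrightarrow> \<exists>j k u t. toric_chart N E V i j k u t"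
begin

definition toric_map :: "(nat \<Rightarrow> complex) \<Rightarrow> nat \<Rightarrow> complex"
  where "toric_map x c = (if c \<le> N then x 0 ^ E c 0 * x 1 ^ E c 1 * x 2 ^ E c 2 else 0)"

definition fermat :: "(nat \<Rightarrow> complex) \<Rightarrow> bool"
  where "fermat x \<longleftrightarrow> x 0 ^ d + x 1 ^ d = x 2 ^ d"

definition cone :: "(nat \<Rightarrow> complex) set"
  where "cone = toric_map ` {x. fermat x}"

definition curve :: "point set"
  where "curve = line ` (cone - {0})"

text \<open>The signs in x0^d + x1^d - x2^d = 0; they allow the three variables to be
  permuted.\<close>

definition sg :: "nat \<Rightarrow> complex"
  where "sg i = (if i = 2 then - 1 else 1)"

lemma sg_nonzero [simp]: "sg i \<noteq> 0"
  by (simp add: sg_def)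

lemma toric_map_perm:
  assumes "i < 3" "j < 3" "k < 3" "i \<noteq> j" "i \<noteq> k" "j \<noteq> k" "c \<le> N"
  shows "toric_map x c = x i ^ E c i * x j ^ E c j * x k ^ E c k"
  using perm3_cases[OF assms(1-6)] assms(7)
  by (elim disjE conjE) (simp_all add: toric_map_def mult_ac)

lemma fermat_perm:
  assumes "i < 3" "j < 3" "k < 3" "i \<noteq> j" "i \<noteq> k" "j \<noteq> k"
  shows "fermat x \<longleftrightarrow> sg i * x i ^ d + sg j * x j ^ d + sg k * x k ^ d = 0"
  using perm3_cases[OF assms]
  by (elim disjE conjE) (auto simp: fermat_def sg_def algebra_simps eq_neg_iff_add_eq_0)

lemma lin_perm:
  assumes "i < 3" "j < 3" "k < 3" "i \<noteq> j" "i \<noteq> k" "j \<noteq> k"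
  shows "w 0 + w 1 = w 2 \<longleftrightarrow> sg i * w i + sg j * w j + sg k * w k = 0"
  using perm3_cases[OF assms]
  by (elim disjE conjE) (auto simp: fermat_def sg_def algebra_simps eq_neg_iff_add_eq_0)

lemma toric_map_V: "i < 3 \<Longrightarrow> toric_map x (V i) = x i ^ d"
  using V_le[of i] less_3_cases[of i] E_V[of i 0] E_V[of i 1] E_V[of i 2]
  by (auto simp: toric_map_def)

lemma toric_map_vecs: "toric_map x \<in> vecs N"
  by (simp add: vecs_def toric_map_def)

lemma toric_map_scale: "toric_map (\<lambda>i. b * x i) c = b ^ d * toric_map x c"
proof (cases "c \<le> N")
  case True
  have "b ^ d = b ^ E c 0 * b ^ E c 1 * b ^ E c 2"
    by (simp add: E_sum[OF True, symmetric] power_add)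
  then show ?thesis using True by (simp add: toric_map_def power_mult_distrib mult_ac)
qed (simp add: toric_map_def)

lemma fermat_scale: "fermat x \<Longrightarrow> fermat (\<lambda>i. b * x i)"
  by (simp add: fermat_def power_mult_distrib flip: distrib_left)

lemma cone_scale:
  assumes "w \<in> cone"
  shows "(\<lambda>i. a * w i) \<in> cone"
proof -
  obtain x where x: "w = toric_map x" "fermat x" using assms by (auto simp: cone_def)
  obtain b where b: "b ^ d = a" using ex_complex_root[OF d_pos] by blast
  have "(\<lambda>i. a * w i) = toric_map (\<lambda>i. b * x i)"
    unfolding x(1) by (intro ext) (simp add: toric_map_scale b)
  then show ?thesis using fermat_scale[OF x(2), of b] by (auto simp: cone_def)
qed

lemma zero_in_cone: "0 \<in> cone"
proof -
  have "fermat (\<lambda>_. 0)" using d_pos by (simp add: fermat_def zero_power)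
  then have "toric_map (\<lambda>_. 0) \<in> cone" by (auto simp: cone_def)
  from cone_scale[OF this, of 0] show ?thesis by (simp add: zero_fun_def)
qed

lemma toric_map_nonzero: "i < 3 \<Longrightarrow> x i \<noteq> 0 \<Longrightarrow> toric_map x \<noteq> 0"
  using toric_map_V[of i x] by (metis power_not_zero zero_fun_apply)

lemma curve_mem:
  assumes "L \<in> curve" "v \<in> L"
  shows "v \<in> cone"
  using assms cone_scale by (auto simp: curve_def line_eq)

lemma curve_line: "L \<in> curve \<Longrightarrow> v \<in> L \<Longrightarrow> v \<noteq> 0 \<Longrightarrow> L = line v"
  using line_eq_line by (auto simp: curve_def)

lemma cone_vecs: "cone \<subseteq> vecs N"
  using toric_map_vecs by (auto simp: cone_def)

lemma curve_proj: "curve \<subseteq> proj N"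
  using cone_vecs by (auto simp: curve_def proj_def)

lemma vanishes_on_curve: "(\<And>w. w \<in> cone \<Longrightarrow> F w = 0) \<Longrightarrow> L \<in> curve \<Longrightarrow> vanishes_on F L"
  using curve_mem by (auto simp: vanishes_on_def)

text \<open>The equations of the image: the Fermat equation read in the vertex coordinates, and
  monomial identities, the last family having the shape used in \<open>toric_chart\<close>. By
  \<open>cone_rels\<close> and \<open>rels_cone\<close> they characterize the cone.\<close>

definition rels :: "(nat \<Rightarrow> complex) \<Rightarrow> bool"
  where "rels w \<longleftrightarrow> w (V 0) + w (V 1) = w (V 2) \<and>
    (\<forall>c\<le>N. w c ^ d = w (V 0) ^ E c 0 * w (V 1) ^ E c 1 * w (V 2) ^ E c 2) \<and>
    (\<forall>c t v u A B r A' B'. c \<le> N \<longrightarrow> t \<le> N \<longrightarrow> v \<le> N \<longrightarrow> u \<le> N \<longrightarrow>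
      (\<forall>n<3. E c n + E t n * A + E v n * B = E u n * r + E t n * A' + E v n * B') \<longrightarrow>
      w c * w t ^ A * w v ^ B = w u ^ r * w t ^ A' * w v ^ B')"

lemma toric_map_rel:
  assumes "c \<le> N" "t \<le> N" "v \<le> N" "u \<le> N"
    and eq: "\<forall>n<3. E c n + E t n * A + E v n * B = E u n * r + E t n * A' + E v n * B'"
  shows "toric_map x c * toric_map x t ^ A * toric_map x v ^ B =
    toric_map x u ^ r * toric_map x t ^ A' * toric_map x v ^ B'"
proof -
  have "toric_map x c * toric_map x t ^ A * toric_map x v ^ B =
     x 0 ^ (E c 0 + E t 0 * A + E v 0 * B) * x 1 ^ (E c 1 + E t 1 * A + E v 1 * B) *
     x 2 ^ (E c 2 + E t 2 * A + E v 2 * B)"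
    using assms(1-4)
    by (simp add: toric_map_def power_add power_mult power_mult_distrib; simp add: mult_ac)
  also have "\<dots> = x 0 ^ (E u 0 * r + E t 0 * A' + E v 0 * B') * x 1 ^ (E u 1 * r + E t 1 * A' + E v 1 * B') *
     x 2 ^ (E u 2 * r + E t 2 * A' + E v 2 * B')"
    using eq by (simp add: all_less_3)
  also have "\<dots> = toric_map x u ^ r * toric_map x t ^ A' * toric_map x v ^ B'"
    using assms(1-4)
    by (simp add: toric_map_def power_add power_mult power_mult_distrib; simp add: mult_ac)
  finally show ?thesis .
qed

lemma rels_toric_map:
  assumes "fermat x"
  shows "rels (toric_map x)"
proof -
  have "toric_map x c ^ d = toric_map x (V 0) ^ E c 0 * toric_map x (V 1) ^ E c 1 * toric_map x (V 2) ^ E c 2"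
    if "c \<le> N" for c
  proof -
    have "toric_map x c ^ d = (x 0 ^ d) ^ E c 0 * (x 1 ^ d) ^ E c 1 * (x 2 ^ d) ^ E c 2"
      using that by (simp add: toric_map_def power_mult_distrib flip: power_mult) (simp add: mult.commute)
    then show ?thesis by (simp add: toric_map_V)
  qed
  then show ?thesis
    using assms toric_map_rel unfolding rels_def by (simp add: toric_map_V fermat_def)
qed

lemma rels_perm:
  assumes "rels w" "i < 3" "j < 3" "k < 3" "i \<noteq> j" "i \<noteq> k" "j \<noteq> k" "c \<le> N"
  shows "w c ^ d = w (V i) ^ E c i * w (V j) ^ E c j * w (V k) ^ E c k"
  using perm3_cases[OF assms(2-7)] assms(1,8)
  by (elim disjE conjE) (simp_all add: rels_def mult_ac)

text \<open>Roots chosen in the order x k, x j, x i make the coordinates \<open>V k\<close>,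
  \<open>t\<close> and \<open>u\<close> correct, and the chart relations determine all the others.
  Only the nonzero coordinates \<open>t\<close> and \<open>V k\<close> are cancelled there, so x i
  may be 0.\<close>

lemma chart_param:
  assumes w: "w \<in> vecs N" "rels w" and chart: "toric_chart N E V i j k u t"
    and nz: "w (V j) \<noteq> 0" "w (V k) \<noteq> 0"
  shows "w \<in> cone"
proof -
  have ijk: "i < 3" "j < 3" "k < 3" "i \<noteq> j" "i \<noteq> k" "j \<noteq> k"
    and ut: "u \<le> N" "t \<le> N" "0 < E u i" "E t i = 0" "0 < E t j"
    using chart by (auto simp: toric_chart_def)
  obtain xk where xk: "xk ^ d = w (V k)" using ex_complex_root[OF d_pos] by blast
  then have "xk \<noteq> 0" using nz d_pos by (auto simp: zero_power)
  obtain xj where xj: "xj ^ E t j = w t / xk ^ E t k" using ex_complex_root[OF ut(5)] by blast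
  have "w t ^ d \<noteq> 0" using rels_perm[OF w(2) ijk ut(2)] nz ut by simp
  then have wt: "w t \<noteq> 0" using d_pos by (auto simp: zero_power)
  then have "xj \<noteq> 0" using xj ut \<open>xk \<noteq> 0\<close> by (auto simp: zero_power)
  obtain xi where xi: "xi ^ E u i = w u / (xj ^ E u j * xk ^ E u k)" using ex_complex_root[OF ut(3)] by blast
  define x where "x = (\<lambda>_. 0)(i := xi, j := xj, k := xk)"
  have x: "x i = xi" "x j = xj" "x k = xk" using ijk by (auto simp: x_def)
  have t: "toric_map x t = w t"
    using ut \<open>xk \<noteq> 0\<close> by (simp add: toric_map_perm[OF ijk] x xj)
  have u: "toric_map x u = w u"
    using ut \<open>xk \<noteq> 0\<close> \<open>xj \<noteq> 0\<close> by (simp add: toric_map_perm[OF ijk] x xi)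
  have k: "toric_map x (V k) = w (V k)"
    using ijk by (simp add: toric_map_V x xk)
  have c: "toric_map x c = w c" for c
  proof (cases "c \<le> N")
    case True
    then obtain r A B A' B' where eq:
      "\<forall>n<3. E c n + E t n * A + E (V k) n * B = E u n * r + E t n * A' + E (V k) n * B'"
      using chart unfolding toric_chart_def by blast
    have "w c * w t ^ A * w (V k) ^ B = w u ^ r * w t ^ A' * w (V k) ^ B'"
      using w(2) True ut V_le[OF ijk(3)] eq unfolding rels_def by blast
    also have "\<dots> = toric_map x c * w t ^ A * w (V k) ^ B"
      using toric_map_rel[OF True ut(2) V_le[OF ijk(3)] ut(1) eq, of x] by (simp add: t u k)
    finally show ?thesis using wt nz by simp
  qed (use w in \<open>simp add: toric_map_def vecs_def\<close>)
  then have wx: "w = toric_map x" by (intro ext) simp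
  have "fermat x"
    using w(2) unfolding rels_def fermat_def wx by (simp add: toric_map_V)
  then show ?thesis using wx by (auto simp: cone_def)
qed

text \<open>The linear equation kills the third vertex coordinate, and then the d-th power equations
  kill every coordinate. Hence at most one vertex coordinate vanishes at a point, and the charts
  cover the curve.\<close>

lemma rels_vertices:
  assumes "w \<in> vecs N" "rels w" "i < 3" "j < 3" "i \<noteq> j" "w (V i) = 0" "w (V j) = 0"
  shows "w = 0"
proof
  fix c
  obtain k where k: "k < 3" "i \<noteq> k" "j \<noteq> k" using ex_third[of i j] by blast
  have "sg i * w (V i) + sg j * w (V j) + sg k * w (V k) = 0"
    using lin_perm[OF assms(3,4) k(1) assms(5) k(2,3), of "\<lambda>i. w (V i)"] assms(2) by (simp add: rels_def)
  then have "w (V k) = 0" using assms by simp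
  then have "w (V 0) = 0" "w (V 1) = 0" "w (V 2) = 0"
    using perm3_cases[OF assms(3,4) k(1) assms(5) k(2,3)] assms by auto
  moreover have "E c 0 > 0 \<or> E c 1 > 0 \<or> E c 2 > 0" if "c \<le> N"
    using E_sum[OF that] d_pos by auto
  ultimately have "w c ^ d = 0" if "c \<le> N"
    using that assms(2) by (auto simp: rels_def zero_power)
  then show "w c = 0 c" using assms(1) by (cases "c \<le> N") (auto simp: vecs_def)
qed

lemma chart_choice:
  assumes "w \<in> vecs N" "rels w" "w \<noteq> 0"
  obtains i j k u t where "toric_chart N E V i j k u t" "w (V j) \<noteq> 0" "w (V k) \<noteq> 0"
proof -
  obtain i where i: "i < 3" "\<And>j. j < 3 \<Longrightarrow> j \<noteq> i \<Longrightarrow> w (V j) \<noteq> 0"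
  proof (cases "\<exists>i<3. w (V i) = 0")
    case True
    then obtain i where "i < 3" "w (V i) = 0" by auto
    then show ?thesis using rels_vertices[OF assms(1,2)] assms(3) that by metis
  next
    case False
    then show ?thesis using that[of 0] by auto
  qed
  then obtain j k u t where chart: "toric_chart N E V i j k u t" using chart_ex by blast
  then show ?thesis using that i by (auto simp: toric_chart_def)
qed

lemma rels_cone: "w \<in> vecs N \<Longrightarrow> rels w \<Longrightarrow> w \<in> cone"
  using chart_choice chart_param zero_in_cone by metis

lemma cone_rels: "w \<in> cone \<Longrightarrow> rels w"
  using rels_toric_map by (auto simp: cone_def)

end

locale toric_curve_over = toric_curve d N E V + algebraic_coeffs K
  for d N :: nat and E :: "nat \<Rightarrow> nat \<Rightarrow> nat" and V :: "nat \<Rightarrow> nat" and K :: "complex set"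
begin

lemma form_lin: "is_form K N 1 (\<lambda>w. w (V 0) + w (V 1) - w (V 2))"
  by (intro is_form_diff is_form_add is_form_coord V_le) auto

lemma form_pow:
  assumes "c \<le> N"
  shows "is_form K N d (\<lambda>w. w c ^ d - w (V 0) ^ E c 0 * w (V 1) ^ E c 1 * w (V 2) ^ E c 2)"
proof -
  have "is_form K N (d * 1) (\<lambda>w. w c ^ d)"
    "is_form K N (E c 0 * 1 + E c 1 * 1 + E c 2 * 1) (\<lambda>w. w (V 0) ^ E c 0 * w (V 1) ^ E c 1 * w (V 2) ^ E c 2)"
    by (intro is_form_mult is_form_power is_form_coord V_le assms; simp)+
  then show ?thesis using E_sum[OF assms] is_form_diff by simp
qed

text \<open>Both monomials have the same degree: sum the exponent identities over the three
  variables and divide by \<open>d\<close>.\<close>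

lemma form_rel:
  assumes "c \<le> N" "t \<le> N" "v \<le> N" "u \<le> N"
    and eq: "\<forall>n<3. E c n + E t n * A + E v n * B = E u n * r + E t n * A' + E v n * B'"
  shows "is_form K N (1 + A + B) (\<lambda>w. w c * w t ^ A * w v ^ B - w u ^ r * w t ^ A' * w v ^ B')"
proof -
  have E: "E b 0 * m + E b 1 * m + E b 2 * m = d * m" if "b \<le> N" for b m
    using E_sum[OF that] by (simp flip: add_mult_distrib)
  have "d * 1 + d * A + d * B = d * r + d * A' + d * B'"
    using eq E[OF assms(1), of 1] E[OF assms(2), of A] E[OF assms(2), of A'] E[OF assms(3), of B]
      E[OF assms(3), of B'] E[OF assms(4), of r] unfolding all_less_3 by linarith
  then have "d * (1 + A + B) = d * (r + A' + B')" by (simp add: algebra_simps)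
  then have "1 + A + B = r + A' + B'" using d_pos by (metis less_not_refl mult_cancel1)
  moreover have "is_form K N (1 + A * 1 + B * 1) (\<lambda>w. w c * w t ^ A * w v ^ B)"
    "is_form K N (r * 1 + A' * 1 + B' * 1) (\<lambda>w. w u ^ r * w t ^ A' * w v ^ B')"
    by (intro is_form_mult is_form_power is_form_coord assms)+
  ultimately show ?thesis using is_form_diff by simp
qed

end


section \<open>Local parametrizations and tangent spaces\<close>

context toric_curve
begin

lemma chart_dvd:
  assumes "toric_chart N E V i j k u t" "c \<le> N"
  shows "E u i dvd E c i"
proof -
  obtain r A B A' B' where
    "\<forall>n<3. E c n + E t n * A + E (V k) n * B = E u n * r + E t n * A' + E (V k) n * B'"
    using assms unfolding toric_chart_def by blast
  moreover have "i < 3" "E t i = 0" "E (V k) i = 0"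
    using assms(1) E_V[of k i] by (auto simp: toric_chart_def)
  ultimately have "E c i = E u i * r" by fastforce
  then show ?thesis by simp
qed

text \<open>A parametrization of the cone near a point in a chart.  Its parameter is \<open>x i ^ E u i\<close>, and
  \<open>x j\<close> is a branch of the \<open>d\<close>-th root determined by the equation of the Fermat curve.\<close>

lemma local_curve:
  assumes chart: "toric_chart N E V i j k u t" and x: "fermat x" "x j \<noteq> 0" "x k \<noteq> 0"
  obtains w q z0 where "w z0 = toric_map x" "\<And>c. ((\<lambda>z. w z c) has_field_derivative q c) (at z0)"
    "\<forall>\<^sub>F z in nhds z0. w z \<in> cone" "q (V k) = 0" "x i \<noteq> 0 \<Longrightarrow> q (V i) \<noteq> 0" "x i = 0 \<Longrightarrow> q u \<noteq> 0"
    "x i = 0 \<Longrightarrow> z0 = 0" "\<And>z. z \<noteq> 0 \<Longrightarrow> w z (V i) \<noteq> 0" "\<And>z. w z (V k) \<noteq> 0"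
proof -
  have ijk: "i < 3" "j < 3" "k < 3" "i \<noteq> j" "i \<noteq> k" "j \<noteq> k"
    and ut: "u \<le> N" "t \<le> N" "0 < E u i"
    using chart by (auto simp: toric_chart_def)
  \<comment> \<open>By \<open>chart_dvd\<close> all exponents of x i are multiples of
    \<open>e\<close>, so x i enters the coordinates only through z = x i ^ e.\<close>
  define e where "e = E u i"
  have e: "e > 0" using ut by (simp add: e_def)
  have div: "E c i = e * (E c i div e)" if "c \<le> N" for c
    using chart_dvd[OF chart that] by (simp add: e_def)
  define R where "R = d div e"
  have R: "d = e * R"
    using div[OF V_le[OF ijk(1)]] E_V[OF ijk(1,1)] by (simp add: R_def)
  have "R > 0" using R d_pos by (cases R) auto
  \<comment> \<open>Solving the Fermat equation for the variable with index \<open>j\<close> gives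
    y^d = x j ^ d * H z. As H z0 = 1, the principal logarithm provides a holomorphic d-th root near
    z0.\<close>
  define H where "H z = - (sg i * z ^ R + sg k * x k ^ d) / (sg j * x j ^ d)" for z
  define y where "y z = x j * exp (Ln (H z) / of_nat d)" for z
  define w where "w z c = (if c \<le> N then z ^ (E c i div e) * y z ^ E c j * x k ^ E c k else 0)" for z c
  define z0 where "z0 = x i ^ e"
  have "sg i * z0 ^ R + sg k * x k ^ d = - (sg j * x j ^ d)"
    using x(1) fermat_perm[OF ijk, of x]
    by (simp add: z0_def R flip: power_mult) (simp add: algebra_simps eq_neg_iff_add_eq_0)
  then have H0: "H z0 = 1"
    using x(2) unfolding H_def by simp
  then have y0: "y z0 = x j" by (simp add: y_def)
  define H' where "H' = - (sg i * (of_nat R * z0 ^ (R - 1))) / (sg j * x j ^ d)"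
  have H': "(H has_field_derivative H') (at z0)"
    unfolding H_def H'_def using x(2) by (auto intro!: derivative_eq_intros)
  have "(Ln has_field_derivative inverse (H z0)) (at (H z0))"
    by (rule has_field_derivative_Ln) (simp add: H0)
  from DERIV_chain2[OF this H']
  have "((\<lambda>z. Ln (H z) / of_nat d) has_field_derivative inverse (H z0) * H' / of_nat d) (at z0)"
    by (rule DERIV_cdivide)
  from DERIV_cmult[OF DERIV_chain2[OF DERIV_exp this], of "x j"]
  obtain y' where y': "(y has_field_derivative y') (at z0)"
    unfolding y_def by blast
  define q where "q c = (if c \<le> N then (of_nat (E c i div e) * z0 ^ (E c i div e - 1) * y z0 ^ E c j +
    z0 ^ (E c i div e) * (of_nat (E c j) * y z0 ^ (E c j - 1) * y')) * x k ^ E c k else 0)" for c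
  have "((\<lambda>z. w z c) has_field_derivative q c) (at z0)" for c
  proof (cases "c \<le> N")
    case True
    show ?thesis
      unfolding w_def q_def using True
      by (auto intro!: derivative_eq_intros y' simp: algebra_simps)
  qed (simp add: w_def q_def)
  moreover have "w z0 = toric_map x"
  proof
    fix c
    show "w z0 c = toric_map x c"
    proof (cases "c \<le> N")
      case True
      have "z0 ^ (E c i div e) = x i ^ E c i"
        by (subst (2) div[OF True]) (simp add: z0_def power_mult)
      then show ?thesis using True by (simp add: w_def y0 toric_map_perm[OF ijk])
    qed (simp add: w_def toric_map_def)
  qed
  moreover have "\<forall>\<^sub>F z in nhds z0. w z \<in> cone"
  proof -
    have "\<forall>\<^sub>F z in nhds z0. H z \<noteq> 0"
      unfolding eventually_nhds_conv_at
      using tendsto_imp_eventually_ne[OF isContD[OF DERIV_isCont[OF H']], of 0] H0 by simp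
    then show ?thesis
    proof (rule eventually_mono)
      fix z assume Hz: "H z \<noteq> 0"
      obtain xi where xi: "xi ^ e = z" using ex_complex_root[OF e] by blast
      define x' where "x' = (\<lambda>_. 0)(i := xi, j := y z, k := x k)"
      have x': "x' i = xi" "x' j = y z" "x' k = x k" using ijk by (auto simp: x'_def)
      have "exp (Ln (H z) / of_nat d) ^ d = H z"
        using d_pos Hz by (simp flip: exp_of_nat_mult)
      then have "y z ^ d = x j ^ d * H z"
        by (simp add: y_def power_mult_distrib)
      then have "sg j * y z ^ d = - (sg i * z ^ R + sg k * x k ^ d)"
        using x(2) by (simp add: H_def)
      moreover have "xi ^ d = z ^ R" by (simp add: R power_mult xi)
      ultimately have "fermat x'"
        unfolding fermat_perm[OF ijk] x' by simp
      moreover have "w z = toric_map x'"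
      proof
        fix c
        show "w z c = toric_map x' c"
        proof (cases "c \<le> N")
          case True
          have "z ^ (E c i div e) = xi ^ E c i"
            by (subst (2) div[OF True]) (simp add: xi power_mult)
          then show ?thesis using True by (simp add: w_def toric_map_perm[OF ijk] x')
        qed (simp add: w_def toric_map_def)
      qed
      ultimately show "w z \<in> cone" by (auto simp: cone_def)
    qed
  qed
  moreover have Vk: "V k \<le> N" "E (V k) i = 0" "E (V k) j = 0"
    and Vi: "V i \<le> N" "E (V i) i = d" "E (V i) j = 0" "E (V i) k = 0"
    using ijk V_le E_V by auto
  have "q (V k) = 0" by (simp add: q_def Vk)
  moreover have "q (V i) \<noteq> 0" if "x i \<noteq> 0"
    using that \<open>R > 0\<close> by (simp add: q_def Vi R_def[symmetric] z0_def)
  \<comment> \<open>Coordinate \<open>u\<close> contains z to the power E u i div e = 1, so its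
    derivative at z = 0 is a product of powers of x j and x k.\<close>
  moreover have "q u \<noteq> 0" if "x i = 0"
  proof -
    have "z0 = 0" using that e by (simp add: z0_def zero_power)
    moreover have "y 0 = x j" using y0 by (simp add: \<open>z0 = 0\<close>)
    ultimately show ?thesis using ut(1) x e by (simp add: q_def e_def[symmetric])
  qed
  moreover have "z0 = 0" if "x i = 0" using that e by (simp add: z0_def zero_power)
  moreover have "w z (V i) \<noteq> 0" if "z \<noteq> 0" for z
    using that by (simp add: w_def Vi)
  moreover have "w z (V k) \<noteq> 0" for z
    using x(3) by (simp add: w_def Vk)
  ultimately show ?thesis using that[of w z0 q] by blast
qed

end

context toric_curve_over
begin

text \<open>Every equation in \<open>rels\<close> comes from a form over \<open>K\<close> that
  vanishes on the cone. With \<open>rels_cone\<close> this shows that the curve is closed over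
  \<open>K\<close>.\<close>

lemma vanishing_rels:
  assumes "\<And>e F. is_form K N e F \<Longrightarrow> (\<And>v. v \<in> cone \<Longrightarrow> F v = 0) \<Longrightarrow> F w = 0"
  shows "rels w"
  unfolding rels_def
proof (intro conjI allI impI)
  show "w (V 0) + w (V 1) = w (V 2)"
    using assms[OF form_lin] cone_rels by (simp add: rels_def)
  show "w c ^ d = w (V 0) ^ E c 0 * w (V 1) ^ E c 1 * w (V 2) ^ E c 2" if "c \<le> N" for c
    using assms[OF form_pow[OF that]] cone_rels that by (simp add: rels_def)
  fix c t v u A B r A' B'
  assume h: "c \<le> N" "t \<le> N" "v \<le> N" "u \<le> N"
    "\<forall>n<3. E c n + E t n * A + E v n * B = E u n * r + E t n * A' + E v n * B'"
  have "w' c * w' t ^ A * w' v ^ B - w' u ^ r * w' t ^ A' * w' v ^ B' = 0" if "w' \<in> cone" for w'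
    using cone_rels[OF that] h unfolding rels_def by simp
  from assms[OF form_rel[OF h] this]
  show "w c * w t ^ A * w v ^ B = w u ^ r * w t ^ A' * w v ^ B'" by simp
qed

lemma curve_closed: "zariski_closed K N curve"
proof -
  define \<F> where "\<F> = {F. (\<exists>e. is_form K N e F) \<and> (\<forall>v\<in>cone. F v = 0)}"
  have "curve = {L \<in> proj N. \<forall>F\<in>\<F>. vanishes_on F L}"
  proof
    show "curve \<subseteq> {L \<in> proj N. \<forall>F\<in>\<F>. vanishes_on F L}"
      using curve_proj vanishes_on_curve by (auto simp: \<F>_def)
    show "{L \<in> proj N. \<forall>F\<in>\<F>. vanishes_on F L} \<subseteq> curve"
    proof
      fix L assume L: "L \<in> {L \<in> proj N. \<forall>F\<in>\<F>. vanishes_on F L}"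
      then have "L \<in> proj N" by simp
      then obtain v where v: "v \<in> L" "v \<noteq> 0" "v \<in> vecs N" "L = line v" by (rule proj_rep)
      have "rels v"
        by (rule vanishing_rels) (use L v in \<open>auto simp: \<F>_def vanishes_on_def\<close>)
      then show "L \<in> curve" using rels_cone v by (auto simp: curve_def)
    qed
  qed
  then show ?thesis
    unfolding zariski_closed_iff by (intro exI[of _ \<F>]) (auto simp: \<F>_def)
qed

lemma tangent_form:
  assumes "v \<in> cone_tangent K N curve p" "is_form K N e F" "\<And>w. w \<in> cone \<Longrightarrow> F w = 0"
    and "((\<lambda>z. F (\<lambda>i. p i + z * v i)) has_field_derivative D) (at 0)"
  shows "D = 0"
proof -
  obtain f where f: "f \<in> forms K N e" "F = mpoly_eval f" using assms(2) by (auto simp: is_form_def)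
  have "vanishes_on F L" if "L \<in> curve" for L
    by (rule vanishes_on_curve[OF _ that]) (rule assms(3))
  then have "f \<in> vanishing_forms K N curve"
    using f by (auto simp: vanishing_forms_def vanishes_at_def vanishes_on_def)
  then have "mpoly_diff f p v = 0" using assms(1) by (simp add: cone_tangent_def)
  then show ?thesis using DERIV_imp_deriv[OF assms(4)] by (simp add: mpoly_diff_def f)
qed

lemma tangent_lin:
  assumes "v \<in> cone_tangent K N curve p"
  shows "v (V 0) + v (V 1) = v (V 2)"
proof -
  have "v (V 0) + v (V 1) - v (V 2) = 0"
    by (rule tangent_form[OF assms form_lin])
      (use cone_rels in \<open>auto simp: rels_def intro!: derivative_eq_intros\<close>)
  then show ?thesis by simp
qed

text \<open>Along p + z v the vertex coordinates do not move, so the derivative of the d-th power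
  equation is d * p c ^ (d - 1) * v c = 0.\<close>

lemma tangent_pow:
  assumes "v \<in> cone_tangent K N curve p" "c \<le> N" "p c \<noteq> 0" "v (V 0) = 0" "v (V 1) = 0" "v (V 2) = 0"
  shows "v c = 0"
proof -
  have "of_nat d * (v c * p c ^ (d - 1)) = 0"
  proof (rule tangent_form[OF assms(1) form_pow[OF assms(2)]])
    show "w c ^ d - w (V 0) ^ E c 0 * w (V 1) ^ E c 1 * w (V 2) ^ E c 2 = 0" if "w \<in> cone" for w
      using cone_rels[OF that] assms(2) by (simp add: rels_def)
  qed (use assms in \<open>auto intro!: derivative_eq_intros\<close>)
  then show ?thesis using d_pos assms(3) by simp
qed

text \<open>Along p + z v coordinate \<open>u\<close> stays 0, so the right side of the binomial
  vanishes identically as r > 0, while the left side has derivative v c times a nonzero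
  number.\<close>

lemma tangent_rel:
  assumes v: "v \<in> cone_tangent K N curve p" and le: "c \<le> N" "t \<le> N" "s \<le> N" "u \<le> N" and "r > 0"
    and eq: "\<forall>n<3. E c n + E t n * A + E s n * B = E u n * r + E t n * A' + E s n * B'"
    and p: "p c = 0" "p u = 0" "v u = 0" "p t \<noteq> 0" "p s \<noteq> 0"
  shows "v c = 0"
proof -
  have "v c * (p t ^ A * p s ^ B) = 0"
  proof (rule tangent_form[OF v form_rel[OF le eq]])
    show "w c * w t ^ A * w s ^ B - w u ^ r * w t ^ A' * w s ^ B' = 0" if "w \<in> cone" for w
      using cone_rels[OF that] le eq unfolding rels_def by simp
    have "((\<lambda>z. z * v c * (p t + z * v t) ^ A * (p s + z * v s) ^ B) has_field_derivative
        v c * (p t ^ A * p s ^ B)) (at 0)"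
      by (auto intro!: derivative_eq_intros)
    then show "((\<lambda>z. (p c + z * v c) * (p t + z * v t) ^ A * (p s + z * v s) ^ B -
         (p u + z * v u) ^ r * (p t + z * v t) ^ A' * (p s + z * v s) ^ B') has_field_derivative
        v c * (p t ^ A * p s ^ B)) (at 0)"
      using p \<open>r > 0\<close> by (simp add: zero_power)
  qed
  then show ?thesis using p by simp
qed

lemma tangent_vertices:
  assumes "v \<in> cone_tangent K N curve p" "i < 3" "k < 3" "i \<noteq> k" "v (V i) = 0" "v (V k) = 0" "n < 3"
  shows "v (V n) = 0"
proof -
  obtain j where j: "j < 3" "i \<noteq> j" "k \<noteq> j" using ex_third[of i k] by blast
  have "sg i * v (V i) + sg j * v (V j) + sg k * v (V k) = 0"
    using lin_perm[of i j k "\<lambda>i. v (V i)"] assms j tangent_lin[OF assms(1)] by simp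
  then have "v (V j) = 0" using assms by simp
  then show ?thesis
    using less_3_cases[OF assms(7)] perm3_cases[of i j k] j assms by auto
qed

lemma tangent_kernel_interior:
  assumes v: "v \<in> cone_tangent K N curve (toric_map x)" and x: "\<And>n. n < 3 \<Longrightarrow> x n \<noteq> 0"
    and ik: "i < 3" "k < 3" "i \<noteq> k" "v (V i) = 0" "v (V k) = 0"
  shows "v = 0"
proof
  fix c
  show "v c = 0 c"
  proof (cases "c \<le> N")
    case True
    have "v (V n) = 0" if "n < 3" for n using tangent_vertices[OF v ik that] .
    moreover have "toric_map x c \<noteq> 0" using True x by (simp add: toric_map_def)
    ultimately show ?thesis using tangent_pow[OF v True] by simp
  qed (use v in \<open>simp add: cone_tangent_def vecs_def\<close>)
qed

text \<open>Coordinates divisible by x i fall to \<open>tangent_rel\<close>. One of them is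
  \<open>V i\<close>, so all vertex coordinates of \<open>v\<close> vanish, and
  \<open>tangent_pow\<close> settles the remaining coordinates, where the point is nonzero.\<close>

lemma tangent_kernel_edge:
  assumes v: "v \<in> cone_tangent K N curve (toric_map x)" and chart: "toric_chart N E V i j k u t"
    and x: "x i = 0" "x j \<noteq> 0" "x k \<noteq> 0" and vu: "v u = 0" "v (V k) = 0"
  shows "v = 0"
proof
  fix c
  have ijk: "i < 3" "j < 3" "k < 3" "i \<noteq> j" "i \<noteq> k" "j \<noteq> k"
    and ut: "u \<le> N" "t \<le> N" "0 < E u i" "E t i = 0" "0 < E t j"
    using chart by (auto simp: toric_chart_def)
  have pos: "v c = 0" if c: "c \<le> N" "E c i > 0" for c
  proof -
    obtain r A B A' B' where eq:
      "\<forall>n<3. E c n + E t n * A + E (V k) n * B = E u n * r + E t n * A' + E (V k) n * B'"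
      using chart c unfolding toric_chart_def by blast
    have "E c i = E u i * r" using eq[rule_format, OF ijk(1)] ut E_V[of k i] ijk by simp
    then have "r > 0" using c by (cases r) auto
    then show ?thesis
      using tangent_rel[OF v c(1) ut(2) V_le[OF ijk(3)] ut(1) _ eq] vu x c ut V_le[OF ijk(3)] E_V[of k i] ijk
      by (simp add: toric_map_perm[OF ijk] zero_power)
  qed
  have Vi: "v (V i) = 0" using pos[OF V_le[OF ijk(1)]] E_V[of i i] ijk d_pos by simp
  have V: "v (V n) = 0" if "n < 3" for n
    using tangent_vertices[OF v ijk(1,3,5) Vi vu(2) that] .
  show "v c = 0 c"
  proof (cases "c \<le> N")
    case True
    show ?thesis
    proof (cases "E c i = 0")
      case False
      then show ?thesis using pos[OF True] by simp
    next
      case c: True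
      then have "toric_map x c \<noteq> 0" using x by (simp add: toric_map_perm[OF ijk True])
      then show ?thesis using tangent_pow[OF v True] V by simp
    qed
  qed (use v in \<open>simp add: cone_tangent_def vecs_def\<close>)
qed

lemma cone_tangent_linear:
  assumes "u \<in> cone_tangent K N X p" "v \<in> cone_tangent K N X p"
  shows "(\<lambda>i. a * u i + b * v i) \<in> cone_tangent K N X p"
  using assms by (auto simp: cone_tangent_def vecs_def mpoly_diff_linear)

lemma cone_tangent_self:
  assumes "p \<in> cone"
  shows "p \<in> cone_tangent K N curve p"
proof -
  have "mpoly_diff f p p = 0" if f: "f \<in> vanishing_forms K N curve" for f
  proof (cases "p = 0")
    case True
    then show ?thesis by (simp add: mpoly_diff_def)
  next
    case False
    then have L: "line p \<in> curve" using assms by (auto simp: curve_def)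
    have "mpoly_eval f (\<lambda>i. p i + z * p i) = 0" for z
    proof -
      have "(\<lambda>i. p i + z * p i) = (\<lambda>i. (1 + z) * p i)" by (intro ext) (simp add: algebra_simps)
      then have "(\<lambda>i. p i + z * p i) \<in> line p" unfolding line_eq by blast
      then show ?thesis using f L by (auto simp: vanishing_forms_def vanishes_at_def)
    qed
    then show ?thesis by (simp add: mpoly_diff_def)
  qed
  then show ?thesis using assms cone_vecs by (auto simp: cone_tangent_def)
qed

lemma cone_tangent_curve:
  assumes w: "\<And>c. ((\<lambda>z. w z c) has_field_derivative q c) (at z0)" and "\<forall>\<^sub>F z in nhds z0. w z \<in> cone"
    and nz: "w z0 \<noteq> 0"
  shows "q \<in> cone_tangent K N curve (w z0)"
proof -
  have "q c = 0" if "c > N" for c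
  proof -
    have "\<forall>\<^sub>F z in nhds z0. w z c = 0"
      using assms(2) by (rule eventually_mono) (use that cone_vecs in \<open>auto simp: vecs_def\<close>)
    then have "((\<lambda>z. 0) has_field_derivative q c) (at z0)"
      using w[of c] by (subst (asm) DERIV_cong_ev[OF refl _ refl]) auto
    then show ?thesis using DERIV_unique DERIV_const by blast
  qed
  moreover have "mpoly_diff f (w z0) q = 0" if f: "f \<in> vanishing_forms K N curve" for f
  proof -
    obtain e where fe: "is_form K N e (mpoly_eval f)"
      using f by (auto simp: vanishing_forms_def is_form_def)
    have van: "mpoly_eval f v = 0" if "v \<in> cone" "v \<noteq> 0" for v
    proof -
      have "line v \<in> curve" using that by (auto simp: curve_def)
      then show ?thesis using f line_self[of v] by (auto simp: vanishing_forms_def vanishes_at_def)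
    qed
    obtain c where c: "w z0 c \<noteq> 0" using nz by (auto simp: fun_eq_iff)
    have "\<forall>\<^sub>F z in nhds z0. w z c \<noteq> 0"
      unfolding eventually_nhds_conv_at
      using tendsto_imp_eventually_ne[OF isContD[OF DERIV_isCont[OF w]] c] c by simp
    with assms(2) have "\<forall>\<^sub>F z in nhds z0. mpoly_eval f (w z) = 0"
      by eventually_elim (auto intro!: van simp: fun_eq_iff)
    then have "((\<lambda>z. 0) has_field_derivative mpoly_diff f (w z0) q) (at z0)"
      using mpoly_eval_has_field_derivative[of w q z0 f, OF w]
      by (subst (asm) DERIV_cong_ev[OF refl _ refl]) auto
    then show ?thesis using DERIV_unique DERIV_const by blast
  qed
  ultimately show ?thesis by (auto simp: cone_tangent_def vecs_def)
qed

text \<open>The point \<open>p\<close> and the velocity \<open>q\<close> of the local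
  parametrization form a basis. Their coordinates \<open>V k\<close> and \<open>s\<close> form a
  triangular matrix since q (V k) = 0, and by the kernel lemmas these two coordinates determine a
  tangent vector.\<close>

lemma tangent_dim:
  assumes "p \<in> cone" "p \<noteq> 0"
  shows "cvec.dim (cone_tangent K N curve p) = 2"
proof -
  obtain x where x: "fermat x" "p = toric_map x" using assms by (auto simp: cone_def)
  obtain i j k u t where chart: "toric_chart N E V i j k u t" and jk: "p (V j) \<noteq> 0" "p (V k) \<noteq> 0"
    using chart_choice[of p] assms cone_vecs cone_rels by blast
  have ijk: "i < 3" "j < 3" "k < 3" "i \<noteq> j" "i \<noteq> k" "j \<noteq> k"
    using chart by (auto simp: toric_chart_def)
  have xjk: "x j \<noteq> 0" "x k \<noteq> 0" using jk d_pos ijk by (auto simp: x toric_map_V zero_power)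
  obtain w q z0 where w: "w z0 = toric_map x" "\<And>c. ((\<lambda>z. w z c) has_field_derivative q c) (at z0)"
    "\<forall>\<^sub>F z in nhds z0. w z \<in> cone" and q: "q (V k) = 0" "x i \<noteq> 0 \<Longrightarrow> q (V i) \<noteq> 0" "x i = 0 \<Longrightarrow> q u \<noteq> 0"
    by (rule local_curve[OF chart x(1) xjk]) blast
  \<comment> \<open>Coordinate \<open>V i\<close> is a power of the parameter z, which may have
    derivative 0 at z = 0; where x i vanishes, \<open>u\<close> takes its place.\<close>
  define s where "s = (if x i = 0 then u else V i)"
  define T where "T = cone_tangent K N curve p"
  have qs: "q s \<noteq> 0" using q by (simp add: s_def)
  have pT: "p \<in> T" unfolding T_def by (rule cone_tangent_self[OF assms(1)])
  have qT: "q \<in> T" using cone_tangent_curve[of w q z0] w assms x by (simp add: T_def)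
  have kernel: "v = 0" if "v \<in> T" "v s = 0" "v (V k) = 0" for v
  proof (cases "x i = 0")
    case True
    then show ?thesis using tangent_kernel_edge[OF _ chart True xjk] that x by (simp add: T_def s_def)
  next
    case False
    then have "x n \<noteq> 0" if "n < 3" for n
      using perm3_cases[OF ijk] less_3_cases[OF that] xjk by auto
    then show ?thesis
      using tangent_kernel_interior[of v x i k] False that x ijk by (simp add: T_def s_def)
  qed
  have span: "T \<subseteq> cvec.span {p, q}"
  proof
    fix v assume v: "v \<in> T"
    define a where "a = v (V k) / p (V k)"
    define b where "b = (v s - a * p s) / q s"
    have "(\<lambda>i. 1 * v i + (- 1) * (a * p i + b * q i)) \<in> T"
      unfolding T_def by (intro cone_tangent_linear) (use v pT qT in \<open>auto simp: T_def\<close>)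
    then have "(\<lambda>i. 1 * v i + (- 1) * (a * p i + b * q i)) = 0"
      by (rule kernel) (use jk qs q in \<open>auto simp: a_def b_def field_simps\<close>)
    from fun_cong[OF this] have "v i + - (a * p i + b * q i) = 0" for i
      by (simp only: mult_1 mult_minus1 zero_fun_apply)
    then have "v i = a * p i + b * q i" for i
      by (simp only: eq_iff_diff_eq_0[of "v i"] diff_conv_add_uminus)
    then have v_eq: "v = (\<lambda>i. a * p i) + (\<lambda>i. b * q i)" by (intro ext) simp
    show "v \<in> cvec.span {p, q}"
      unfolding v_eq by (intro cvec.span_add cvec.span_scale cvec.span_base) auto
  qed
  have indep: "cvec.independent {p, q}"
  proof -
    have "p \<notin> cvec.span {q}"
    proof
      assume "p \<in> cvec.span {q}"
      then obtain a where "p = (\<lambda>i. a * q i)" by (auto simp: cvec.span_singleton)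
      then have "p (V k) = a * q (V k)" by metis
      then show False using jk q by simp
    qed
    moreover have "q \<noteq> 0" using qs by (auto simp: fun_eq_iff)
    ultimately show ?thesis by (simp add: cvec.independent_insert cvec.independent_empty cvec.span_empty)
  qed
  have "p \<noteq> q" using jk q by auto
  then show ?thesis
    using cvec.dim_unique[of "{p, q}" T 2] pT qT span indep by (simp add: T_def)
qed

end


section \<open>The Belyi pair\<close>

definition vec3 :: "complex \<Rightarrow> complex \<Rightarrow> complex \<Rightarrow> nat \<Rightarrow> complex"
  where "vec3 x y z i = (if i = 0 then x else if i = 1 then y else z)"

lemma line_eq_affine_pt_iff:
  assumes "g \<noteq> 0" "\<And>j. j > 1 \<Longrightarrow> g j = 0"
  shows "line g = affine_pt z \<longleftrightarrow> g 0 = z * g 1 \<and> g 1 \<noteq> 0"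
proof
  assume "line g = affine_pt z"
  then have "g \<in> affine_pt z" using line_self by blast
  then obtain a where a: "g = (\<lambda>i. a * (if i = 0 then z else if i = 1 then 1 else 0))"
    by (auto simp: affine_pt_def line_eq)
  then have "a \<noteq> 0" using assms(1) by (auto simp: fun_eq_iff)
  then show "g 0 = z * g 1 \<and> g 1 \<noteq> 0" by (simp add: a)
next
  assume g: "g 0 = z * g 1 \<and> g 1 \<noteq> 0"
  have "g = (\<lambda>i. g 1 * (if i = 0 then z else if i = 1 then 1 else 0))"
  proof
    fix i :: nat
    consider "i = 0" | "i = 1" | "i > 1" by linarith
    then show "g i = g 1 * (if i = 0 then z else if i = 1 then 1 else 0)"
      using g assms(2) by cases auto
  qed
  then have "g \<in> affine_pt z" unfolding affine_pt_def line_eq by blast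
  then show "line g = affine_pt z" unfolding affine_pt_def by (rule line_eq_line[OF _ assms(1)])
qed

lemma line_eq_infinity_pt:
  assumes "g \<noteq> 0" "\<And>j. j > 1 \<Longrightarrow> g j = 0" "g 1 = 0"
  shows "line g = infinity_pt"
proof -
  have "g = (\<lambda>i. g 0 * (if i = 0 then 1 else 0))"
  proof
    fix i :: nat
    consider "i = 0" | "i = 1" | "i > 1" by linarith
    then show "g i = g 0 * (if i = 0 then 1 else 0)"
      using assms by cases auto
  qed
  then have "g \<in> infinity_pt" unfolding infinity_pt_def line_eq by blast
  then show ?thesis unfolding infinity_pt_def by (rule line_eq_line[OF _ assms(1)])
qed

context toric_curve
begin

lemma fermat_vec3: "fermat (vec3 x y z) \<longleftrightarrow> x ^ d + y ^ d = z ^ d"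
  by (simp add: fermat_def vec3_def)

lemma toric_map_vec3:
  "toric_map (vec3 x y z) c = (if c \<le> N then x ^ E c 0 * y ^ E c 1 * z ^ E c 2 else 0)"
  by (simp add: toric_map_def vec3_def)

lemma toric_map_vec3_V:
  "toric_map (vec3 x y z) (V 0) = x ^ d" "toric_map (vec3 x y z) (V 1) = y ^ d"
  "toric_map (vec3 x y z) (V 2) = z ^ d"
  by (simp_all add: toric_map_V vec3_def)

lemma vec3_in_cone: "x ^ d + y ^ d = z ^ d \<Longrightarrow> toric_map (vec3 x y z) \<in> cone"
  by (auto simp: cone_def fermat_vec3)

lemma vec3_nonzero: "x \<noteq> 0 \<or> y \<noteq> 0 \<or> z \<noteq> 0 \<Longrightarrow> toric_map (vec3 x y z) \<noteq> 0"
  using toric_map_nonzero[of 0 "vec3 x y z"] toric_map_nonzero[of 1 "vec3 x y z"]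
    toric_map_nonzero[of 2 "vec3 x y z"] by (auto simp: vec3_def)

lemma vec3_in_curve:
  "x ^ d + y ^ d = z ^ d \<Longrightarrow> x \<noteq> 0 \<or> y \<noteq> 0 \<or> z \<noteq> 0 \<Longrightarrow> line (toric_map (vec3 x y z)) \<in> curve"
  unfolding curve_def using vec3_in_cone vec3_nonzero by auto

lemma cone_vec3:
  assumes "w \<in> cone"
  obtains x y z where "w = toric_map (vec3 x y z)" "x ^ d + y ^ d = z ^ d"
proof -
  obtain x where x: "w = toric_map x" "fermat x" using assms by (auto simp: cone_def)
  have "toric_map x = toric_map (vec3 (x 0) (x 1) (x 2))"
    by (intro ext) (simp add: toric_map_def vec3_def)
  then show ?thesis using that x by (auto simp: fermat_def)
qed

lemma curve_cases:
  assumes "L \<in> curve"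
  obtains x y where "L = line (toric_map (vec3 x y 1))" "x ^ d + y ^ d = 1"
  | y where "L = line (toric_map (vec3 1 y 0))" "y ^ d = - 1"
proof -
  obtain w where w: "w \<in> cone" "w \<noteq> 0" "L = line w" using assms by (auto simp: curve_def)
  obtain x y z where xyz: "w = toric_map (vec3 x y z)" "x ^ d + y ^ d = z ^ d"
    using cone_vec3[OF w(1)] by blast
  have scale: "w = (\<lambda>c. b ^ d * toric_map (vec3 (x / b) (y / b) (z / b)) c)" if "b \<noteq> 0" for b
  proof
    fix c
    have "(\<lambda>i. b * vec3 (x / b) (y / b) (z / b) i) = vec3 x y z"
      by (intro ext) (use that in \<open>simp add: vec3_def\<close>)
    then show "w c = b ^ d * toric_map (vec3 (x / b) (y / b) (z / b)) c"
      unfolding xyz(1) using toric_map_scale[of b "vec3 (x / b) (y / b) (z / b)" c] by simp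
  qed
  have L: "L = line (toric_map (vec3 (x / b) (y / b) (z / b)))" if "b \<noteq> 0" for b
  proof -
    have "w \<in> line (toric_map (vec3 (x / b) (y / b) (z / b)))"
      unfolding line_eq using scale[OF that] by blast
    then show ?thesis using line_eq_line w by metis
  qed
  show ?thesis
  proof (cases "z = 0")
    case False
    have "(x / z) ^ d + (y / z) ^ d = 1"
      using False xyz(2) by (simp add: power_divide flip: add_divide_distrib)
    then show ?thesis using that(1) L[OF False] False by simp
  next
    case True
    have "x \<noteq> 0"
    proof
      assume "x = 0"
      then have "y = 0" using xyz(2) True d_pos by (simp add: zero_power)
      then have w0: "w (V 0) = 0" "w (V 1) = 0"
        unfolding xyz(1) toric_map_vec3_V using \<open>x = 0\<close> d_pos by (simp_all add: zero_power)
      have "w \<in> vecs N" using cone_vecs w(1) by blast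
      from rels_vertices[OF this cone_rels[OF w(1)] _ _ _ w0] have "w = 0" by simp
      then show False using w by simp
    qed
    moreover have "(y / x) ^ d = - 1"
    proof -
      have "y ^ d = - (x ^ d)" using xyz(2) True d_pos by (simp add: zero_power add_eq_0_iff)
      then show ?thesis using \<open>x \<noteq> 0\<close> by (simp add: power_divide)
    qed
    ultimately show ?thesis using that(2) L[of x] True by simp
  qed
qed

end

context toric_curve_over
begin

lemma form_poly2:
  assumes "is_form K N e F"
  obtains P where "\<And>m n. algebraic (coeff (coeff P m) n)" "\<And>x y. F (toric_map (vec3 x y 1)) = poly2 P x y"
proof -
  obtain S c n where S: "finite S" "\<forall>m\<in>S. c m \<in> K \<and> (\<Sum>i\<le>N. n m i) = e"
    and F: "F = (\<lambda>v. \<Sum>m\<in>(S :: (nat \<Rightarrow>\<^sub>0 nat) set). c m * (\<Prod>i\<le>N. v i ^ n m i))"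
    using is_form_expand[OF assms] by blast
  define a where "a m = (\<Sum>i\<le>N. E i 0 * n m i)" for m
  define b where "b m = (\<Sum>i\<le>N. E i 1 * n m i)" for m
  define P where "P = (\<Sum>m\<in>S. monom (monom (c m) (a m)) (b m))"
  have "(\<Prod>i\<le>N. toric_map (vec3 x y 1) i ^ n m i) = x ^ a m * y ^ b m" for x y m
    by (simp add: toric_map_vec3 power_mult_distrib prod.distrib a_def b_def power_sum power_mult)
  then have "F (toric_map (vec3 x y 1)) = poly2 P x y" for x y
    by (simp add: F P_def poly2_def poly_sum poly_monom mult_ac poly_power)
  moreover have "algebraic (c m)" if "m \<in> S" for m
    using S(2) that algebraic_K by blast
  then have "algebraic (coeff (coeff P k) l)" for k l
    by (auto simp: P_def coeff_sum intro!: algebraic_sum)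
  ultimately show ?thesis using that by blast
qed

text \<open>In the chart of a point at infinity the local parametrization passes through it at z = 0
  and is affine for all other z, so the value of \<open>F\<close> there is a limit of zeros.\<close>

lemma vanishes_at_infinity:
  assumes F: "is_form K N e F" and zero: "\<And>x y. x ^ d + y ^ d = 1 \<Longrightarrow> F (toric_map (vec3 x y 1)) = 0"
    and y: "y ^ d = - 1"
  shows "F (toric_map (vec3 1 y 0)) = 0"
proof -
  have van: "F w = 0" if w: "w \<in> cone" "w (V 2) \<noteq> 0" for w
  proof -
    have "w \<noteq> 0" using w by auto
    then have L: "line w \<in> curve" using w by (auto simp: curve_def)
    from L show ?thesis
    proof (cases rule: curve_cases)
      case (1 x y)
      then have "vanishes_on F (line w)" using zero[OF 1(2)] vanishes_on_line[OF F] by simp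
      then show ?thesis using line_self by (simp add: vanishes_on_def)
    next
      case (2 y)
      then have "w \<in> line (toric_map (vec3 1 y 0))" using line_self[of w] by simp
      then show ?thesis using w(2) d_pos by (auto simp: line_eq toric_map_vec3_V zero_power)
    qed
  qed
  obtain j k u t where chart: "toric_chart N E V 2 j k u t" using chart_ex[of 2] by auto
  let ?x = "vec3 1 y 0"
  have "y \<noteq> 0" using y d_pos by (auto simp: zero_power)
  moreover have "j = 0 \<and> k = 1 \<or> j = 1 \<and> k = 0"
    using chart perm3_cases[of 2 j k] by (auto simp: toric_chart_def)
  ultimately have x: "?x j \<noteq> 0" "?x k \<noteq> 0" "?x 2 = 0" by (auto simp: vec3_def)
  have fx: "fermat ?x" using y d_pos by (simp add: fermat_vec3 zero_power)
  obtain w q z0 where w: "w z0 = toric_map ?x" "\<And>c. ((\<lambda>z. w z c) has_field_derivative q c) (at z0)"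
    "\<forall>\<^sub>F z in nhds z0. w z \<in> cone" "?x 2 = 0 \<Longrightarrow> z0 = 0" "\<And>z. z \<noteq> 0 \<Longrightarrow> w z (V 2) \<noteq> 0"
    by (rule local_curve[OF chart fx x(1,2)]) blast
  obtain f where f: "F = mpoly_eval f" using F by (auto simp: is_form_def)
  have "((\<lambda>z. F (w z)) has_field_derivative mpoly_diff f (w z0) q) (at z0)"
    unfolding f by (rule mpoly_eval_has_field_derivative) (rule w)
  then have "((\<lambda>z. F (w z)) \<longlongrightarrow> F (w z0)) (at z0)"
    by (intro isContD DERIV_isCont)
  moreover have "\<forall>\<^sub>F z in at z0. F (w z) = 0"
  proof -
    have "\<forall>\<^sub>F z in at z0. w z \<in> cone" using w(3) by (simp add: eventually_nhds_conv_at)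
    moreover have "\<forall>\<^sub>F z in at z0. z \<noteq> 0" using w(4)[OF x(3)] by (simp add: eventually_at_filter)
    ultimately show ?thesis by eventually_elim (use van w(5) in blast)
  qed
  ultimately have "F (w z0) = 0"
    using tendsto_unique[of "at z0" "\<lambda>z. F (w z)" "F (w z0)" 0] tendsto_eventually by force
  then show ?thesis by (simp add: w(1))
qed

text \<open>By \<open>vanishes_at_infinity\<close> a form that is nonzero on the curve is nonzero at
  an affine point. Then \<open>fermat_finite_zeros\<close> leaves finitely many algebraic x, each
  with finitely many y; besides these there are only finitely many points at infinity.\<close>

lemma finite_zeros_curve: "finite_zeros K N curve (V 0) (V 2) 1 (\<lambda>v. v (V 0))"
proof
  show "zariski_closed K N curve" by (rule curve_closed)
  show "infinite curve"
  proof -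
    have "\<exists>y. of_nat c ^ d + y ^ d = (1 :: complex)" for c
      using ex_complex_root[OF d_pos, of "1 - of_nat c ^ d"] by (metis add_diff_cancel_left' diff_add_cancel)
    then obtain y where y: "\<And>c. of_nat c ^ d + y c ^ d = (1 :: complex)" by metis
    define L where "L c = line (toric_map (vec3 (of_nat c) (y c) 1))" for c :: nat
    have "L c \<in> curve" for c
      unfolding L_def by (rule vec3_in_curve) (simp_all add: y)
    moreover have "inj L"
    proof
      fix c c' assume "L c = L c'"
      then have "toric_map (vec3 (of_nat c) (y c) 1) \<in> line (toric_map (vec3 (of_nat c') (y c') 1))"
        unfolding L_def by (metis line_self)
      then obtain a where a: "toric_map (vec3 (of_nat c) (y c) 1) =
          (\<lambda>i. a * toric_map (vec3 (of_nat c') (y c') 1) i)"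
        by (auto simp: line_eq)
      from fun_cong[OF a, of "V 2"] have "a = 1" by (simp add: toric_map_vec3_V)
      with fun_cong[OF a, of "V 0"] have "(of_nat (c ^ d) :: complex) = of_nat (c' ^ d)"
        by (simp add: toric_map_vec3_V)
      then have "c ^ d = c' ^ d" by (simp only: of_nat_eq_iff)
      then show "c = c'" using d_pos by (simp add: power_eq_iff_eq_base)
    qed
    ultimately show ?thesis
      using range_inj_infinite[of L] finite_subset[of "range L" curve] by blast
  qed
  show "V 0 \<le> N" "V 2 \<le> N" by (auto intro: V_le)
  show "v (V 0) \<noteq> 0 \<or> v (V 2) \<noteq> 0" if "L \<in> curve" "v \<in> L" "v \<noteq> 0" for L v
    using curve_mem[OF that(1,2)] rels_vertices[of v 0 2] cone_rels cone_vecs that(3) by auto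
  show "is_form K N 1 (\<lambda>v. v (V 0))" by (intro is_form_coord V_le) simp
  then have van: "vanishes_on (\<lambda>v. v (V 0)) (line v) \<longleftrightarrow> v (V 0) = 0" for v
    by (rule vanishes_on_line)
  show "\<exists>L\<in>curve. vanishes_on (\<lambda>v. v (V 0)) L"
    by (rule bexI[of _ "line (toric_map (vec3 0 1 1))"], unfold van)
      (use d_pos in \<open>auto simp: toric_map_vec3_V zero_power intro!: vec3_in_curve\<close>)
  show "\<exists>L\<in>curve. \<not> vanishes_on (\<lambda>v. v (V 0)) L"
    by (rule bexI[of _ "line (toric_map (vec3 1 0 1))"], unfold van)
      (use d_pos in \<open>auto simp: toric_map_vec3_V zero_power intro!: vec3_in_curve\<close>)
next
  fix e F L0 assume F: "is_form K N e F" and L0: "L0 \<in> curve" "\<not> vanishes_on F L0"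
  obtain P where P: "\<And>m n. algebraic (coeff (coeff P m) n)" "\<And>x y. F (toric_map (vec3 x y 1)) = poly2 P x y"
    using form_poly2[OF F] by blast
  have "\<exists>x y. x ^ d + y ^ d = 1 \<and> F (toric_map (vec3 x y 1)) \<noteq> 0"
  proof (rule ccontr)
    assume "\<not> ?thesis"
    then have zero: "\<And>x y. x ^ d + y ^ d = 1 \<Longrightarrow> F (toric_map (vec3 x y 1)) = 0" by blast
    from L0(1) have "vanishes_on F L0"
      by (cases rule: curve_cases)
        (auto simp: vanishes_on_line[OF F] intro: zero vanishes_at_infinity[OF F zero])
    then show False using L0 by simp
  qed
  then obtain x0 y0 where xy0: "x0 ^ d + y0 ^ d = 1" "poly2 P x0 y0 \<noteq> 0" using P by auto
  obtain D where D: "\<And>n. algebraic (coeff D n)" "D \<noteq> 0"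
    "\<And>x y. x ^ d + y ^ d = 1 \<Longrightarrow> poly2 P x y = 0 \<Longrightarrow> poly D x = 0"
    using fermat_finite_zeros[OF d_pos P(1) xy0] by blast
  define A where "A = (SIGMA x:{x. poly D x = 0}. {y. y ^ d = 1 - x ^ d})"
  have fin: "finite A" "finite {y::complex. y ^ d = - 1}"
    unfolding A_def using poly_roots_finite[OF D(2)] finite_nth_roots[OF d_pos] by (auto simp: d_pos)
  have cases: "(\<exists>(x, y)\<in>A. L = line (toric_map (vec3 x y 1))) \<or>
      (\<exists>y\<in>{y. y ^ d = - 1}. L = line (toric_map (vec3 1 y 0)))"
    if L: "L \<in> curve" "vanishes_on F L" for L
    using L(1)
  proof (cases rule: curve_cases)
    case (1 x y)
    then have "poly2 P x y = 0" using L(2) vanishes_on_line[OF F] P(2) by simp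
    then have "(x, y) \<in> A" using D(3)[OF 1(2)] 1(2) by (auto simp: A_def algebra_simps)
    then show ?thesis using 1 by blast
  qed auto
  have alg: "algebraic (toric_map (vec3 x y z) i)" if "algebraic x" "algebraic y" "algebraic z" for x y z i
    using that by (simp add: toric_map_vec3 algebraic_mult algebraic_power)
  have alg01: "algebraic (0::complex)" "algebraic (1::complex)" by (auto intro: rat_imp_algebraic)
  have "finite {L \<in> curve. vanishes_on F L}"
    by (rule finite_subset[of _ "(\<lambda>(x, y). line (toric_map (vec3 x y 1))) ` A \<union>
      (\<lambda>y. line (toric_map (vec3 1 y 0))) ` {y. y ^ d = - 1}"]) (use cases fin in force)+
  moreover have "\<exists>v\<in>L. v \<noteq> 0 \<and> (\<forall>i. algebraic (v i))" if "L \<in> curve" "vanishes_on F L" for L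
    using cases[OF that]
  proof (elim disjE bexE)
    fix xy assume xy: "xy \<in> A" "case xy of (x, y) \<Rightarrow> L = line (toric_map (vec3 x y 1))"
    obtain x y where xy': "xy = (x, y)" by (cases xy)
    have x: "algebraic x"
      using xy algebraic_root_of_algebraic_poly[OF D(1,2)] by (auto simp: A_def xy')
    have "algebraic (1 - x ^ d)"
      using algebraic_add[OF alg01(2), of "- (x ^ d)"] algebraic_power[OF x] by simp
    then have y: "algebraic y"
      using xy algebraic_nth_root[OF d_pos, of y] by (auto simp: A_def xy')
    show ?thesis
      using xy alg[OF x y alg01(2)] vec3_nonzero[of x y 1] line_self
      by (intro bexI[of _ "toric_map (vec3 x y 1)"]) (auto simp: xy')
  next
    fix y assume y: "y \<in> {y. y ^ d = - 1}" "L = line (toric_map (vec3 1 y 0))"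
    have "algebraic (y ^ d)" using y by (auto intro: rat_imp_algebraic)
    then have "algebraic y" by (rule algebraic_nth_root[OF d_pos])
    then show ?thesis
      using y alg[OF alg01(2) _ alg01(1)] vec3_nonzero[of 1 y 0] line_self
      by (intro bexI[of _ "toric_map (vec3 1 y 0)"]) auto
  qed
  ultimately show "finite {L \<in> curve. vanishes_on F L} \<and>
      (\<forall>L\<in>curve. vanishes_on F L \<longrightarrow> (\<exists>v\<in>L. v \<noteq> 0 \<and> (\<forall>i. algebraic (v i))))"
    by blast
qed

lemma smooth: "smooth_projective_curve K N curve"
proof -
  interpret finite_zeros K N curve "V 0" "V 2" 1 "\<lambda>v. v (V 0)" by (rule finite_zeros_curve)
  show ?thesis
    unfolding smooth_projective_curve_def
    using irreducible dim_one tangent_dim curve_mem by auto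
qed

end

section \<open>The map to the projective line\<close>

context toric_curve
begin

definition proj_coords :: "(nat \<Rightarrow> complex) \<Rightarrow> nat \<Rightarrow> complex"
  where "proj_coords v j = (if j = 0 then v (V 0) else if j = 1 then v (V 2) else 0)"

text \<open>The map (x^d : z^d); by \<open>belyi_map_eq\<close> it does not depend on the chosen
  representative.\<close>

definition belyi_map :: "point \<Rightarrow> point"
  where "belyi_map L = line (proj_coords (SOME v. v \<in> L \<and> v \<noteq> 0))"

lemma proj_coords_nonzero:
  assumes "v \<in> cone" "v \<noteq> 0"
  shows "proj_coords v \<noteq> 0"
proof
  assume "proj_coords v = 0"
  then have "proj_coords v 0 = 0" "proj_coords v 1 = 0" by simp_all
  then show False
    using rels_vertices[of v 0 2] cone_rels cone_vecs assms by (auto simp: proj_coords_def)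
qed

lemma belyi_map_eq:
  assumes "L \<in> curve" "v \<in> L" "v \<noteq> 0"
  shows "belyi_map L = line (proj_coords v)"
proof -
  define w where "w = (SOME v. v \<in> L \<and> v \<noteq> 0)"
  have w: "w \<in> L" "w \<noteq> 0"
    using someI_ex[of "\<lambda>v. v \<in> L \<and> v \<noteq> 0"] assms by (auto simp: w_def)
  then have "w \<in> line v" using curve_line[OF assms] by simp
  then obtain a where a: "w = (\<lambda>i. a * v i)" by (auto simp: line_eq)
  have "proj_coords w = (\<lambda>i. a * proj_coords v i)"
    by (intro ext) (simp add: proj_coords_def a)
  then have "proj_coords w \<in> line (proj_coords v)" unfolding line_eq by blast
  moreover have "proj_coords w \<noteq> 0"
    using proj_coords_nonzero curve_mem[OF assms(1) w(1)] w(2) by blast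
  ultimately show ?thesis
    unfolding belyi_map_def w_def[symmetric] by (rule line_eq_line)
qed

lemma belyi_map_affine:
  assumes "L \<in> curve" "v \<in> L" "v \<noteq> 0"
  shows "belyi_map L = affine_pt z \<longleftrightarrow> v (V 0) = z * v (V 2) \<and> v (V 2) \<noteq> 0"
  unfolding belyi_map_eq[OF assms]
  using line_eq_affine_pt_iff[OF proj_coords_nonzero[OF curve_mem[OF assms(1,2)] assms(3)], of z]
  by (simp add: proj_coords_def)

lemma belyi_map_infinity:
  assumes "L \<in> curve" "v \<in> L" "v \<noteq> 0" "v (V 2) = 0"
  shows "belyi_map L = infinity_pt"
  unfolding belyi_map_eq[OF assms(1-3)]
  using line_eq_infinity_pt[OF proj_coords_nonzero[OF curve_mem[OF assms(1,2)] assms(3)]] assms(4)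
  by (simp add: proj_coords_def)

end

context toric_curve_over
begin

text \<open>A linear projection whose centre does not meet the curve: one representation works
  everywhere, with empty exceptional set, and the projection is its own differential.\<close>

lemma belyi_map_represented:
  obtains G where "\<And>L. L \<in> curve \<Longrightarrow> represents_at K N curve 1 belyi_map L G"
    "\<And>v. form_map 1 G v = proj_coords v"
    "\<And>p v. (\<lambda>j. if j \<le> 1 then mpoly_diff (G j) p v else 0) = proj_coords v"
proof -
  have "is_form K N 1 (\<lambda>v. v (V 0))" "is_form K N 1 (\<lambda>v. v (V 2))"
    by (intro is_form_coord V_le; simp)+
  then obtain g0 g2 where g: "g0 \<in> forms K N 1" "g2 \<in> forms K N 1"
      "mpoly_eval g0 = (\<lambda>v. v (V 0))" "mpoly_eval g2 = (\<lambda>v. v (V 2))"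
    by (auto simp: is_form_def)
  define G where "G j = (if j = 0 then g0 else g2)" for j :: nat
  have map: "form_map 1 G v = proj_coords v" for v
    unfolding form_map_def by (intro ext) (auto simp: proj_coords_def G_def g)
  have "represents_at K N curve 1 belyi_map L G" if L: "L \<in> curve" for L
    unfolding represents_at_def
  proof (intro conjI)
    show "\<exists>e. \<forall>j\<le>1. G j \<in> forms K N e" using g by (intro exI[of _ 1]) (simp add: G_def)
    show "\<exists>Z. zariski_closed K N Z \<and> L \<in> curve - Z \<and>
      (\<forall>L'\<in>curve - Z. \<forall>v\<in>L' - {0}. form_map 1 G v \<noteq> 0 \<and> belyi_map L' = line (form_map 1 G v))"
      unfolding map
      using zariski_closed_empty L belyi_map_eq proj_coords_nonzero curve_mem
      by (intro exI[of _ "{}"]) auto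
  qed
  moreover have "(\<lambda>j. if j \<le> 1 then mpoly_diff (G j) p v else 0) = proj_coords v" for p v
  proof
    fix j :: nat
    have "deriv (\<lambda>z. p i + z * v i) 0 = v i" for i
      by (rule DERIV_imp_deriv) (auto intro!: derivative_eq_intros)
    then show "(if j \<le> 1 then mpoly_diff (G j) p v else 0) = proj_coords v j"
      by (auto simp: proj_coords_def G_def mpoly_diff_def g)
  qed
  ultimately show ?thesis using that map by blast
qed

lemma belyi_map_morphism: "morphism K N curve 1 (proj 1) belyi_map"
proof -
  have "belyi_map L \<in> proj 1" if L: "L \<in> curve" for L
  proof -
    obtain v where v: "v \<in> cone" "v \<noteq> 0" "L = line v" using L by (auto simp: curve_def)
    have "proj_coords v \<in> vecs 1 - {0}"
      using proj_coords_nonzero[OF v(1,2)] by (auto simp: vecs_def proj_coords_def)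
    moreover have "belyi_map L = line (proj_coords v)"
      using belyi_map_eq[OF L _ v(2)] v(3) line_self by simp
    ultimately show ?thesis by (simp add: proj_def)
  qed
  then show ?thesis
    unfolding morphism_def using belyi_map_represented by (metis image_subsetI)
qed

lemma identity_morphism: "morphism K N curve N curve (\<lambda>L. L)"
proof -
  have "\<exists>g\<in>forms K N 1. mpoly_eval g = (\<lambda>v. v j)" if "j \<le> N" for j
    using is_form_coord[OF that] by (simp add: is_form_def)
  then obtain G where G: "\<And>j. j \<le> N \<Longrightarrow> G j \<in> forms K N 1 \<and> mpoly_eval (G j) = (\<lambda>v. v j)" by metis
  have map: "form_map N G v = v" if "v \<in> cone" for v
    using that cone_vecs unfolding form_map_def by (intro ext) (auto simp: G vecs_def)
  have "represents_at K N curve N (\<lambda>L. L) L G" if L: "L \<in> curve" for L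
    unfolding represents_at_def
  proof (intro conjI)
    show "\<exists>e. \<forall>j\<le>N. G j \<in> forms K N e" using G by blast
    show "\<exists>Z. zariski_closed K N Z \<and> L \<in> curve - Z \<and>
      (\<forall>L'\<in>curve - Z. \<forall>v\<in>L' - {0}. form_map N G v \<noteq> 0 \<and> L' = line (form_map N G v))"
      using zariski_closed_empty L curve_line map curve_mem
      by (intro exI[of _ "{}"]) auto
  qed
  then show ?thesis unfolding morphism_def by blast
qed

text \<open>Outside the three branch values no Fermat coordinate vanishes. If the differential maps
  \<open>v\<close> into the image line, subtracting a multiple of \<open>p\<close> makes the
  coordinates \<open>V 0\<close> and \<open>V 2\<close> vanish, and
  \<open>tangent_kernel_interior\<close> leaves nothing else.\<close>

lemma belyi_map_unramified:
  assumes L: "L \<in> curve" and nb: "belyi_map L \<notin> {affine_pt 0, affine_pt 1, infinity_pt}"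
  shows "unramified_at K N curve 1 belyi_map L"
proof -
  obtain G where G: "represents_at K N curve 1 belyi_map L G"
    "\<And>v. form_map 1 G v = proj_coords v"
    "\<And>p v. (\<lambda>j. if j \<le> 1 then mpoly_diff (G j) p v else 0) = proj_coords v"
    using belyi_map_represented L by metis
  have "v \<in> L" if p: "p \<in> L - {0}" and v: "v \<in> cone_tangent K N curve p"
    and pv: "proj_coords v \<in> line (proj_coords p)" for p v
  proof -
    have p': "p \<in> L" "p \<noteq> 0" "p \<in> cone" using p curve_mem[OF L] by auto
    have p2: "p (V 2) \<noteq> 0" using belyi_map_infinity[OF L p'(1,2)] nb by auto
    then have p0: "p (V 0) \<noteq> 0" "p (V 0) \<noteq> p (V 2)"
      using belyi_map_affine[OF L p'(1,2), of 0] belyi_map_affine[OF L p'(1,2), of 1] nb by auto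
    then have p1: "p (V 1) \<noteq> 0" using cone_rels[OF p'(3)] by (auto simp: rels_def)
    obtain x where x: "p = toric_map x" using p'(3) by (auto simp: cone_def)
    have xn: "x n \<noteq> 0" if "n < 3" for n
      using less_3_cases[OF that] p0 p1 p2 d_pos by (auto simp: x toric_map_V zero_power)
    obtain a where a: "proj_coords v = (\<lambda>i. a * proj_coords p i)"
      using pv by (auto simp: line_eq)
    have "v (V 0) = a * p (V 0)" "v (V 2) = a * p (V 2)"
      using fun_cong[OF a, of 0] fun_cong[OF a, of 1] by (simp_all add: proj_coords_def)
    moreover have "(\<lambda>i. 1 * v i + (- a) * p i) \<in> cone_tangent K N curve p"
      by (intro cone_tangent_linear v cone_tangent_self p')
    ultimately have "(\<lambda>i. 1 * v i + (- a) * p i) = 0"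
      using tangent_kernel_interior[of _ x 0 2] xn by (simp add: x)
    from fun_cong[OF this] have "v i + - (a * p i) = 0" for i
      by (simp only: mult_1 mult_minus_left zero_fun_apply)
    then have "v i = a * p i" for i
      by (simp only: eq_iff_diff_eq_0[of "v i"] diff_conv_add_uminus)
    then have "v = (\<lambda>i. a * p i)" by (intro ext)
    then have "v \<in> line p" unfolding line_eq by blast
    then show ?thesis using curve_line[OF L p'(1,2)] by simp
  qed
  then show ?thesis
    unfolding unramified_at_def by (intro exI[of _ G] conjI ballI impI G(1)) (simp only: G(2,3))
qed

lemma belyi_pair_curve: "belyi_pair K N curve belyi_map"
proof -
  have "\<not> (\<exists>c. \<forall>L\<in>curve. belyi_map L = c)"
  proof
    assume "\<exists>c. \<forall>L\<in>curve. belyi_map L = c"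
    moreover define v where "v = toric_map (vec3 0 1 1)"
    moreover define w where "w = toric_map (vec3 1 0 1)"
    ultimately obtain c where c: "\<forall>L\<in>curve. belyi_map L = c" by blast
    have v: "line v \<in> curve" "v \<noteq> 0" "v (V 0) = 0" "v (V 2) = 1"
      and w: "line w \<in> curve" "w \<noteq> 0" "w (V 0) = 1" "w (V 2) = 1"
      using d_pos by (auto simp: v_def w_def toric_map_vec3_V zero_power intro!: vec3_in_curve vec3_nonzero)
    have "belyi_map (line v) = affine_pt 0"
      using belyi_map_affine[OF v(1) line_self v(2), of 0] v by simp
    then have "belyi_map (line w) = affine_pt 0" using c v w by metis
    then show False using belyi_map_affine[OF w(1) line_self w(2), of 0] w by simp
  qed
  then show ?thesis
    unfolding belyi_pair_def using smooth belyi_map_morphism belyi_map_unramified by blast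
qed

end

text \<open>Base change does not alter the point set, so the required isomorphism is the
  identity.\<close>

lemma (in toric_curve) admits_belyi_pair_if_corresponds:
  assumes "corresponds n D N curve belyi_map"
  shows "admits_belyi_pair_over_Q n D"
proof -
  interpret rat: toric_curve_over d N E V \<rat>
    by (intro toric_curve_over.intro toric_curve_axioms algebraic_coeffs_Rats)
  interpret alg: toric_curve_over d N E V Qbar
    by (intro toric_curve_over.intro toric_curve_axioms algebraic_coeffs_Qbar)
  have "isomorphic_pairs Qbar N curve belyi_map N curve belyi_map"
    unfolding isomorphic_pairs_def using alg.identity_morphism by blast
  then show ?thesis
    unfolding admits_belyi_pair_over_Q_def
    using assms alg.belyi_pair_curve rat.smooth rat.belyi_map_morphism by blast
qed


section \<open>The exponents of the invariant monomials\<close>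

text \<open>\<open>Q\<close> is membership in a subgroup of Z^2 that contains d Z^2.\<close>

locale plane_lattice =
  fixes Q :: "int \<Rightarrow> int \<Rightarrow> bool" and d :: int
  assumes d: "d > 0" and Q_d: "Q d 0" "Q 0 d"
    and Q_diff: "Q a b \<Longrightarrow> Q a' b' \<Longrightarrow> Q (a - a') (b - b')"
begin

lemma Q_scale: "Q a b \<Longrightarrow> Q (n * a) (n * b)"
proof -
  assume Q: "Q a b"
  have zero: "Q 0 0" using Q_diff[OF Q Q] by simp
  show ?thesis
  proof (induction n rule: int_induct[where k = 0])
    case (step1 n)
    have "Q (n * a - (0 - a)) (n * b - (0 - b))" by (intro Q_diff step1 zero Q)
    then show ?case by (simp add: algebra_simps)
  next
    case (step2 n)
    have "Q (n * a - a) (n * b - b)" by (intro Q_diff step2 Q)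
    then show ?case by (simp add: algebra_simps)
  qed (use zero in simp)
qed

lemma ex_minimal_positive:
  assumes "P (d :: int)" "\<And>x y n. P x \<Longrightarrow> P y \<Longrightarrow> P (x - n * y)"
  shows "\<exists>c. 0 < c \<and> c \<le> d \<and> P c \<and> (\<forall>x. P x \<longrightarrow> c dvd x)"
proof -
  define m where "m = (LEAST m. 0 < m \<and> P (int m))"
  have ex: "0 < nat d \<and> P (int (nat d))" using assms d by simp
  have m: "0 < m" "P (int m)" using LeastI[of "\<lambda>m. 0 < m \<and> P (int m)", OF ex] by (auto simp: m_def)
  have least: "m \<le> n" if "0 < n \<and> P (int n)" for n unfolding m_def by (rule Least_le) (rule that)
  have "m \<le> nat d" by (rule least) (rule ex)
  moreover have "int m dvd x" if "P x" for x
  proof (rule ccontr)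
    assume "\<not> int m dvd x"
    then have "x mod int m \<noteq> 0" by (simp add: dvd_eq_mod_eq_0)
    moreover have "x mod int m \<ge> 0" using m by simp
    ultimately have pos: "0 < x mod int m" by linarith
    have "x - (x div int m) * int m = x mod int m" by (simp add: minus_div_mult_eq_mod)
    then have "P (x mod int m)" using assms(2)[OF that m(2), of "x div int m"] by simp
    then have "m \<le> nat (x mod int m)" using pos by (intro least) simp
    moreover have "x mod int m < int m" using m by simp
    ultimately show False using pos by linarith
  qed
  ultimately show ?thesis using m by (intro exI[of _ "int m"]) auto
qed

text \<open>The first coordinates of the lattice are the multiples of \<open>c\<close>, its elements on the axis those
  of \<open>e\<close>.  As \<open>e\<close> divides \<open>(d / c) * j\<close> with \<open>j < e\<close>, the generator \<open>(c, j)\<close> lies in the triangle.\<close>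

lemma generators_in_triangle:
  obtains c j e where "0 < c" "Q c j" "0 \<le> j" "c + j \<le> d" "0 < e" "e \<le> d" "Q 0 e"
    "\<And>a b. Q a b \<Longrightarrow> \<exists>r m. a = c * r \<and> b = r * j + m * e"
proof -
  have sub: "Q (a - n * a') (b - n * b')" if "Q a b" "Q a' b'" for a b a' b' n
    using Q_diff[OF that(1) Q_scale[OF that(2)]] .
  have "\<exists>c. 0 < c \<and> c \<le> d \<and> (\<exists>b. Q c b) \<and> (\<forall>x. (\<exists>b. Q x b) \<longrightarrow> c dvd x)"
    by (rule ex_minimal_positive) (use Q_d sub in blast)+
  then obtain c b0 where c: "0 < c" "Q c b0" "\<And>a b. Q a b \<Longrightarrow> c dvd a" by auto
  have "\<exists>e. 0 < e \<and> e \<le> d \<and> Q 0 e \<and> (\<forall>x. Q 0 x \<longrightarrow> e dvd x)"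
  proof (rule ex_minimal_positive)
    show "Q 0 (x - n * y)" if "Q 0 x" "Q 0 y" for x y n using sub[OF that, of n] by simp
  qed (rule Q_d)
  then obtain e where e: "0 < e" "e \<le> d" "Q 0 e" "\<And>b. Q 0 b \<Longrightarrow> e dvd b" by auto
  define j where "j = b0 mod e"
  have j: "0 \<le> j" "j < e" using e by (simp_all add: j_def)
  have "Q c j"
    using sub[OF c(2) e(3), of "b0 div e"] by (simp add: j_def minus_div_mult_eq_mod)
  have gen: "\<exists>r m. a = c * r \<and> b = r * j + m * e" if Q: "Q a b" for a b
  proof -
    obtain r where r: "a = c * r" using c(3)[OF Q] by auto
    have "Q 0 (b - r * j)" using sub[OF Q \<open>Q c j\<close>, of r] by (simp add: r mult.commute)
    then obtain m where "b - r * j = e * m" using e(4) by (auto simp: dvd_def)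
    then show ?thesis using r by (intro exI[of _ r] exI[of _ m]) (simp add: algebra_simps)
  qed
  \<comment> \<open>Here r = d / c and - m = r * j / e. The latter is less than r, hence at most r -
    1, and this gives r * j <= (r - 1) * d = r * (d - c).\<close>
  obtain r m where rm: "d = c * r" "0 = r * j + m * e" using gen[OF Q_d(1)] by auto
  have r: "r > 0" using rm(1) d c(1) by (simp add: zero_less_mult_iff)
  have "r * j = (- m) * e" using rm(2) by simp
  moreover have "r * j < r * e" using j r by simp
  ultimately have "- m < r" using e(1) by (simp only: mult_less_cancel_right)
  then have "(- m) * e \<le> (r - 1) * e" using e(1) by (intro mult_right_mono) auto
  also have "\<dots> \<le> (r - 1) * d" using r e(2) by (intro mult_left_mono) auto
  also have "\<dots> = r * (d - c)" using rm(1) by (simp add: algebra_simps)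
  finally have "r * j \<le> r * (d - c)" using \<open>r * j = (- m) * e\<close> by simp
  then have "j \<le> d - c" using r by simp
  then show ?thesis using that[of c j e] c(1) \<open>Q c j\<close> j e gen by auto
qed

end

lemma sum_perm3:
  assumes "i < 3" "j < 3" "k < (3::nat)" "i \<noteq> j" "i \<noteq> k" "j \<noteq> k"
  shows "f i + f j + f k = f 0 + f 1 + (f 2 :: 'a::comm_monoid_add)"
  using perm3_cases[OF assms] by (elim disjE conjE) (simp_all add: ac_simps)

lemma all_perm3:
  assumes "i < 3" "j < 3" "k < (3::nat)" "i \<noteq> j" "i \<noteq> k" "j \<noteq> k"
  shows "(\<forall>n<3. P n) \<longleftrightarrow> P i \<and> P j \<and> P k"
  unfolding all_less_3 using perm3_cases[OF assms] by (elim disjE conjE) auto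

text \<open>The monomials invariant under the subgroup of \<open>(\<int>/d)\<^sup>2\<close> generated by \<open>(0, l)\<close>
  and \<open>(k, - s)\<close>, with \<open>d = k * l\<close>.\<close>

locale invariant_monomials =
  fixes k l s :: nat
  assumes kl: "0 < k" "0 < l" and s: "s < l"
begin

abbreviation d :: nat where "d \<equiv> k * l"

text \<open>The last two conditions pair the exponent vector with the two generators of the
  subgroup; integer exponents admit quotients of monomials.\<close>

definition invariant :: "(nat \<Rightarrow> int) \<Rightarrow> bool"
  where "invariant f \<longleftrightarrow> int d dvd f 0 + f 1 + f 2 \<and> int d dvd int l * f 1 \<and>
    int d dvd int k * f 0 - int s * f 1"

definition exponents :: "(nat \<Rightarrow> nat) set"
  where "exponents = {f. (\<forall>n\<ge>3. f n = 0) \<and> f 0 + f 1 + f 2 = d \<and> invariant (\<lambda>n. int (f n))}"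

lemma invariant_diff: "invariant f \<Longrightarrow> invariant g \<Longrightarrow> invariant (\<lambda>n. f n - g n)"
  using dvd_diff[of "int d" "f 0 + f 1 + f 2" "g 0 + g 1 + g 2"]
    dvd_diff[of "int d" "int l * f 1" "int l * g 1"]
    dvd_diff[of "int d" "int k * f 0 - int s * f 1" "int k * g 0 - int s * g 1"]
  by (simp add: invariant_def algebra_simps)

lemma invariant_shift:
  assumes "n < 3"
  shows "invariant (f(n := f n + int d)) \<longleftrightarrow> invariant f"
proof -
  have delta: "invariant (\<lambda>m. if m = n then a * int d else 0)" for a
    using less_3_cases[OF assms] by (auto simp: invariant_def)
  have "(\<lambda>m. f m - (if m = n then - 1 * int d else 0)) = f(n := f n + int d)"
    "(\<lambda>m. (f(n := f n + int d)) m - (if m = n then 1 * int d else 0)) = f"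
    by (auto simp: fun_eq_iff)
  then show ?thesis
    using invariant_diff[OF _ delta[of "-1"], of f] invariant_diff[OF _ delta[of 1], of "f(n := f n + int d)"]
    by metis
qed

lemma finite_exponents: "finite exponents"
proof (rule finite_subset)
  show "exponents \<subseteq> (\<lambda>(a, b, c) n. if n = 0 then a else if n = 1 then b else if n = 2 then c else 0) `
      ({..d} \<times> {..d} \<times> {..d})"
  proof
    fix f assume f: "f \<in> exponents"
    have "f = (\<lambda>n. if n = 0 then f 0 else if n = 1 then f 1 else if n = 2 then f 2 else 0)"
    proof
      fix n :: nat
      consider "n = 0" | "n = 1" | "n = 2" | "n \<ge> 3" by linarith
      then show "f n = (if n = 0 then f 0 else if n = 1 then f 1 else if n = 2 then f 2 else 0)"
        using f by cases (auto simp: exponents_def)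
    qed
    moreover have "(f 0, f 1, f 2) \<in> {..d} \<times> {..d} \<times> {..d}" using f by (auto simp: exponents_def)
    ultimately show "f \<in> (\<lambda>(a, b, c) n. if n = 0 then a else if n = 1 then b else if n = 2 then c else 0) `
      ({..d} \<times> {..d} \<times> {..d})"
      by (intro image_eqI[of _ _ "(f 0, f 1, f 2)"]) (simp_all only: prod.case)
  qed
qed simp

context
  fixes i j m :: nat
  assumes ijm: "i < 3" "j < 3" "m < 3" "i \<noteq> j" "i \<noteq> m" "j \<noteq> m"
begin

text \<open>Exponents of total degree 0, as they arise when a monomial of degree d is divided by x m
  ^ d.\<close>

definition planar :: "int \<Rightarrow> int \<Rightarrow> nat \<Rightarrow> int"
  where "planar a b = (\<lambda>_. 0)(i := a, j := b, m := - a - b)"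

lemma planar_lattice: "plane_lattice (\<lambda>a b. invariant (planar a b)) (int d)"
proof
  show "int d > 0" using kl by simp
  show "invariant (planar (a - a') (b - b'))" if "invariant (planar a b)" "invariant (planar a' b')" for a b a' b'
  proof -
    have "planar (a - a') (b - b') = (\<lambda>n. planar a b n - planar a' b' n)"
      unfolding planar_def by (auto simp: fun_eq_iff)
    then show ?thesis using invariant_diff[OF that] by simp
  qed
  have dvd: "invariant f" if "\<And>n. int d dvd f n" for f
    unfolding invariant_def using that by (intro conjI dvd_add dvd_diff dvd_mult)
  show "invariant (planar (int d) 0)" "invariant (planar 0 (int d))"
    by (rule dvd; simp add: planar_def)+
qed

lemma exponents_sum:
  assumes "f \<in> exponents"
  shows "int (f i) + int (f j) + int (f m) = int d"
proof -
  have "f i + f j + f m = d" using sum_perm3[OF ijm, of f] assms by (simp add: exponents_def)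
  then show ?thesis by (simp only: of_nat_add[symmetric])
qed

lemma invariant_planar:
  assumes "f \<in> exponents"
  shows "invariant (planar (int (f i)) (int (f j)))"
proof -
  have "int (f i) + int (f j) + int (f m) = int d"
    by (rule exponents_sum[OF assms])
  then have "((planar (int (f i)) (int (f j)))(m := planar (int (f i)) (int (f j)) m + int d)) n = int (f n)" for n
  proof -
    assume sum: "int (f i) + int (f j) + int (f m) = int d"
    consider "n = i" | "n = j" | "n = m" | "n \<ge> 3"
      using perm3_cases[OF ijm] by linarith
    then show ?thesis
      using sum ijm assms by cases (auto simp: planar_def exponents_def)
  qed
  then have "(planar (int (f i)) (int (f j)))(m := planar (int (f i)) (int (f j)) m + int d) = (\<lambda>n. int (f n))"
    by (intro ext)
  then show ?thesis
    using assms invariant_shift[OF ijm(3), of "planar (int (f i)) (int (f j))"] by (simp add: exponents_def)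
qed

lemma planar_exponent:
  assumes "invariant (planar a b)" "0 \<le> a" "0 \<le> b" "a + b \<le> int d"
  shows "\<exists>f\<in>exponents. int (f i) = a \<and> int (f j) = b \<and> int (f m) = int d - a - b"
proof -
  define f where "f = (\<lambda>_. 0)(i := nat a, j := nat b, m := nat (int d - a - b))"
  have f: "int (f i) = a" "int (f j) = b" "int (f m) = int d - a - b"
    using ijm assms by (auto simp: f_def)
  have "(planar a b)(m := planar a b m + int d) = (\<lambda>n. int (f n))"
    using assms ijm by (auto simp: planar_def f_def fun_eq_iff)
  then have "invariant (\<lambda>n. int (f n))"
    using assms(1) invariant_shift[OF ijm(3), of "planar a b"] by simp
  moreover have "f 0 + f 1 + f 2 = d"
    using sum_perm3[OF ijm, of f] f by linarith
  moreover have "f n = 0" if "n \<ge> 3" for n using that ijm by (auto simp: f_def)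
  ultimately show ?thesis using f by (intro bexI[of _ f]) (auto simp: exponents_def)
qed

text \<open>\<open>u\<close> and \<open>t\<close> are the lattice generators \<open>(c, b)\<close>
  and \<open>(0, e)\<close> of \<open>generators_in_triangle\<close>, completed to monomials of
  degree d.\<close>

lemma chart_exponents:
  obtains u t where "u \<in> exponents" "t \<in> exponents" "0 < u i" "t i = 0" "0 < t j"
    "\<And>f. f \<in> exponents \<Longrightarrow> \<exists>r A B A' B'.
      f i + t i * A = u i * r + t i * A' \<and> f j + t j * A = u j * r + t j * A' \<and>
      f m + t m * A + d * B = u m * r + t m * A' + d * B'"
proof -
  interpret plane_lattice "\<lambda>a b. invariant (planar a b)" "int d" by (rule planar_lattice)
  obtain c b e where g: "0 < c" "invariant (planar c b)" "0 \<le> b" "c + b \<le> int d" "0 < e" "e \<le> int d"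
    "invariant (planar 0 e)" "\<And>a b'. invariant (planar a b') \<Longrightarrow> \<exists>r n. a = c * r \<and> b' = r * b + n * e"
    using generators_in_triangle by metis
  obtain u where u: "u \<in> exponents" "int (u i) = c" "int (u j) = b" "int (u m) = int d - c - b"
    using planar_exponent[OF g(2)] g by auto
  obtain t where t: "t \<in> exponents" "int (t i) = 0" "int (t j) = e" "int (t m) = int d - 0 - e"
    using planar_exponent[OF g(7)] g by auto
  have "\<exists>r A B A' B'.
      f i + t i * A = u i * r + t i * A' \<and> f j + t j * A = u j * r + t j * A' \<and>
      f m + t m * A + d * B = u m * r + t m * A' + d * B'" if f: "f \<in> exponents" for f
  proof -
    obtain r n where rn: "int (f i) = c * r" "int (f j) = r * b + n * e"
      using g(8)[OF invariant_planar[OF f]] by blast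
    have "r \<ge> 0"
    proof (rule ccontr)
      assume "\<not> 0 \<le> r"
      then have "c * r < 0" using g(1) by (simp add: mult_less_0_iff)
      then show False using rn(1) by linarith
    qed
    have fm: "int (f m) = int d - c * r - (r * b + n * e)"
      using exponents_sum[OF f] rn by linarith
    \<comment> \<open>The monomial \<open>f\<close> is u^r * t^n times x m ^ d to the power 1 - r -
      n, which balances the degrees. As n and 1 - r - n may be negative, each is split into its
      positive and negative part.\<close>
    have n: "int (nat n) = n + int (nat (- n))"
      and n': "int (nat (1 - r - n)) = int (nat (r + n - 1)) - (r + n - 1)" by linarith+
    have "int (f i + t i * nat (- n)) = int (u i * nat r + t i * nat n)"
      using \<open>r \<ge> 0\<close> by (simp add: rn u t)
    moreover have "int (f j + t j * nat (- n)) = int (u j * nat r + t j * nat n)"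
      unfolding of_nat_add of_nat_mult rn u t n using \<open>r \<ge> 0\<close> by (simp add: algebra_simps)
    moreover have "int (f m + t m * nat (- n) + d * nat (r + n - 1)) =
        int (u m * nat r + t m * nat n + d * nat (1 - r - n))"
      unfolding of_nat_add of_nat_mult[of "t m"] of_nat_mult[of "u m"] of_nat_mult[of d] fm u t n n'
      using \<open>r \<ge> 0\<close> by (simp add: algebra_simps)
    ultimately show ?thesis
      unfolding of_nat_eq_iff by blast
  qed
  then show ?thesis using that[of u t] u t g by auto
qed

end

lemma ex_toric_curve:
  obtains N E V where "toric_curve d N E V" "\<And>c. c \<le> N \<Longrightarrow> E c \<in> exponents"
    "\<And>f. f \<in> exponents \<Longrightarrow> \<exists>c\<le>N. E c = f"
proof -
  define vertex where "vertex i = (\<lambda>_. 0)(i := d)" for i :: nat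
  have vertex: "vertex i \<in> exponents" if "i < 3" for i
    using less_3_cases[OF that] by (auto simp: vertex_def exponents_def invariant_def)
  obtain h where h: "bij_betw h {0..<card exponents} exponents"
    using ex_bij_betw_nat_finite[OF finite_exponents] by blast
  define N where "N = card exponents - 1"
  have "card exponents > 0" using finite_exponents vertex[of 0] by (auto simp: card_gt_0_iff)
  then have N: "{0..<card exponents} = {..N}" by (auto simp: N_def)
  have h_mem: "h c \<in> exponents" if "c \<le> N" for c
    using bij_betw_apply[OF h, of c] that N by auto
  have h_surj: "\<exists>c\<le>N. h c = f" if "f \<in> exponents" for f
    using that bij_betw_imp_surj_on[OF h] N by (metis atMost_iff imageE)
  have "\<forall>i\<in>{..<3}. \<exists>c. c \<le> N \<and> h c = vertex i" using h_surj vertex by auto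
  then obtain V where V: "\<And>i. i < 3 \<Longrightarrow> V i \<le> N \<and> h (V i) = vertex i"
    using bchoice[of "{..<3}" "\<lambda>i c. c \<le> N \<and> h c = vertex i"] by auto
  have "toric_curve d N h V"
  proof
    show "0 < d" using kl by simp
    show "h c 0 + h c 1 + h c 2 = d" if "c \<le> N" for c
      using h_mem[OF that] by (simp add: exponents_def)
    show "V i \<le> N" if "i < 3" for i using V that by blast
    show "h (V i) j = (if j = i then d else 0)" if "i < 3" for i j
      using V[OF that] by (simp add: vertex_def)
    fix i :: nat assume i: "i < 3"
    obtain j where j: "j < 3" "i \<noteq> j" using ex_third[of i i] by blast
    obtain m where m: "m < 3" "i \<noteq> m" "j \<noteq> m" using ex_third[of i j] by blast
    note ijm = i j(1) m(1) j(2) m(2,3)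
    obtain u t where ut: "u \<in> exponents" "t \<in> exponents" "0 < u i" "t i = 0" "0 < t j"
      "\<And>f. f \<in> exponents \<Longrightarrow> \<exists>r A B A' B'.
        f i + t i * A = u i * r + t i * A' \<and> f j + t j * A = u j * r + t j * A' \<and>
        f m + t m * A + d * B = u m * r + t m * A' + d * B'"
      by (rule chart_exponents[OF ijm]) blast
    obtain cu ct where c: "cu \<le> N" "h cu = u" "ct \<le> N" "h ct = t" using h_surj ut by metis
    have Vm: "h (V m) i = 0" "h (V m) j = 0" "h (V m) m = d"
      using V[OF m(1)] m by (auto simp: vertex_def)
    have "toric_chart N h V i j m cu ct"
      unfolding toric_chart_def all_perm3[OF ijm] Vm c
    proof (intro conjI allI impI)
      fix c' assume "c' \<le> N"
      from ut(6)[OF h_mem[OF this]]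
      show "\<exists>r A B A' B'. h c' i + t i * A + 0 * B = u i * r + t i * A' + 0 * B' \<and>
        h c' j + t j * A + 0 * B = u j * r + t j * A' + 0 * B' \<and>
        h c' m + t m * A + d * B = u m * r + t m * A' + d * B'"
        by simp
    qed (use ijm ut c in auto)
    then show "\<exists>j k u t. toric_chart N h V i j k u t" by blast
  qed
  then show ?thesis using that h_mem h_surj by blast
qed

text \<open>These two monomials already detect the subgroup: if (a, b) pairs to 0 modulo k * l with
  (l, 0) and with (s, k), then a = k * q, and l divides b + s * q.\<close>

lemma exponents_generators:
  "\<exists>f\<in>exponents. f 0 = l \<and> f 1 = 0" "\<exists>f\<in>exponents. f 0 = s \<and> f 1 = k"
proof -
  have "l \<le> d" using kl by simp
  then show "\<exists>f\<in>exponents. f 0 = l \<and> f 1 = 0"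
    by (intro bexI[of _ "(\<lambda>_. 0)(0 := l, 2 := d - l)"]) (auto simp: exponents_def invariant_def)
  have "s + k \<le> d"
  proof -
    obtain k' l' where "k = Suc k'" "l = Suc l'" using kl by (metis gr0_implies_Suc)
    then show ?thesis using s by simp
  qed
  then show "\<exists>f\<in>exponents. f 0 = s \<and> f 1 = k"
    by (intro bexI[of _ "(\<lambda>_. 0)(0 := s, 1 := k, 2 := d - s - k)"])
      (auto simp: exponents_def invariant_def mult.commute)
qed

end


section \<open>Transitive pairs of commuting permutations\<close>

locale commuting_pair =
  fixes d :: nat and g h :: "nat \<Rightarrow> nat"
  assumes d: "d \<ge> 1" and perm: "g permutes {1..d}" "h permutes {1..d}"
    and comm: "g (h x) = h (g x)"
begin

definition pt :: "nat \<Rightarrow> nat \<Rightarrow> nat"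
  where "pt a b = (g ^^ a) ((h ^^ b) 1)"

lemma comm_pow: "h ((g ^^ a) x) = (g ^^ a) (h x)"
  by (induction a) (simp_all add: comm[symmetric])

lemma pt_Suc: "g (pt a b) = pt (Suc a) b" "h (pt a b) = pt a (Suc b)"
  by (simp_all add: pt_def comm_pow)

lemma pt_add: "(g ^^ a) ((h ^^ b) (pt a' b')) = pt (a + a') (b + b')"
proof -
  have "(h ^^ b) (pt a' b') = pt a' (b + b')" by (induction b) (simp_all add: pt_Suc)
  moreover have "(g ^^ a) (pt a' b'') = pt (a + a') b''" for b'' by (induction a) (simp_all add: pt_Suc)
  ultimately show ?thesis by simp
qed

lemma inj_pow: "inj (\<lambda>x. (g ^^ a) ((h ^^ b) x))"
  using inj_compose[OF inj_fn inj_fn, OF permutes_inj permutes_inj, OF perm] by (simp add: o_def)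

lemma pt_cancel: "pt (a + a') (b + b') = pt (a + a'') (b + b'') \<longleftrightarrow> pt a' b' = pt a'' b''"
  using inj_eq[OF inj_pow, of a b "pt a' b'" "pt a'' b''"] by (simp only: pt_add)

lemma pt_range: "pt a b \<in> {1..d}"
proof -
  have "(h ^^ b) 1 \<in> {1..d}"
    by (induction b) (use d permutes_in_image[OF perm(2)] in auto)
  then show ?thesis unfolding pt_def
    by (induction a) (use permutes_in_image[OF perm(1)] in auto)
qed

lemma return_time: "\<exists>n>0. pt (n * a) (n * b) = pt 0 0"
proof -
  have "\<not> inj (\<lambda>n. pt (n * a) (n * b))"
    using range_inj_infinite[of "\<lambda>n. pt (n * a) (n * b)"] pt_range
      finite_subset[of "range (\<lambda>n. pt (n * a) (n * b))" "{1..d}"] by blast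
  then obtain m n where neq: "m \<noteq> n" "pt (m * a) (m * b) = pt (n * a) (n * b)"
    unfolding inj_def by blast
  obtain m n where mn: "m < n" "pt (m * a) (m * b) = pt (n * a) (n * b)"
    using neq by (cases m n rule: linorder_cases) auto
  have n: "n = m + (n - m)" using mn by simp
  have "pt (m * a + 0) (m * b + 0) = pt (m * a + (n - m) * a) (m * b + (n - m) * b)"
    unfolding add_mult_distrib[symmetric] n[symmetric] using mn by simp
  then show ?thesis
    unfolding pt_cancel using mn by (intro exI[of _ "n - m"]) auto
qed

text \<open>\<open>l\<close> is the length of the orbit of 1 under \<open>h\<close>, and
  \<open>k\<close> the first positive power of \<open>g\<close> that brings 1 back into this orbit,
  at h^s 1. So (0, l) and (k, - s) generate the stabilizer of 1 in Z^2, in Hermite normal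
  form.\<close>

definition l :: nat where "l = (LEAST n. 0 < n \<and> pt 0 n = pt 0 0)"
definition k :: nat where "k = (LEAST n. 0 < n \<and> (\<exists>j. pt n 0 = pt 0 j))"

lemma l: "0 < l" "pt 0 l = pt 0 0" "\<And>n. n < l \<Longrightarrow> pt 0 n = pt 0 0 \<Longrightarrow> n = 0"
proof -
  have "\<exists>n>0. pt 0 n = pt 0 0" using return_time[of 0 1] by simp
  from LeastI_ex[OF this] show "0 < l" "pt 0 l = pt 0 0" by (auto simp: l_def)
  show "n = 0" if "n < l" "pt 0 n = pt 0 0" for n
    using not_less_Least[OF that(1)[unfolded l_def]] that(2) by auto
qed

lemma k: "0 < k" "\<exists>j. pt k 0 = pt 0 j" "\<And>n j. n < k \<Longrightarrow> pt n 0 = pt 0 j \<Longrightarrow> n = 0"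
proof -
  have "\<exists>n>0. \<exists>j. pt n 0 = pt 0 j" using return_time[of 1 0] by auto
  from LeastI_ex[OF this] show "0 < k" "\<exists>j. pt k 0 = pt 0 j" by (auto simp: k_def)
  show "n = 0" if "n < k" "pt n 0 = pt 0 j" for n j
    using not_less_Least[OF that(1)[unfolded k_def]] that(2) by auto
qed

lemma pt_add_l: "pt a (b + n * l) = pt a b"
proof (induction n)
  case (Suc n)
  have "pt (a + 0) ((b + n * l) + l) = pt (a + 0) ((b + n * l) + 0)"
    unfolding pt_cancel by (rule l)
  then show ?case using Suc by (simp add: ac_simps)
qed simp

lemma pt_mod_l: "pt a (b mod l) = pt a b"
  using pt_add_l[of a "b mod l" "b div l"] by (simp only: mod_div_mult_eq)

definition s :: nat where "s = (SOME j. pt k 0 = pt 0 j) mod l"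

lemma s: "s < l" "pt k 0 = pt 0 s"
  using l(1) someI_ex[OF k(2)] by (simp_all add: s_def pt_mod_l)

lemma pt_add_k: "pt (a + n * k) b = pt a (b + n * s)"
proof (induction n arbitrary: b)
  case (Suc n)
  have "pt ((a + n * k) + k) (b + 0) = pt ((a + n * k) + 0) (b + s)"
    unfolding pt_cancel by (rule s)
  then show ?case using Suc[of "b + s"] by (simp add: ac_simps)
qed simp

lemma pt_0_eq: "pt 0 b = pt 0 b' \<Longrightarrow> b mod l = b' mod l"
proof (induction b b' rule: linorder_wlog)
  case (le b b')
  have "pt (0 + 0) (b + 0) = pt (0 + 0) (b + (b' - b))" using le by simp
  then have "pt 0 ((b' - b) mod l) = pt 0 0"
    unfolding pt_cancel by (simp add: pt_mod_l)
  then have "(b' - b) mod l = 0" using l by simp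
  then show ?case using le(1) by (metis le_add_diff_inverse mod_add_right_eq add_0_right)
qed simp

lemma pt_axis:
  assumes "pt a b = pt 0 b'"
  shows "k dvd a"
proof -
  \<comment> \<open>With natural exponents, multiplication by l - 1 replaces negation: h^l fixes the
    whole orbit, so h^(b * (l - 1)) undoes h^b.\<close>
  have eq: "pt (a + 0) (b * l) = pt 0 (b' + b * (l - 1))"
  proof -
    have "b + b * (l - 1) = b * l" using l(1) by (cases l) simp_all
    moreover have "pt (0 + a) (b * (l - 1) + b) = pt (0 + 0) (b * (l - 1) + b')"
      unfolding pt_cancel using assms by simp
    ultimately show ?thesis by (simp add: ac_simps)
  qed
  define r where "r = a mod k"
  define q where "q = a div k"
  have "pt a (b * l) = pt r (q * s)"
    using pt_add_l[of a 0 b] pt_add_k[of r q 0] by (simp add: r_def q_def mod_div_mult_eq)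
  then have "pt r (q * s) = pt 0 (b' + b * (l - 1))" using eq by simp
  then have "pt (0 + r) (q * s * (l - 1) + q * s) = pt (0 + 0) (q * s * (l - 1) + (b' + b * (l - 1)))"
    unfolding pt_cancel by simp
  moreover have "q * s * (l - 1) + q * s = 0 + (q * s) * l" using l(1) by (cases l) simp_all
  ultimately have "pt r 0 = pt 0 (q * s * (l - 1) + (b' + b * (l - 1)))"
    using pt_add_l[of r 0 "q * s"] by simp
  then have "r = 0" using k by (metis mod_less_divisor r_def)
  then show ?thesis by (simp add: r_def dvd_eq_mod_eq_0)
qed

text \<open>Congruence of (a, b) and (a', b') modulo the lattice generated by (k, - s) and (0,
  l).\<close>

definition same :: "nat \<Rightarrow> nat \<Rightarrow> nat \<Rightarrow> nat \<Rightarrow> bool"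
  where "same a b a' b' \<longleftrightarrow>
    (\<exists>q. int a - int a' = int k * q \<and> int l dvd int b - int b' + int s * q)"

lemma same_sym: "same a b a' b' \<Longrightarrow> same a' b' a b"
proof -
  assume "same a b a' b'"
  then obtain q where q: "int a - int a' = int k * q" "int l dvd int b - int b' + int s * q"
    by (auto simp: same_def)
  have "int a' - int a = int k * (- q)" using q(1) by (simp add: algebra_simps)
  moreover have "int l dvd int b' - int b + int s * (- q)"
    using q(2) dvd_minus_iff[of "int l" "int b - int b' + int s * q"] by (simp add: algebra_simps)
  ultimately show ?thesis unfolding same_def by blast
qed

lemma pt_eq_iff_le:
  assumes "a' \<le> a"
  shows "pt a b = pt a' b' \<longleftrightarrow> same a b a' b'"
proof -
  have "pt a b = pt a' b' \<longleftrightarrow> pt (a' + (a - a')) (0 + b) = pt (a' + 0) (0 + b')" using assms by simp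
  also have "\<dots> \<longleftrightarrow> pt (a - a') b = pt 0 b'" by (rule pt_cancel)
  also have "\<dots> \<longleftrightarrow> same a b a' b'"
  proof
    assume eq: "pt (a - a') b = pt 0 b'"
    then have "k dvd a - a'" by (rule pt_axis)
    then obtain q where q: "a - a' = k * q" by (auto simp: dvd_def)
    have "pt 0 (b + q * s) = pt 0 b'" using eq pt_add_k[of 0 q b] by (simp add: q mult.commute)
    then have "int (b + q * s) mod int l = int b' mod int l"
      using pt_0_eq by (metis of_nat_mod)
    then have "int l dvd int b - int b' + int s * int q"
      by (simp add: mod_eq_dvd_iff algebra_simps)
    moreover have "int a - int a' = int k * int q" using q assms by (metis of_nat_diff of_nat_mult)
    ultimately show "same a b a' b'" unfolding same_def by blast
  next
    assume "same a b a' b'"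
    then obtain q where q: "int a - int a' = int k * q" "int l dvd int b - int b' + int s * q"
      by (auto simp: same_def)
    have "q \<ge> 0"
    proof (rule ccontr)
      assume "\<not> q \<ge> 0"
      then have "int k * q < 0" using k(1) by (simp add: mult_less_0_iff)
      then show False using q(1) assms by linarith
    qed
    then obtain n where n: "q = int n" using nonneg_int_cases by blast
    have a: "a - a' = n * k"
    proof -
      have "int (a - a') = int (n * k)" using q(1) assms by (simp add: n mult.commute)
      then show ?thesis by (simp only: of_nat_eq_iff)
    qed
    have "int (b + n * s) mod int l = int b' mod int l"
      using q(2) by (simp add: mod_eq_dvd_iff n algebra_simps)
    then have "(b + n * s) mod l = b' mod l" by (metis of_nat_eq_iff of_nat_mod)
    then have "pt 0 (b + n * s) = pt 0 b'" by (metis pt_mod_l)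
    then show "pt (a - a') b = pt 0 b'" using pt_add_k[of 0 n b] by (simp add: a)
  qed
  finally show ?thesis .
qed

lemma pt_eq_iff: "pt a b = pt a' b' \<longleftrightarrow> same a b a' b'"
  using pt_eq_iff_le[of a' a b b'] pt_eq_iff_le[of a a' b' b] same_sym nle_le by metis

text \<open>The box with side lengths \<open>k\<close> and \<open>l\<close> is a fundamental domain
  for the stabilizer.\<close>

lemma degree:
  assumes surj: "\<And>i. i \<in> {1..d} \<Longrightarrow> \<exists>a b. pt a b = i"
  shows "d = k * l"
proof -
  have "bij_betw (\<lambda>(a, b). pt a b) ({..<k} \<times> {..<l}) {1..d}"
    unfolding bij_betw_def
  proof
    show "inj_on (\<lambda>(a, b). pt a b) ({..<k} \<times> {..<l})"
    proof (rule inj_onI, clarsimp)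
      fix a b a' b' assume ab: "a < k" "b < l" "a' < k" "b' < l" "pt a b = pt a' b'"
      then obtain q where q: "int a - int a' = int k * q" "int l dvd int b - int b' + int s * q"
        by (auto simp: pt_eq_iff same_def)
      have "\<bar>int a - int a'\<bar> < int k" using ab by linarith
      then have "int k * \<bar>q\<bar> < int k * 1" using q(1) by (simp add: abs_mult)
      then have "q = 0" using k(1) by (simp only: mult_less_cancel_left) auto
      moreover have "\<bar>int b - int b'\<bar> < int l" using ab by linarith
      ultimately have "int b - int b' = 0" using q(2) dvd_imp_le_int[of "int b - int b'" "int l"] by fastforce
      then show "a = a' \<and> b = b'" using q(1) \<open>q = 0\<close> by simp
    qed
    show "(\<lambda>(a, b). pt a b) ` ({..<k} \<times> {..<l}) = {1..d}"
    proof
      show "(\<lambda>(a, b). pt a b) ` ({..<k} \<times> {..<l}) \<subseteq> {1..d}" using pt_range by auto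
      show "{1..d} \<subseteq> (\<lambda>(a, b). pt a b) ` ({..<k} \<times> {..<l})"
      proof
        fix i assume "i \<in> {1..d}"
        then obtain a b where i: "i = pt a b" using surj by blast
        have "pt a b = pt (a mod k) ((b + (a div k) * s) mod l)"
          using pt_add_k[of "a mod k" "a div k" b] by (simp add: pt_mod_l mod_div_mult_eq)
        then show "i \<in> (\<lambda>(a, b). pt a b) ` ({..<k} \<times> {..<l})"
          unfolding i using k(1) l(1)
          by (intro image_eqI[of _ _ "(a mod k, (b + (a div k) * s) mod l)"]) auto
      qed
    qed
  qed
  from bij_betw_same_card[OF this] show ?thesis by simp
qed

end


section \<open>Lifting the standard loops\<close>

lemma ex_root1_power:
  assumes "d > 0" "z ^ d = 1"
  shows "\<exists>a. z = root1 d ^ a"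
proof -
  have "1 \<le> d" and z: "z \<in> {z. z ^ d = 1}" using assms by simp_all
  from z show ?thesis
    unfolding complex_roots_unity[OF \<open>1 \<le> d\<close>] by (auto simp: root1_power)
qed

context toric_curve
begin

text \<open>The path is continuous already as a path of nonzero vectors, and \<open>line\<close> is
  continuous by the definition of the quotient topology.\<close>

lemma lift_path:
  assumes cont: "continuous_on {0..1} x" "continuous_on {0..1} y"
    and eq: "\<And>t. t \<in> {0..1} \<Longrightarrow> x t ^ d + y t ^ d = 1" "\<And>t. t \<in> {0..1} \<Longrightarrow> x t ^ d = c t"
  shows "lifts_from_to N curve belyi_map c (line (toric_map (vec3 (x 0) (y 0) 1)))
    (line (toric_map (vec3 (x 1) (y 1) 1)))"
proof -
  define w where "w t = toric_map (vec3 (x t) (y t) 1)" for t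
  have w: "w t \<in> vecs N - {0}" "line (w t) \<in> curve" if "t \<in> {0..1}" for t
    using toric_map_vecs vec3_nonzero[of "x t" "y t" 1] vec3_in_curve[of "x t" "y t" 1] eq(1)[OF that]
    by (auto simp: w_def)
  have w_cont: "continuous_on {0..1} w"
  proof (rule continuous_on_coordinatewise_then_product)
    fix i
    show "continuous_on {0..1} (\<lambda>t. w t i)"
      unfolding w_def toric_map_vec3 by (cases "i \<le> N") (auto intro!: continuous_intros cont)
  qed
  have "pathin (subtopology (proj_top N) curve) (\<lambda>t. line (w t))"
    unfolding pathin_def continuous_map_in_subtopology
  proof
    show "continuous_map (top_of_set {0..1}) (proj_top N) (\<lambda>t. line (w t))"
      unfolding continuous_map_def topspace_proj_top topspace_euclidean_subtopology
    proof (intro conjI allI impI funcsetI)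
      show "line (w t) \<in> proj N" if "t \<in> {0..1}" for t
        using w(1)[OF that] by (auto simp: proj_def)
      fix U assume "openin (proj_top N) U"
      then have "openin (top_of_set (vecs N - {0})) {v \<in> vecs N - {0}. line v \<in> U}"
        by (simp add: openin_proj_top)
      then have "openin (top_of_set {0..1}) ({0..1} \<inter> w -` {v \<in> vecs N - {0}. line v \<in> U})"
        using continuous_openin_preimage[OF w_cont, of "vecs N - {0}"] w(1) by blast
      also have "{0..1} \<inter> w -` {v \<in> vecs N - {0}. line v \<in> U} = {t \<in> {0..1}. line (w t) \<in> U}"
        using w(1) by auto
      finally show "openin (top_of_set {0..1}) {t \<in> {0..1}. line (w t) \<in> U}" .
    qed
    show "(\<lambda>t. line (w t)) \<in> topspace (top_of_set {0..1}) \<rightarrow> curve" using w(2) by auto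
  qed
  moreover have "belyi_map (line (w t)) = affine_pt (c t)" if "t \<in> {0..1}" for t
    using belyi_map_affine[OF w(2)[OF that] line_self, of "c t"] w(1)[OF that] eq(2)[OF that]
    by (simp add: w_def toric_map_vec3_V)
  ultimately show ?thesis
    unfolding lifts_from_to_def by (intro exI[of _ "\<lambda>t. line (w t)"]) (simp add: w_def)
qed

definition rho :: complex where "rho = of_real (root d (1 / 2))"

lemma rho: "rho ^ d = 1 / 2" "rho \<noteq> 0"
  using d_pos by (simp_all add: rho_def flip: of_real_power)

text \<open>With z = 1, both x^d and y^d equal 1/2 over the base point. Different pairs of exponents
  may give the same point of the quotient curve.\<close>

definition fibre_pt :: "nat \<Rightarrow> nat \<Rightarrow> point"
  where "fibre_pt a b = line (toric_map (vec3 (rho * root1 d ^ a) (rho * root1 d ^ b) 1))"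

lemma root1_power_d: "(root1 d ^ a) ^ d = 1"
  using root1_power_self[OF d_pos] by (metis mult.commute power_mult power_one)

lemma fibre: "{L \<in> curve. belyi_map L = affine_pt (1 / 2)} = {fibre_pt a b | a b. True}"
proof (intro equalityI subsetI)
  fix L assume "L \<in> {L \<in> curve. belyi_map L = affine_pt (1 / 2)}"
  then have L: "L \<in> curve" "belyi_map L = affine_pt (1 / 2)" by auto
  from L(1) show "L \<in> {fibre_pt a b | a b. True}"
  proof (cases rule: curve_cases)
    case (1 x y)
    have x: "x ^ d = 1 / 2"
      using belyi_map_affine[OF L(1), of "toric_map (vec3 x y 1)" "1 / 2"] L(2) line_self vec3_nonzero[of x y 1]
      by (simp add: 1(1) toric_map_vec3_V)
    have "y ^ d = 1 - x ^ d" using 1(2) by (simp add: algebra_simps)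
    then have "y ^ d = 1 / 2" by (simp add: x)
    with x have "(x / rho) ^ d = 1" "(y / rho) ^ d = 1" by (simp_all add: power_divide rho)
    then obtain a b where "x / rho = root1 d ^ a" "y / rho = root1 d ^ b"
      using ex_root1_power[OF d_pos] by metis
    then have "x = rho * root1 d ^ a" "y = rho * root1 d ^ b" using rho(2) by (simp_all add: field_simps)
    then show ?thesis using 1(1) unfolding fibre_pt_def by blast
  next
    case (2 y)
    then show ?thesis
      using belyi_map_affine[OF L(1), of "toric_map (vec3 1 y 0)" "1 / 2"] L(2) line_self
        vec3_nonzero[of 1 y 0] d_pos
      by (simp add: 2(1) toric_map_vec3_V zero_power)
  qed
next
  fix L assume "L \<in> {fibre_pt a b | a b. True}"
  then obtain a b where L: "L = fibre_pt a b" by auto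
  let ?v = "toric_map (vec3 (rho * root1 d ^ a) (rho * root1 d ^ b) 1)"
  have "line ?v \<in> curve"
    by (rule vec3_in_curve) (simp_all add: power_mult_distrib root1_power_d rho)
  moreover have "belyi_map (line ?v) = affine_pt (1 / 2)"
    using belyi_map_affine[OF \<open>line ?v \<in> curve\<close> line_self, of "1 / 2"] vec3_nonzero[of _ _ 1]
    by (simp add: toric_map_vec3_V power_mult_distrib root1_power_d rho)
  ultimately show "L \<in> {L \<in> curve. belyi_map L = affine_pt (1 / 2)}"
    by (simp add: L fibre_pt_def)
qed

text \<open>Coordinate \<open>V 2\<close> equals 1 on both representatives, so equal lines have
  equal vectors, and these are compared as powers of \<open>root1 d\<close>.\<close>

lemma fibre_pt_eq_iff:
  "fibre_pt a b = fibre_pt a' b' \<longleftrightarrow>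
    (\<forall>c\<le>N. (a * E c 0 + b * E c 1) mod d = (a' * E c 0 + b' * E c 1) mod d)"
proof -
  define v where "v a b = toric_map (vec3 (rho * root1 d ^ a) (rho * root1 d ^ b) 1)" for a b
  have v: "v a b c = (if c \<le> N then rho ^ (E c 0 + E c 1) * root1 d ^ (a * E c 0 + b * E c 1) else 0)" for a b c
    by (simp add: v_def toric_map_vec3 power_mult_distrib power_add power_mult)
  have v2: "v a b (V 2) = 1" for a b by (simp add: v_def toric_map_vec3_V)
  have "fibre_pt a b = fibre_pt a' b' \<longleftrightarrow> v a b = v a' b'"
  proof
    assume "fibre_pt a b = fibre_pt a' b'"
    then have "v a b \<in> line (v a' b')" unfolding fibre_pt_def v_def by (metis line_self)
    then obtain r where r: "v a b = (\<lambda>i. r * v a' b' i)" by (auto simp: line_eq)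
    from fun_cong[OF r, of "V 2"] have "r = 1" by (simp add: v2)
    then show "v a b = v a' b'" using r by simp
  qed (simp add: fibre_pt_def v_def)
  also have "\<dots> \<longleftrightarrow> (\<forall>c\<le>N. root1 d ^ (a * E c 0 + b * E c 1) = root1 d ^ (a' * E c 0 + b' * E c 1))"
    using rho(2) by (auto simp: fun_eq_iff v)
  finally show ?thesis by (simp add: root1_power_eq_iff[OF d_pos])
qed

text \<open>On the circle around 0, x^d turns once around 0, so x (the path \<open>m\<close>) gains
  the factor \<open>root1 d\<close>, while y^d = 1 - x^d stays in the right half plane and the
  principal logarithm brings y (the path \<open>f\<close>) back. The circle around 1 is the same
  with x and y exchanged.\<close>

lemma fibre_lifts:
  "lifts_from_to N curve belyi_map (circlepath 0 (1 / 2)) (fibre_pt a b) (fibre_pt (Suc a) b)"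
  "lifts_from_to N curve belyi_map (circlepath 1 (- 1 / 2)) (fibre_pt a b) (fibre_pt a (Suc b))"
proof -
  define p where "p t = exp (2 * of_real pi * \<i> * of_real t)" for t
  define m where "m n t = rho * root1 d ^ n * exp (2 * of_real pi * \<i> * of_real t / of_nat d)" for n t
  define f where "f n t = rho * root1 d ^ n * exp (Ln (2 - p t) / of_nat d)" for n t
  have norm: "norm (p t) = 1" for t by (simp add: p_def norm_exp_eq_Re)
  have re: "Re (2 - p t) > 0" for t
    using complex_Re_le_cmod[of "p t"] norm[of t] by simp
  then have nz: "2 - p t \<noteq> 0" for t by (metis less_irrefl zero_complex.simps(1))
  have m_pow: "m n t ^ d = p t / 2" for n t
    using d_pos by (simp add: m_def p_def power_mult_distrib root1_power_d rho flip: exp_of_nat_mult)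
  have f_pow: "f n t ^ d = 1 - p t / 2" for n t
    using d_pos nz[of t] by (simp add: f_def power_mult_distrib root1_power_d rho diff_divide_distrib flip: exp_of_nat_mult)
  have p_cont: "continuous_on {0..1} p" unfolding p_def by (intro continuous_intros)
  have m_cont: "continuous_on {0..1} (m n)" for n unfolding m_def by (intro continuous_intros) (use d_pos in auto)
  have "2 - p t \<notin> \<real>\<^sub>\<le>\<^sub>0" for t using re[of t] by (auto simp: complex_nonpos_Reals_iff)
  then have f_cont: "continuous_on {0..1} (f n)" for n
    unfolding f_def by (intro continuous_intros p_cont) (use d_pos in auto)
  have p01: "p 0 = 1" "p 1 = 1" by (simp_all add: p_def)
  have ends: "m n 0 = rho * root1 d ^ n" "m n 1 = rho * root1 d ^ Suc n"
    "f n 0 = rho * root1 d ^ n" "f n 1 = rho * root1 d ^ n" for n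
    by (simp_all add: m_def f_def p01 root1_def)
  have "lifts_from_to N curve belyi_map (circlepath 0 (1 / 2))
     (line (toric_map (vec3 (m a 0) (f b 0) 1))) (line (toric_map (vec3 (m a 1) (f b 1) 1)))"
    by (rule lift_path[OF m_cont f_cont]) (simp_all add: m_pow f_pow circlepath p_def)
  then show "lifts_from_to N curve belyi_map (circlepath 0 (1 / 2)) (fibre_pt a b) (fibre_pt (Suc a) b)"
    by (simp add: ends fibre_pt_def)
  have "lifts_from_to N curve belyi_map (circlepath 1 (- 1 / 2))
     (line (toric_map (vec3 (f a 0) (m b 0) 1))) (line (toric_map (vec3 (f a 1) (m b 1) 1)))"
    by (rule lift_path[OF f_cont m_cont]) (simp_all add: m_pow f_pow circlepath p_def)
  then show "lifts_from_to N curve belyi_map (circlepath 1 (- 1 / 2)) (fibre_pt a b) (fibre_pt a (Suc b))"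
    by (simp add: ends fibre_pt_def)
qed

end


section \<open>Abelian child's drawings\<close>

text \<open>The number g^a h^b 1 goes to \<open>C.fibre_pt a b\<close>. This is well defined and
  injective because both sides identify exponents modulo the same lattice: the stabilizer of 1,
  which is also the annihilator modulo d of the invariant monomials.\<close>

lemma (in commuting_pair) fibre_numbering:
  assumes surj: "\<And>i. i \<in> {1..d} \<Longrightarrow> \<exists>a b. pt a b = i"
    and \<psi>: "\<psi> \<in> D" "\<psi> F2_x = g" "\<psi> F2_y = h"
  shows "admits_belyi_pair_over_Q d D"
proof -
  interpret M: invariant_monomials k l s
    by unfold_locales (use k(1) l(1) s(1) in auto)
  have dkl: "k * l = d" by (rule degree[OF surj, symmetric])
  then have idkl: "int d = int k * int l" by (metis of_nat_mult)
  obtain N E V where curve: "toric_curve (k * l) N E V" and E: "\<And>c. c \<le> N \<Longrightarrow> E c \<in> M.exponents"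
    and E_surj: "\<And>f. f \<in> M.exponents \<Longrightarrow> \<exists>c\<le>N. E c = f"
    using M.ex_toric_curve by metis
  have "toric_curve d N E V" using curve by (simp only: dkl)
  then interpret C: toric_curve d N E V .
  have inv: "(a * E c 0 + b * E c 1) mod d = (a' * E c 0 + b' * E c 1) mod d \<longleftrightarrow>
      int d dvd (int a - int a') * int (E c 0) + (int b - int b') * int (E c 1)" for a b a' b' c
  proof -
    have "(a * E c 0 + b * E c 1) mod d = (a' * E c 0 + b' * E c 1) mod d \<longleftrightarrow>
      int (a * E c 0 + b * E c 1) mod int d = int (a' * E c 0 + b' * E c 1) mod int d"
      by (simp only: of_nat_mod[symmetric] of_nat_eq_iff)
    also have "\<dots> \<longleftrightarrow> int d dvd (int a - int a') * int (E c 0) + (int b - int b') * int (E c 1)"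
      by (simp add: mod_eq_dvd_iff algebra_simps)
    finally show ?thesis .
  qed
  have fibre_eq: "C.fibre_pt a b = C.fibre_pt a' b' \<longleftrightarrow> same a b a' b'" for a b a' b'
    unfolding C.fibre_pt_eq_iff inv
  proof
    assume R: "\<forall>c\<le>N. int d dvd (int a - int a') * int (E c 0) + (int b - int b') * int (E c 1)"
    then have R': "int d dvd (int a - int a') * int (f 0) + (int b - int b') * int (f 1)" if "f \<in> M.exponents" for f
      using E_surj[OF that] by blast
    obtain f1 f2 where f: "f1 \<in> M.exponents" "f1 0 = l" "f1 1 = 0" "f2 \<in> M.exponents" "f2 0 = s" "f2 1 = k"
      using M.exponents_generators by blast
    have "int k * int l dvd (int a - int a') * int l" using R'[OF f(1)] unfolding f idkl by simp
    then have "int k dvd int a - int a'" using l(1) by auto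
    then obtain q where q: "int a - int a' = int k * q" by (auto simp: dvd_def)
    have "int k * int l dvd int k * (int b - int b' + int s * q)"
      using R'[OF f(4)] unfolding f idkl q by (simp add: algebra_simps)
    then have "int l dvd int b - int b' + int s * q" using k(1) by auto
    then show "same a b a' b'" using q unfolding same_def by blast
  next
    assume "same a b a' b'"
    then obtain q n where q: "int a - int a' = int k * q" "int b - int b' + int s * q = int l * n"
      by (auto simp: same_def dvd_def)
    show "\<forall>c\<le>N. int d dvd (int a - int a') * int (E c 0) + (int b - int b') * int (E c 1)"
    proof (intro allI impI)
      fix c assume "c \<le> N"
      then have "int d dvd int l * int (E c 1)" "int d dvd int k * int (E c 0) - int s * int (E c 1)"
        using E[of c] by (auto simp: M.exponents_def M.invariant_def idkl)
      then have "int d dvd n * (int l * int (E c 1)) + q * (int k * int (E c 0) - int s * int (E c 1))"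
        by (rule dvd_add[OF dvd_mult dvd_mult])
      also have "n * (int l * int (E c 1)) + q * (int k * int (E c 0) - int s * int (E c 1)) =
          int k * q * int (E c 0) + (int l * n - int s * q) * int (E c 1)"
        by (simp add: algebra_simps)
      also have "\<dots> = (int a - int a') * int (E c 0) + (int b - int b') * int (E c 1)"
        by (simp add: q(1) q(2)[symmetric])
      finally show "int d dvd (int a - int a') * int (E c 0) + (int b - int b') * int (E c 1)" .
    qed
  qed
  have "\<forall>i\<in>{1..d}. \<exists>ab. pt (fst ab) (snd ab) = i" using surj by simp
  then obtain r where r: "\<And>i. i \<in> {1..d} \<Longrightarrow> pt (fst (r i)) (snd (r i)) = i" by metis
  define b where "b i = C.fibre_pt (fst (r i)) (snd (r i))" for i
  have b_pt: "b (pt a' b') = C.fibre_pt a' b'" for a' b'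
    unfolding b_def fibre_eq using r[OF pt_range] pt_eq_iff by metis
  have "corresponds d D N C.curve C.belyi_map"
    unfolding corresponds_def
  proof (intro bexI[of _ \<psi>] exI[of _ b] conjI ballI)
    show "bij_betw b {1..d} {L \<in> C.curve. C.belyi_map L = affine_pt (1 / 2)}"
      unfolding bij_betw_def C.fibre
    proof
      show "inj_on b {1..d}"
      proof (rule inj_onI)
        fix i j assume ij: "i \<in> {1..d}" "j \<in> {1..d}" "b i = b j"
        then show "i = j" using r unfolding b_def fibre_eq by (metis pt_eq_iff)
      qed
      show "b ` {1..d} = {C.fibre_pt a b | a b. True}"
      proof (intro equalityI subsetI)
        fix L assume "L \<in> {C.fibre_pt a b | a b. True}"
        then obtain a' b' where "L = b (pt a' b')" by (auto simp: b_pt)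
        then show "L \<in> b ` {1..d}" using pt_range by blast
      qed (auto simp: b_def)
    qed
    fix i assume "i \<in> {1..d}"
    then obtain a' b' where i: "i = pt a' b'" using surj by metis
    show "lifts_from_to N C.curve C.belyi_map (circlepath 0 (1 / 2)) (b i) (b (\<psi> F2_x i))"
      unfolding \<psi> i pt_Suc b_pt by (rule C.fibre_lifts)
    show "lifts_from_to N C.curve C.belyi_map (circlepath 1 (- 1 / 2)) (b i) (b (\<psi> F2_y i))"
      unfolding \<psi> i pt_Suc b_pt by (rule C.fibre_lifts)
  qed (rule \<psi>)
  then show ?thesis by (rule C.admits_belyi_pair_if_corresponds)
qed

text \<open>Words contain inverse letters, but \<open>pt\<close> has only nonnegative powers. An
  injective map of the finite orbit into itself is onto, so inverses preserve the orbit too.\<close>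

lemma (in commuting_pair) orbit_closed:
  assumes hom: "\<psi> \<in> hom F2 (sym_group d)" and xy: "\<psi> F2_x = g" "\<psi> F2_y = h"
    and w: "w \<in> carrier F2" and i: "\<exists>a b. i = pt a b"
  shows "\<exists>a b. \<psi> w i = pt a b"
  using w i
proof (induction w arbitrary: i)
  case Nil
  interpret group_hom F2 "sym_group d" \<psi>
    using group_F2 sym_group_is_group hom by (simp add: group_hom_def group_hom_axioms_def)
  have "\<psi> [] = id" using hom_one by (simp add: F2_def sym_group_one)
  then show ?case using Nil by simp
next
  case (Cons a w)
  interpret group_hom F2 "sym_group d" \<psi>
    using group_F2 sym_group_is_group hom by (simp add: group_hom_def group_hom_axioms_def)
  have w: "[a] \<in> carrier F2" "w \<in> carrier F2" "a # w = [a] \<otimes>\<^bsub>F2\<^esub> w"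
    using Cons.prems by (auto simp: F2_def reduced_Cons push_def)
  define Orb where "Orb = {pt a b | a b. True}"
  have "Orb \<subseteq> {1..d}" using pt_range unfolding Orb_def by blast
  then have finOrb: "finite Orb" by (rule finite_subset) simp
  have pos: "\<psi> [(True, c)] ` Orb \<subseteq> Orb" for c
  proof -
    have "\<psi> [(True, c)] = g \<or> \<psi> [(True, c)] = h"
      using xy by (cases c) (simp_all add: F2_x_def F2_y_def)
    moreover have "g j \<in> Orb" "h j \<in> Orb" if "j \<in> Orb" for j
      using that pt_Suc unfolding Orb_def by blast+
    ultimately show ?thesis by (metis image_subsetI)
  qed
  have "\<psi> [a] j \<in> Orb" if j: "j \<in> Orb" for j
  proof (cases a)
    case (Pair sgn c)
    have car: "[(True, c)] \<in> carrier F2" "[(False, c)] \<in> carrier F2" by (simp_all add: F2_def)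
    show ?thesis
    proof (cases sgn)
      case True
      then show ?thesis using pos[of c] j Pair by auto
    next
      case False
      have "inj (\<psi> [(True, c)])"
        using hom_closed[OF car(1)] permutes_inj by (auto simp: sym_group_carrier)
      then have "\<psi> [(True, c)] ` Orb = Orb"
        by (intro endo_inj_surj finOrb pos) (rule inj_on_subset, auto)
      then have "j \<in> \<psi> [(True, c)] ` Orb" using j by simp
      then obtain i where i: "i \<in> Orb" "\<psi> [(True, c)] i = j" by blast
      have "[(False, c)] \<otimes>\<^bsub>F2\<^esub> [(True, c)] = \<one>\<^bsub>F2\<^esub>"
        by (simp add: F2_def push_def letter_inv_def)
      then have "\<psi> [(False, c)] \<circ> \<psi> [(True, c)] = id"
        using hom_mult[OF car(2,1)] hom_one by (simp add: sym_group_mult sym_group_one)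
      then have "\<psi> [(False, c)] j = i" using i(2) by (metis comp_apply id_apply)
      then show ?thesis using i Pair False by simp
    qed
  qed
  moreover have "\<psi> (a # w) i = \<psi> [a] (\<psi> w i)"
    using hom_mult[OF w(1,2)] w(3) by (simp add: sym_group_mult)
  ultimately show ?case using Cons.IH[OF w(2) Cons.prems(2)] by (auto simp: Orb_def)
qed

theorem corollary4p8:
  fixes d :: nat and D :: "(letter list \<Rightarrow> nat \<Rightarrow> nat) set"
  assumes "childs_drawing d D" and "abelian_drawing d D"
  shows "admits_belyi_pair_over_Q d D"
proof -
  obtain \<psi>0 where d: "d \<ge> 1" and \<psi>0: "\<psi>0 \<in> hom F2 (sym_group d)" "transitive_hom d \<psi>0"
    "D = drawing_of d \<psi>0"
    using assms(1) by (auto simp: childs_drawing_def)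
  obtain \<psi> where \<psi>: "\<psi> \<in> D" "comm_group ((sym_group d)\<lparr>carrier := \<psi> ` carrier F2\<rparr>)"
    using assms(2) by (auto simp: abelian_drawing_def)
  then obtain \<sigma> where hom: "\<psi> \<in> hom F2 (sym_group d)" and \<sigma>: "\<sigma> permutes {1..d}"
    and conj: "\<And>w. w \<in> carrier F2 \<Longrightarrow> \<psi> w = \<sigma> \<circ> \<psi>0 w \<circ> inv' \<sigma>"
    using \<psi>0(3) by (auto simp: drawing_of_def sym_group_carrier sym_group_mult)
  have xy: "F2_x \<in> carrier F2" "F2_y \<in> carrier F2" by (simp_all add: F2_def F2_x_def F2_y_def)
  define g where "g = \<psi> F2_x"
  define h where "h = \<psi> F2_y"
  interpret A: comm_group "(sym_group d)\<lparr>carrier := \<psi> ` carrier F2\<rparr>" by (rule \<psi>(2))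
  have "g \<circ> h = h \<circ> g"
    using A.m_comm[of g h] xy by (simp add: g_def h_def sym_group_mult)
  moreover have "g permutes {1..d}" "h permutes {1..d}"
    using hom xy by (auto simp: g_def h_def hom_def sym_group_carrier)
  ultimately interpret P: commuting_pair d g h
    using d by unfold_locales (auto simp: fun_eq_iff)
  \<comment> \<open>Transitivity is given for \<open>\<psi>0\<close> and the Abelian group for the
    conjugate \<open>\<psi>\<close>; conjugation by \<open>\<sigma>\<close> transfers the
    former.\<close>
  have "\<exists>a b. P.pt a b = i" if i: "i \<in> {1..d}" for i
  proof -
    have inv: "inv' \<sigma> j \<in> {1..d}" if "j \<in> {1..d}" for j
      using permutes_in_image[OF permutes_inv[OF \<sigma>]] that by blast
    have "1 \<in> {1..d}" using d by simp
    then obtain w where w: "w \<in> carrier F2" "\<psi>0 w (inv' \<sigma> 1) = inv' \<sigma> i"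
      using \<psi>0(2) inv i unfolding transitive_hom_def by metis
    have "\<psi> w 1 = i"
      using conj[OF w(1)] w(2) permutes_inverses(1)[OF \<sigma>] by simp
    moreover have "1 = P.pt 0 0" by (simp add: P.pt_def)
    ultimately show ?thesis
      using P.orbit_closed[OF hom g_def[symmetric] h_def[symmetric] w(1), of 1] by metis
  qed
  then show ?thesis
    using P.fibre_numbering \<psi>(1) g_def h_def by blast
qed

end
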